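(* Let $\alpha(n)$ be defined by $$\sum_{n=0}^\infty \alpha(n)q^n=\prod_{n=1}^\infty\frac{(1-q^{2n})^3}{(1-q^n)^2},$$ with the convention that $\alpha(x)=0$ whenever $x$ is not a nonnegative integer. Let $\ell>3$ be prime and $N_\ell=\frac{1}{6}(\ell^2-1)$. Then for every nonnegative integer $n$, $$\ell\,\alpha(\ell^2 n+N_\ell)+\left(\frac{-1}{\ell}\right)\left(\frac{N_\ell-n}{\ell}\right)\alpha(n)+\alpha\!\left(\frac{n-N_\ell}{\ell^2}\right)\equiv c_\ell\,\alpha(n)\pmod{2^{12}},$$ where $c_\ell=\ell\,\alpha(N_\ell)+\left(\frac{6}{\ell}\right)$.
   Context: $\left(\frac{\cdot}{\ell}\right)$ denotes the Legendre symbol (equal to $0$ when $\ell$ divides the top entry). The numbers $\alpha(n)$ satisfy $\overline{\mathcal{EO}}(2m)=\alpha(m)$, where $\overline{\mathcal{EO}}(n)$ is Andrews's function counting partitions of $n$ in which every even part is less than each odd part and only the largest even part occurs an odd number of times. *)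

theory Defs
  imports "HOL-Analysis.Analysis" "HOL-Number_Theory.Number_Theory"
begin

(* The factor (1 - q^{2m})^3 / (1 - q^m)^2 with m = n + 1.  The type int has no field
   inverse, so the quotient is taken via the right inverse in the power series ring; the 1 is the
   inverse of the constant coefficient. *)
definition alpha_factor :: "nat \<Rightarrow> int fps" where
  "alpha_factor n =
     (1 - fps_X ^ (2 * Suc n)) ^ 3 * fps_right_inverse ((1 - fps_X ^ Suc n) ^ 2) 1"

(* The infinite product is taken in the library's (X-adic) topology on formal power series. *)
definition alpha_gf :: "int fps" where
  "alpha_gf = (\<Prod>n. alpha_factor n)"

definition alpha :: "rat \<Rightarrow> int" where
  "alpha x = (if x \<in> \<nat> then fps_nth alpha_gf (nat \<lfloor>x\<rfloor>) else 0)"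

(* The division is exact for every prime l > 3; see six_N_ell below. *)
definition N_ell :: "nat \<Rightarrow> int" where
  "N_ell l = (int l ^ 2 - 1) div 6"

definition c_ell :: "nat \<Rightarrow> int" where
  "c_ell l = int l * alpha (of_int (N_ell l)) + Legendre 6 (int l)"

lemma alpha_factor_times:
  "alpha_factor n * (1 - fps_X ^ Suc n) ^ 2 = (1 - fps_X ^ (2 * Suc n)) ^ 3"
proof -
  have "fps_right_inverse ((1 - fps_X ^ Suc n) ^ 2) 1 * (1 - fps_X ^ Suc n :: int fps) ^ 2 = 1"
    by (subst mult.commute, rule fps_right_inverse) (simp add: fps_nth_power_0)
  then show ?thesis
    unfolding alpha_factor_def by (simp only: mult.assoc mult_1_right)
qed

lemma alpha_factor_nth:
  assumes "0 < k" "k \<le> n"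
  shows "fps_nth (alpha_factor n) k = 0"
proof -
  define x where "x = (fps_X ^ Suc n :: int fps)"
  define g where "g = fps_right_inverse ((1 - x) ^ 2) 1"
  have 1: "(1 - x) ^ 2 * g = 1"
    unfolding g_def by (rule fps_right_inverse) (simp add: fps_nth_power_0 x_def)
  have "alpha_factor n = (1 - x ^ 2) ^ 3 * g"
    unfolding alpha_factor_def g_def x_def by (simp only: power_mult mult.commute [of 2])
  also have "(1 - x ^ 2) ^ 3 = (1 - x) ^ 2 + x * (2 - 4 * x + 3 * x ^ 3 - x ^ 5)"
    by (simp add: eval_nat_numeral algebra_simps)
  also have "\<dots> * g = 1 + x * ((2 - 4 * x + 3 * x ^ 3 - x ^ 5) * g)"
    using 1 by (simp only: distrib_right mult.assoc)
  finally have "alpha_factor n = 1 + fps_X ^ Suc n * ((2 - 4 * x + 3 * x ^ 3 - x ^ 5) * g)"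
    by (simp only: x_def)
  then show ?thesis
    using assms by (simp add: fps_X_power_mult_nth del: power_Suc)
qed

lemma alpha_factor_nth_0: "fps_nth (alpha_factor n) 0 = 1"
  by (simp add: alpha_factor_def fps_nth_power_0)

lemma alpha_factor_nonzero: "alpha_factor n \<noteq> 0"
  using alpha_factor_nth_0 [of n] by auto

lemma alpha_partial_nth:
  assumes "k \<le> n"
  shows "fps_nth (\<Prod>i\<le>n. alpha_factor i) k = fps_nth (\<Prod>i\<le>k. alpha_factor i) k"
  using assms
proof (induction n rule: dec_induct)
  case (step n)
  have "fps_nth (\<Prod>i\<le>Suc n. alpha_factor i) k =
      (\<Sum>j=0..k. fps_nth (\<Prod>i\<le>n. alpha_factor i) j * fps_nth (alpha_factor (Suc n)) (k - j))"
    by (simp add: fps_mult_nth)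
  also have "\<dots> = (\<Sum>j=0..k. if j = k then fps_nth (\<Prod>i\<le>n. alpha_factor i) j else 0)"
    using step.hyps by (intro sum.cong) (auto simp: alpha_factor_nth alpha_factor_nth_0)
  finally show ?case using step.IH by simp
qed simp

lemma alpha_gf_has_prod: "alpha_factor has_prod alpha_gf"
proof -
  define L where "L = Abs_fps (\<lambda>k. fps_nth (\<Prod>i\<le>k. alpha_factor i) k)"
  have lim: "(\<lambda>n. \<Prod>i\<le>n. alpha_factor i) \<longlonglongrightarrow> L"
  proof (rule tendsto_fpsI)
    fix k
    show "\<forall>\<^sub>F n in sequentially. fps_nth (\<Prod>i\<le>n. alpha_factor i) k = fps_nth L k"
      unfolding L_def fps_nth_Abs_fps
      using eventually_ge_at_top [of k] by eventually_elim (rule alpha_partial_nth)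
  qed
  have "fps_nth L 0 = 1"
    by (simp add: L_def alpha_factor_nth_0)
  then have "L \<noteq> 0" by auto
  with lim have "alpha_factor has_prod L"
    by (simp add: has_prod_def raw_has_prod_def)
  moreover have "p = L" if "alpha_factor has_prod p" for p
    using that lim
    by (auto simp: has_prod_def raw_has_prod_def alpha_factor_nonzero intro: LIMSEQ_unique)
  ultimately show ?thesis
    unfolding alpha_gf_def prodinf_def by (rule theI)
qed

lemma alpha_of_nat: "alpha (of_nat n) = fps_nth alpha_gf n"
  by (simp add: alpha_def)

lemma six_N_ell:
  assumes "prime l" "l > 3"
  shows "6 * N_ell l = int l ^ 2 - 1"
proof -
  have "\<not> 2 dvd l" "\<not> 3 dvd l"
    using assms primes_dvd_imp_eq [of 2 l] primes_dvd_imp_eq [of 3 l] by auto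
  then have "int l mod 6 = 1 \<or> int l mod 6 = 5" by presburger
  then have "(int l ^ 2) mod 6 = 1 mod 6"
    using power_mod [of "int l" 6 2] by auto
  then have "6 dvd int l ^ 2 - 1"
    by (simp only: mod_eq_dvd_iff)
  then show ?thesis by (simp add: N_ell_def)
qed

end

theory Submission
  imports Defs "HOL-Complex_Analysis.Complex_Analysis" "HOL-Probability.Probability"
begin

text \<open>
  Let \<open>F = eta(2z)^3 / eta(z)^2\<close>, whose coefficients are the \<open>\<alpha>(n)\<close>, and
  \<open>G = eta(z)^3 / eta(2z)^2\<close>; the Fricke involution \<open>z \<mapsto> -1/(2z)\<close> exchanges them up to a factor
  of weight 1/2.  Poisson summation for the theta series of \<open>eta\<close> twisted by \<open>e(b n^2 / c)\<close> and the
  evaluation of quadratic Gauss sums for \<open>c = l, l^2\<close> show that the Hecke operator \<open>T(l^2)\<close> respects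
  this exchange, so the involution turns \<open>F|T / F\<close> into \<open>G|T / G\<close>.  The latter is a Laurent series
  in \<open>q\<close> with integral coefficients and a pole at \<open>q = 0\<close>.  With \<open>t = (eta(2z) / eta(z))^24\<close>, some
  integral polynomial \<open>P(1/t)\<close> agrees with it up to terms vanishing at \<open>q = 0\<close>.  The involution
  sends \<open>1/t\<close> to \<open>2^12 t\<close>, hence it exchanges \<open>F|T / F - P(2^12 t)\<close> and \<open>G|T / G - P(1/t)\<close>, both
  holomorphic in the disc \<open>|q| < 1\<close>.  Their sum and product are invariant under the involution,
  hence constant by the maximum principle, and so both functions vanish.  Thus
  \<open>F|T / F = P(2^12 t)\<close> is congruent to a constant modulo \<open>2^12\<close>.
\<close>

section \<open>Integral power series on the unit disc\<close>

definition complex_fps :: "int fps \<Rightarrow> complex fps" where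
  "complex_fps f = Abs_fps (\<lambda>n. of_int (fps_nth f n))"

lemma complex_fps_nth [simp]: "fps_nth (complex_fps f) n = of_int (fps_nth f n)"
  by (simp add: complex_fps_def)

lemma complex_fps_eq_iff [simp]: "complex_fps f = complex_fps g \<longleftrightarrow> f = g"
  by (simp add: fps_eq_iff)

lemma complex_fps_hom [simp]:
  "complex_fps 0 = 0" "complex_fps 1 = 1" "complex_fps fps_X = fps_X"
  "complex_fps (fps_const c) = fps_const (of_int c)"
  "complex_fps (f + g) = complex_fps f + complex_fps g"
  "complex_fps (f - g) = complex_fps f - complex_fps g"
  "complex_fps (f * g) = complex_fps f * complex_fps g"
  by (rule fps_ext; simp add: fps_mult_nth)+

lemma complex_fps_compose_X_power: "complex_fps (f oo fps_X ^ k) = complex_fps f oo fps_X ^ k"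
  by (rule fps_ext) (simp add: fps_nth_compose_X_power)

definition disc_fps :: "int fps \<Rightarrow> (complex \<Rightarrow> complex) \<Rightarrow> bool" where
  "disc_fps f \<phi> \<longleftrightarrow> \<phi> holomorphic_on ball 0 1 \<and> \<phi> has_fps_expansion complex_fps f"

lemma disc_fps_holomorphic: "disc_fps f \<phi> \<Longrightarrow> \<phi> holomorphic_on ball 0 1"
  by (simp add: disc_fps_def)

lemma disc_fps_sums:
  assumes "disc_fps f \<phi>" "norm q < 1"
  shows "(\<lambda>n. of_int (fps_nth f n) * q ^ n) sums \<phi> q"
proof -
  have "\<phi> holomorphic_on eball 0 (ereal 1)"
    using assms(1) by (simp add: disc_fps_def)
  then show ?thesis
    using has_fps_expansion_imp_sums_complex [of \<phi> "complex_fps f" "ereal 1" q] assms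
    by (simp add: disc_fps_def)
qed

lemma disc_fpsI:
  assumes sums: "\<And>q. norm q < 1 \<Longrightarrow> (\<lambda>n. of_int (fps_nth f n) * q ^ n) sums \<phi> q"
  shows "disc_fps f \<phi>"
  unfolding disc_fps_def
proof
  show "\<phi> holomorphic_on ball 0 1"
    by (rule power_series_holomorphic [where a = "\<lambda>n. of_int (fps_nth f n)"]) (simp add: sums)
  have "\<forall>\<^sub>F q in nhds 0. q \<in> ball (0 :: complex) 1"
    by (rule eventually_nhds_in_open) auto
  then show "\<phi> has_fps_expansion complex_fps f"
    by (intro has_fps_expansionI) (auto elim!: eventually_mono simp: sums)
qed

lemma disc_fps_at_0: "disc_fps f \<phi> \<Longrightarrow> \<phi> 0 = of_int (fps_nth f 0)"
  by (auto simp: disc_fps_def dest: has_fps_expansion_imp_0_eq_fps_nth_0)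

lemma disc_fps_unique: "disc_fps f \<phi> \<Longrightarrow> disc_fps g \<phi> \<Longrightarrow> f = g"
  by (auto simp: disc_fps_def dest: fps_expansion_unique_complex)

lemma disc_fps_cong:
  "disc_fps f \<phi> \<Longrightarrow> (\<And>q. norm q < 1 \<Longrightarrow> \<phi> q = \<gamma> q) \<Longrightarrow> disc_fps f \<gamma>"
  by (rule disc_fpsI) (metis disc_fps_sums)

lemma disc_fps_const: "disc_fps (fps_const c) (\<lambda>_. of_int c)"
  and disc_fps_X: "disc_fps fps_X (\<lambda>q. q)"
  by (simp_all add: disc_fps_def has_fps_expansion_fps_X holomorphic_on_ident)

lemma disc_fps_1: "disc_fps 1 (\<lambda>_. 1)"
  using disc_fps_const [of 1] by simp

lemma disc_fps_0: "disc_fps 0 (\<lambda>_. 0)"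
  using disc_fps_const [of 0] by simp

lemma disc_fps_add: "disc_fps f \<phi> \<Longrightarrow> disc_fps g \<gamma> \<Longrightarrow> disc_fps (f + g) (\<lambda>q. \<phi> q + \<gamma> q)"
  and disc_fps_diff: "disc_fps f \<phi> \<Longrightarrow> disc_fps g \<gamma> \<Longrightarrow> disc_fps (f - g) (\<lambda>q. \<phi> q - \<gamma> q)"
  and disc_fps_mult: "disc_fps f \<phi> \<Longrightarrow> disc_fps g \<gamma> \<Longrightarrow> disc_fps (f * g) (\<lambda>q. \<phi> q * \<gamma> q)"
  by (auto simp: disc_fps_def intro: holomorphic_intros fps_expansion_intros)

lemma disc_fps_power: "disc_fps f \<phi> \<Longrightarrow> disc_fps (f ^ n) (\<lambda>q. \<phi> q ^ n)"
  by (induction n) (auto intro: disc_fps_1 disc_fps_mult)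

lemma disc_fps_sum:
  "(\<And>i. i \<in> A \<Longrightarrow> disc_fps (f i) (\<phi> i)) \<Longrightarrow> disc_fps (\<Sum>i\<in>A. f i) (\<lambda>q. \<Sum>i\<in>A. \<phi> i q)"
  by (induction A rule: infinite_finite_induct) (auto intro: disc_fps_0 disc_fps_add)

lemma disc_fps_prod:
  "(\<And>i. i \<in> A \<Longrightarrow> disc_fps (f i) (\<phi> i)) \<Longrightarrow> disc_fps (\<Prod>i\<in>A. f i) (\<lambda>q. \<Prod>i\<in>A. \<phi> i q)"
  by (induction A rule: infinite_finite_induct) (auto intro: disc_fps_1 disc_fps_mult)

lemma disc_fps_divide:
  assumes f: "disc_fps f \<phi>" and g: "disc_fps g \<gamma>" "fps_nth g 0 = 1"
    and nonzero: "\<And>q. norm q < 1 \<Longrightarrow> \<gamma> q \<noteq> 0"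
  obtains h where "h * g = f" "disc_fps h (\<lambda>q. \<phi> q / \<gamma> q)"
proof -
  define g' where "g' = fps_right_inverse g 1"
  have inverse: "g * g' = 1"
    unfolding g'_def by (rule fps_right_inverse) (simp add: g(2))
  then have "inverse (complex_fps g) = complex_fps g'"
    by (metis complex_fps_hom(2,7) fps_inverse_unique)
  then have "disc_fps g' (\<lambda>q. inverse (\<gamma> q))"
    using g nonzero has_fps_expansion_inverse [of \<gamma> "complex_fps g"]
    by (auto simp: disc_fps_def intro!: holomorphic_intros)
  from disc_fps_mult [OF f this] have "disc_fps (f * g') (\<lambda>q. \<phi> q / \<gamma> q)"
    by (simp add: divide_inverse)
  moreover have "f * g' * g = f"
    using inverse by (simp add: mult.assoc mult.commute)
  ultimately show ?thesis using that by blast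
qed

lemma disc_fps_compose_X_power:
  assumes f: "disc_fps f \<phi>" and k: "k > 0"
  shows "disc_fps (f oo fps_X ^ k) (\<lambda>q. \<phi> (q ^ k))"
  unfolding disc_fps_def
proof
  have "(\<lambda>q::complex. q ^ k) ` ball 0 1 \<subseteq> ball 0 1"
    using k by (auto simp: norm_power power_less_one_iff)
  with disc_fps_holomorphic [OF f] show "(\<lambda>q. \<phi> (q ^ k)) holomorphic_on ball 0 1"
    using holomorphic_on_compose_gen [of "\<lambda>q. q ^ k" "ball 0 1" \<phi> "ball 0 1"]
    by (simp add: o_def holomorphic_on_power holomorphic_on_ident)
  show "(\<lambda>q. \<phi> (q ^ k)) has_fps_expansion complex_fps (f oo fps_X ^ k)"
    using has_fps_expansion_compose [of \<phi> "complex_fps f" "\<lambda>q. q ^ k" "fps_X ^ k"] f k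
    by (simp add: disc_fps_def o_def complex_fps_compose_X_power has_fps_expansion_fps_X_power)
qed

lemma disc_fps_dividend_X_power:
  assumes f: "disc_fps f \<phi>" and dvd: "fps_X ^ n dvd f"
  obtains g \<gamma> where "disc_fps g \<gamma>" "\<And>q. norm q < 1 \<Longrightarrow> \<phi> q = q ^ n * \<gamma> q"
proof -
  obtain g where g: "f = fps_X ^ n * g" using dvd by (elim dvdE)
  define \<gamma> where "\<gamma> = eval_fps (complex_fps g)"
  have "complex_fps g = fps_shift n (complex_fps f)"
    by (rule fps_ext) (simp add: g fps_X_power_mult_nth del: complex_fps_hom)
  moreover have "fps_conv_radius (complex_fps f) \<ge> ereal 1"
    using f by (intro holomorphic_on_imp_fps_conv_radius_ge [of \<phi>]) (simp_all add: disc_fps_def)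
  ultimately have radius: "fps_conv_radius (complex_fps g) \<ge> ereal 1"
    by (simp only: fps_conv_radius_shift)
  have \<gamma>: "disc_fps g \<gamma>"
  proof (rule disc_fpsI)
    fix q :: complex assume "norm q < 1"
    then have "ereal (norm q) < ereal 1" by simp
    also note radius
    finally have "ereal (norm q) < fps_conv_radius (complex_fps g)" .
    from sums_eval_fps [OF this] show "(\<lambda>n. of_int (fps_nth g n) * q ^ n) sums \<gamma> q"
      by (simp add: \<gamma>_def)
  qed
  have "\<phi> q = q ^ n * \<gamma> q" if "norm q < 1" for q
  proof -
    have "disc_fps f (\<lambda>q. q ^ n * \<gamma> q)"
      unfolding g by (intro disc_fps_mult disc_fps_power disc_fps_X \<gamma>)
    with f that show ?thesis by (metis disc_fps_sums sums_unique2)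
  qed
  with \<gamma> that show ?thesis by blast
qed

lemma disc_fps_limit:
  assumes approx: "\<And>n. disc_fps (F n) (f n)" and formal: "F \<longlonglongrightarrow> G"
    and uniform: "\<And>r. r < 1 \<Longrightarrow> uniform_limit (cball 0 r) f g sequentially"
  shows "disc_fps G g"
  unfolding disc_fps_def
proof
  have holo: "f n holomorphic_on ball 0 1" for n
    using approx by (rule disc_fps_holomorphic)
  show g_holo: "g holomorphic_on ball 0 1"
  proof (rule holomorphic_uniform_sequence [OF _ holo])
    fix x :: complex assume x: "x \<in> ball 0 1"
    define d where "d = (1 - norm x) / 2"
    have "cball x d \<subseteq> cball 0 (norm x + d)"
      by (simp add: cball_subset_cball_iff)
    moreover have "norm x + d < 1" "d > 0" using x by (auto simp: d_def field_simps)
    ultimately show "\<exists>d. 0 < d \<and> cball x d \<subseteq> ball 0 1 \<and> uniform_limit (cball x d) f g sequentially"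
      by (intro exI [of _ d]) (auto intro: uniform_limit_on_subset [OF uniform])
  qed simp
  have "fps_nth (complex_fps G) k = (deriv ^^ k) g 0 / fact k" for k
  proof (rule LIMSEQ_unique)
    have "uniform_limit (ball 0 (1/2)) f g sequentially"
      by (rule uniform_limit_on_subset [OF uniform [of "1/2"]]) auto
    then have "(\<lambda>n. (deriv ^^ k) (f n) 0) \<longlonglongrightarrow> (deriv ^^ k) g 0"
      by (rule higher_deriv_complex_uniform_limit)
         (auto intro!: always_eventually holomorphic_on_subset [OF holo])
    moreover have "fps_nth (complex_fps (F n)) k = (deriv ^^ k) (f n) 0 / fact k" for n
      using approx by (intro fps_nth_fps_expansion) (auto simp: disc_fps_def)
    ultimately show "(\<lambda>n. fps_nth (complex_fps (F n)) k) \<longlonglongrightarrow> (deriv ^^ k) g 0 / fact k"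
      by (auto intro: tendsto_divide)
    have "\<forall>\<^sub>F n in sequentially. fps_nth (F n) k = fps_nth G k"
      using formal by (simp add: tendsto_fps_iff)
    then show "(\<lambda>n. fps_nth (complex_fps (F n)) k) \<longlonglongrightarrow> fps_nth (complex_fps G) k"
      by (intro tendsto_eventually) (auto elim: eventually_mono)
  qed
  then have "complex_fps G = fps_expansion g 0"
    by (intro fps_ext) (simp add: fps_expansion_def)
  with g_holo show "g has_fps_expansion complex_fps G"
    by (auto intro!: has_fps_expansion_fps_expansion [of "ball 0 1"])
qed

lemma tendsto_fps_mult:
  fixes f g :: "'b \<Rightarrow> 'a::ring fps"
  assumes "(f \<longlongrightarrow> F) A" "(g \<longlongrightarrow> G) A"
  shows "((\<lambda>x. f x * g x) \<longlongrightarrow> F * G) A"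
proof (rule tendsto_fpsI)
  fix n
  have "\<forall>\<^sub>F x in A. \<forall>k\<in>{..n}. fps_nth (f x) k = fps_nth F k \<and> fps_nth (g x) k = fps_nth G k"
    using assms by (auto simp: eventually_ball_finite_distrib tendsto_fps_iff eventually_conj_iff)
  then show "\<forall>\<^sub>F x in A. fps_nth (f x * g x) n = fps_nth (F * G) n"
    by eventually_elim (auto simp: fps_mult_nth intro!: sum.cong)
qed

lemma tendsto_fps_power:
  fixes f :: "'b \<Rightarrow> 'a::ring_1 fps"
  shows "(f \<longlongrightarrow> F) A \<Longrightarrow> ((\<lambda>x. f x ^ n) \<longlongrightarrow> F ^ n) A"
  by (induction n) (auto intro: tendsto_fps_mult)

lemma tendsto_fps_compose_X_power:
  fixes f :: "'b \<Rightarrow> 'a::comm_ring_1 fps"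
  shows "(f \<longlongrightarrow> F) A \<Longrightarrow> ((\<lambda>x. f x oo fps_X ^ k) \<longlongrightarrow> F oo fps_X ^ k) A"
  by (auto simp: tendsto_fps_iff fps_nth_compose_X_power)

lemma fps_X_power_dvd_iff_nth:
  fixes f :: "'a::comm_ring_1 fps"
  shows "fps_X ^ n dvd f \<longleftrightarrow> (\<forall>i<n. fps_nth f i = 0)"
proof
  assume "fps_X ^ n dvd f"
  then show "\<forall>i<n. fps_nth f i = 0" by (auto elim!: dvdE simp: fps_X_power_mult_nth)
next
  assume "\<forall>i<n. fps_nth f i = 0"
  then have "f = fps_X ^ n * fps_shift n f"
    by (intro fps_ext) (simp add: fps_X_power_mult_nth)
  then show "fps_X ^ n dvd f" by (metis dvd_triv_left)
qed

section \<open>Euler's pentagonal number theorem\<close>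

definition parity_sign :: "int \<Rightarrow> 'a::comm_ring_1" where
  "parity_sign k = (if even k then 1 else -1)"

lemma parity_sign_of_nat: "parity_sign (int n) = (-1) ^ n"
  and parity_sign_minus: "parity_sign (- k) = parity_sign k"
  by (simp_all add: parity_sign_def)

lemma of_int_parity_sign [simp]: "of_int (parity_sign k) = parity_sign k"
  by (simp add: parity_sign_def)

definition pent :: "int \<Rightarrow> nat" where
  "pent k = nat (k * (3 * k + 1) div 2)"

lemma two_pent: "2 * int (pent k) = k * (3 * k + 1)"
proof -
  have "even (k * (3 * k + 1))" by simp
  moreover have "k * (3 * k + 1) \<ge> 0"
    by (cases "k \<ge> 0") (auto simp: zero_le_mult_iff)
  ultimately show ?thesis by (auto simp: pent_def)
qed

lemma inj_pent: "inj pent"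
proof (rule injI)
  fix x y assume "pent x = pent y"
  then have "x * (3 * x + 1) = y * (3 * y + 1)" by (metis two_pent)
  then have "(x - y) * (3 * (x + y) + 1) = 0" by (simp add: algebra_simps)
  moreover have "3 * (x + y) + 1 \<noteq> 0" by presburger
  ultimately show "x = y" by simp
qed

lemma abs_le_pent: "\<bar>k\<bar> \<le> int (pent k)"
proof -
  have "2 * \<bar>k\<bar> \<le> k * (3 * k + 1)"
  proof (cases "k \<ge> 0")
    case True
    then show ?thesis by (cases "k = 0") (auto simp: algebra_simps mult_le_cancel_left)
  next
    case False
    then have "(- k) * (- 3 * k - 1) \<ge> (- k) * 2" by (intro mult_left_mono) auto
    then show ?thesis using False by (simp add: algebra_simps)
  qed
  then show ?thesis using two_pent [of k] by linarith
qed

lemma pent_of_nat: "pent (int n) = n * n + (Suc n choose 2)"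
  and pent_minus_of_nat: "pent (- int n) = n * n + (n choose 2)"
proof -
  have triangle: "2 * int (Suc m choose 2) = int m * (int m + 1)" for m
  proof -
    have "2 * (Suc m choose 2) = Suc m * m" by (simp add: choose_two)
    then show ?thesis by (metis of_nat_Suc of_nat_mult of_nat_numeral mult.commute add.commute)
  qed
  have "2 * int (pent (int n)) = 2 * int (n * n + (Suc n choose 2))"
    unfolding two_pent using triangle [of n] by (simp add: algebra_simps)
  then show "pent (int n) = n * n + (Suc n choose 2)"
    by (simp only: mult_cancel_left of_nat_eq_iff) simp
  have "2 * int (n choose 2) = int n * (int n - 1)"
    using triangle [of "n - 1"] by (cases n) auto
  then have "2 * int (pent (- int n)) = 2 * int (n * n + (n choose 2))"
    unfolding two_pent by (simp add: algebra_simps)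
  then show "pent (- int n) = n * n + (n choose 2)"
    by (simp only: mult_cancel_left of_nat_eq_iff) simp
qed

definition shanks_term :: "nat \<Rightarrow> 'a::comm_ring_1 \<Rightarrow> nat \<Rightarrow> 'a" where
  "shanks_term n x s = (-1) ^ s * (\<Prod>j\<in>{s<..n}. 1 - x ^ j) * x ^ (s * n + (Suc s choose 2))"

text \<open>
  In passing from \<open>n\<close> to \<open>n + 1\<close> each term splits in two, and the halves recombine with a shift
  of \<open>s\<close> to the terms for \<open>n\<close>; two boundary terms are left over.
\<close>

lemma sum_shanks_term_Suc:
  "(\<Sum>s\<le>Suc n. shanks_term (Suc n) x s) =
     (\<Sum>s\<le>n. shanks_term n x s)
       + (-1) ^ Suc n * (x ^ pent (int (Suc n)) + x ^ pent (- int (Suc n)))"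
proof -
  define u where
    "u s = (-1) ^ s * (\<Prod>j\<in>{s<..n}. 1 - x ^ j) * x ^ (s * Suc n + (Suc s choose 2))" for s
  have split: "shanks_term (Suc n) x s = u s - u s * x ^ Suc n" if "s \<le> n" for s
  proof -
    have "{s<..Suc n} = insert (Suc n) {s<..n}" using that by auto
    then show ?thesis by (simp add: shanks_term_def u_def algebra_simps)
  qed
  have recombine: "u (Suc s) - u s * x ^ Suc n = shanks_term n x (Suc s)" if "s < n" for s
  proof -
    have "{s<..n} = insert (Suc s) {Suc s<..n}" using that by auto
    moreover have "Suc (Suc s) choose 2 = (Suc s choose 2) + Suc s"
      by (simp add: numeral_2_eq_2)
    ultimately show ?thesis
      by (simp add: shanks_term_def u_def algebra_simps power_add)
  qed
  have "(\<Sum>s\<le>n. shanks_term (Suc n) x s) = (\<Sum>s\<le>n. u s) - (\<Sum>s\<le>n. u s * x ^ Suc n)"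
    by (simp add: split sum_subtractf)
  also have "\<dots> = u 0 + (\<Sum>s<n. u (Suc s) - u s * x ^ Suc n) - u n * x ^ Suc n"
    unfolding sum_subtractf sum.atMost_shift [of u]
    by (simp add: lessThan_Suc_atMost [symmetric])
  also have "(\<Sum>s<n. u (Suc s) - u s * x ^ Suc n) = (\<Sum>s<n. shanks_term n x (Suc s))"
    by (intro sum.cong) (simp_all add: recombine del: power_Suc)
  also have "u 0 = shanks_term n x 0" by (simp add: u_def shanks_term_def)
  also have "shanks_term n x 0 + (\<Sum>s<n. shanks_term n x (Suc s)) = (\<Sum>s\<le>n. shanks_term n x s)"
    by (rule sum.atMost_shift [symmetric])
  also have "u n * x ^ Suc n = (-1) ^ n * x ^ pent (- int (Suc n))"
    unfolding pent_minus_of_nat u_def by (simp add: power_add mult_ac)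
  finally have "(\<Sum>s\<le>n. shanks_term (Suc n) x s) =
      (\<Sum>s\<le>n. shanks_term n x s) - (-1) ^ n * x ^ pent (- int (Suc n))" .
  moreover have "shanks_term (Suc n) x (Suc n) = (-1) ^ Suc n * x ^ pent (int (Suc n))"
    unfolding pent_of_nat by (simp add: shanks_term_def)
  ultimately show ?thesis by (simp add: algebra_simps)
qed

lemma int_symmetric_interval_Suc:
  "{- int (Suc n)..int (Suc n)} = insert (- int (Suc n)) (insert (int (Suc n)) {- int n..int n})"
  by auto

theorem shanks_identity:
  "(\<Sum>k\<in>{- int n..int n}. parity_sign k * x ^ pent k) = (\<Sum>s\<le>n. shanks_term n x s)"
proof (induction n)
  case 0
  show ?case by (simp add: pent_def parity_sign_def shanks_term_def numeral_2_eq_2)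
next
  case (Suc n)
  have "(\<Sum>k\<in>{- int (Suc n)..int (Suc n)}. parity_sign k * x ^ pent k) =
      (\<Sum>k\<in>{- int n..int n}. parity_sign k * x ^ pent k)
        + (-1) ^ Suc n * (x ^ pent (int (Suc n)) + x ^ pent (- int (Suc n)))"
    unfolding int_symmetric_interval_Suc
    by (simp add: parity_sign_minus parity_sign_of_nat algebra_simps del: of_nat_Suc power_Suc)
  then show ?case by (simp only: Suc.IH sum_shanks_term_Suc)
qed

corollary pentagonal_sum_cong_euler_product:
  "x ^ Suc n dvd (\<Sum>k\<in>{- int n..int n}. parity_sign k * x ^ pent k) - (\<Prod>j<n. 1 - x ^ Suc j)"
proof -
  have "(\<Prod>j\<in>{0<..n}. 1 - x ^ j) = (\<Prod>j<n. 1 - x ^ Suc j)"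
    by (rule prod.reindex_bij_witness [of _ Suc "\<lambda>j. j - 1"]) auto
  then have "shanks_term n x 0 = (\<Prod>j<n. 1 - x ^ Suc j)"
    by (simp add: shanks_term_def numeral_2_eq_2)
  then have "(\<Sum>k\<in>{- int n..int n}. parity_sign k * x ^ pent k) - (\<Prod>j<n. 1 - x ^ Suc j) =
      (\<Sum>s<n. shanks_term n x (Suc s))"
    unfolding shanks_identity sum.atMost_shift [of "shanks_term n x"] by simp
  moreover have "x ^ Suc n dvd shanks_term n x (Suc s)" for s
    unfolding shanks_term_def
    by (intro dvd_mult le_imp_power_dvd) (simp add: numeral_2_eq_2)
  ultimately show ?thesis by (simp add: dvd_sum)
qed

definition euler_fps :: "int fps" where
  "euler_fps = Abs_fps (\<lambda>n. \<Sum>k\<in>{- int n..int n}. if pent k = n then parity_sign k else 0)"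

lemma euler_fps_nth_pent: "fps_nth euler_fps (pent k) = parity_sign k"
proof -
  have "fps_nth euler_fps (pent k) =
      (\<Sum>j\<in>{- int (pent k)..int (pent k)}. if j = k then parity_sign j else 0)"
    unfolding euler_fps_def fps_nth_Abs_fps
    by (intro sum.cong) (use inj_pent in \<open>auto dest: injD\<close>)
  then show ?thesis using abs_le_pent [of k] by (auto simp: abs_le_iff)
qed

lemma euler_fps_nth_not_pent: "n \<notin> range pent \<Longrightarrow> fps_nth euler_fps n = 0"
  by (auto simp: euler_fps_def intro!: sum.neutral)

lemma euler_fps_nth_0 [simp]: "fps_nth euler_fps 0 = 1"
  using euler_fps_nth_pent [of 0] by (simp add: pent_def parity_sign_def)

lemma tendsto_euler_fps: "(\<lambda>n. \<Prod>j<n. 1 - fps_X ^ Suc j) \<longlonglongrightarrow> euler_fps"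
proof (rule tendsto_fpsI)
  fix i
  have "fps_nth (\<Prod>j<n. 1 - fps_X ^ Suc j :: int fps) i = fps_nth euler_fps i" if "n \<ge> i" for n
  proof -
    have "fps_nth (\<Prod>j<n. 1 - fps_X ^ Suc j :: int fps) i =
        fps_nth (\<Sum>k\<in>{- int n..int n}. parity_sign k * fps_X ^ pent k) i"
      using pentagonal_sum_cong_euler_product [of "fps_X :: int fps" n] that
      unfolding fps_X_power_dvd_iff_nth by simp
    also have "\<dots> = (\<Sum>k\<in>{- int n..int n}. if pent k = i then parity_sign k else 0)"
      unfolding fps_sum_nth by (intro sum.cong) (auto simp: parity_sign_def)
    also have "\<dots> = fps_nth euler_fps i"
      unfolding euler_fps_def fps_nth_Abs_fps
    proof (intro sum.mono_neutral_right ballI)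
      fix k assume "k \<in> {- int n..int n} - {- int i..int i}"
      then have "pent k \<noteq> i" using abs_le_pent [of k] by auto
      then show "(if pent k = i then parity_sign k else 0) = (0::int)" by simp
    qed (use that in auto)
    finally show ?thesis .
  qed
  then show "\<forall>\<^sub>F n in sequentially.
      fps_nth (\<Prod>j<n. 1 - fps_X ^ Suc j) i = fps_nth euler_fps i"
    using eventually_ge_at_top [of i] by (rule eventually_mono [rotated])
qed

definition euler :: "complex \<Rightarrow> complex" where
  "euler q = (\<Prod>n. 1 - q ^ Suc n)"

lemma convergent_prod_euler:
  fixes q :: complex assumes "norm q < 1" shows "convergent_prod (\<lambda>n. 1 - q ^ Suc n)"
proof -
  have "summable (\<lambda>n. norm q ^ Suc n)"
    using assms by (simp add: summable_geometric summable_mult)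
  then show ?thesis
    by (intro abs_convergent_prod_imp_convergent_prod summable_imp_abs_convergent_prod)
       (simp add: norm_mult norm_power)
qed

lemma euler_nonzero:
  assumes "norm q < 1" shows "euler q \<noteq> 0"
proof -
  have "q ^ Suc n \<noteq> 1" for n
    using assms by (metis nat.distinct(1) norm_one norm_power order_less_irrefl
        power_less_one_iff norm_ge_zero zero_less_Suc)
  then show ?thesis
    unfolding euler_def using convergent_prod_euler [OF assms] by (intro prodinf_nonzero) auto
qed

lemma uniform_limit_euler:
  assumes "r < 1"
  shows "uniform_limit (cball 0 r) (\<lambda>n q. \<Prod>j<n. 1 - q ^ Suc j) euler sequentially"
proof -
  define \<rho> where "\<rho> = max r 0"
  have \<rho>: "0 \<le> \<rho>" "\<rho> < 1" using assms by (auto simp: \<rho>_def)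
  have "uniformly_convergent_on (cball 0 r)
      (\<lambda>N q. \<Sum>n<N. norm (1 - q ^ Suc n - (1::complex)))"
  proof (rule Weierstrass_m_test' [where M = "\<lambda>n. \<rho> ^ Suc n"])
    fix n and q :: complex assume "q \<in> cball 0 r"
    then have "norm q ^ Suc n \<le> \<rho> ^ Suc n"
      by (intro power_mono) (auto simp: \<rho>_def)
    then show "norm (norm (1 - q ^ Suc n - 1)) \<le> \<rho> ^ Suc n"
      by (simp add: norm_mult norm_power)
  next
    show "summable (\<lambda>n. \<rho> ^ Suc n)"
      using \<rho> by (simp add: summable_geometric summable_mult)
  qed
  then have "uniformly_convergent_on (cball 0 r) (\<lambda>n q. \<Prod>j<n. 1 - q ^ Suc j :: complex)"
    by (intro uniformly_convergent_on_prod' continuous_intros) auto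
  then obtain l where
    l: "uniform_limit (cball 0 r) (\<lambda>n q. \<Prod>j<n. 1 - q ^ Suc j :: complex) l sequentially"
    by (auto simp: uniformly_convergent_on_def)
  have l_eq: "l q = euler q" if q: "q \<in> cball 0 r" for q
  proof (rule LIMSEQ_unique)
    show "(\<lambda>n. \<Prod>j<n. 1 - q ^ Suc j) \<longlonglongrightarrow> l q"
      using l q by (rule tendsto_uniform_limitI)
    have "norm q < 1" using q assms by simp
    from convergent_prod_LIMSEQ [OF convergent_prod_euler [OF this]]
    show "(\<lambda>n. \<Prod>j<n. 1 - q ^ Suc j) \<longlonglongrightarrow> euler q"
      unfolding euler_def lessThan_Suc_atMost [symmetric]
      by (rule filterlim_sequentially_Suc [THEN iffD1])
  qed
  have "uniform_limit (cball 0 r) (\<lambda>n q. \<Prod>j<n. 1 - q ^ Suc j) l sequentially \<longleftrightarrow> ?thesis"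
    by (rule uniform_limit_cong') (simp_all only: l_eq)
  with l show ?thesis by blast
qed

lemma disc_fps_euler: "disc_fps euler_fps euler"
proof (rule disc_fps_limit [OF _ tendsto_euler_fps uniform_limit_euler])
  show "disc_fps (\<Prod>j<n. 1 - fps_X ^ Suc j) (\<lambda>q. \<Prod>j<n. 1 - q ^ Suc j)" for n
    by (intro disc_fps_prod disc_fps_diff disc_fps_power disc_fps_1 disc_fps_X)
qed

theorem euler_pentagonal:
  assumes "norm q < 1"
  shows "((\<lambda>k. parity_sign k * q ^ pent k) has_sum euler q) UNIV"
proof -
  define g where "g n = of_int (fps_nth euler_fps n) * q ^ n" for n
  have "norm (g n) \<le> norm q ^ n" for n
  proof (cases "n \<in> range pent")
    case True
    then show ?thesis
      by (auto simp: g_def norm_mult norm_power euler_fps_nth_pent parity_sign_def)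
  qed (simp add: g_def euler_fps_nth_not_pent)
  then have "summable (\<lambda>n. norm (g n))"
    using assms by (intro summable_comparison_test' [OF summable_geometric [of "norm q"]]) auto
  moreover have "g sums euler q"
    unfolding g_def using disc_fps_euler assms by (rule disc_fps_sums)
  ultimately have "(g has_sum euler q) UNIV"
    by (rule norm_summable_imp_has_sum)
  also have "?this \<longleftrightarrow> (g has_sum euler q) (range pent)"
    by (rule has_sum_cong_neutral) (auto simp: g_def euler_fps_nth_not_pent)
  also have "\<dots> \<longleftrightarrow> (g \<circ> pent has_sum euler q) UNIV"
    by (rule has_sum_reindex [OF inj_pent])
  finally show ?thesis
    by (simp add: g_def o_def euler_fps_nth_pent)
qed

section \<open>The generating function and its dual\<close>

lemma alpha_gf_times_euler: "alpha_gf * euler_fps ^ 2 = (euler_fps oo fps_X\<^sup>2) ^ 3"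
proof (rule LIMSEQ_unique)
  define P where "P n = (\<Prod>j<n. 1 - fps_X ^ Suc j :: int fps)" for n
  have P: "P \<longlonglongrightarrow> euler_fps"
    unfolding P_def by (rule tendsto_euler_fps)
  have "(\<lambda>n. \<Prod>i\<le>n. alpha_factor i) \<longlonglongrightarrow> alpha_gf"
    using alpha_gf_has_prod alpha_factor_nonzero by (auto simp: has_prod_def raw_has_prod_def)
  then have "(\<lambda>n. \<Prod>i<n. alpha_factor i) \<longlonglongrightarrow> alpha_gf"
    unfolding lessThan_Suc_atMost [symmetric] by (rule filterlim_sequentially_Suc [THEN iffD1])
  with P show "(\<lambda>n. (\<Prod>i<n. alpha_factor i) * P n ^ 2) \<longlonglongrightarrow> alpha_gf * euler_fps ^ 2"
    by (intro tendsto_fps_mult tendsto_fps_power)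
  have "(\<Prod>i<n. alpha_factor i) * P n ^ 2 = (P n oo fps_X ^ 2) ^ 3" for n
  proof -
    have "(1 - fps_X ^ Suc i) oo fps_X ^ 2 = (1 - fps_X ^ (2 * Suc i) :: int fps)" for i
      by (subst fps_compose_sub_distrib, subst fps_X_power_compose)
         (simp_all only: fps_compose_1 power_mult, simp)
    then have "P n oo fps_X ^ 2 = (\<Prod>i<n. 1 - fps_X ^ (2 * Suc i))"
      unfolding P_def by (subst fps_compose_prod_distrib) (simp_all del: power_Suc)
    moreover have "(\<Prod>i<n. alpha_factor i) * P n ^ 2 =
        (\<Prod>i<n. alpha_factor i * (1 - fps_X ^ Suc i) ^ 2)"
      unfolding P_def by (simp only: prod.distrib prod_power_distrib)
    ultimately show ?thesis
      by (simp only: alpha_factor_times prod_power_distrib)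
  qed
  then show "(\<lambda>n. (\<Prod>i<n. alpha_factor i) * P n ^ 2) \<longlonglongrightarrow> (euler_fps oo fps_X ^ 2) ^ 3"
    using P by (auto intro: tendsto_fps_power tendsto_fps_compose_X_power)
qed

definition alpha_prod :: "complex \<Rightarrow> complex" where
  "alpha_prod q = euler (q\<^sup>2) ^ 3 / euler q ^ 2"

definition dual_prod :: "complex \<Rightarrow> complex" where
  "dual_prod q = euler q ^ 3 / euler (q\<^sup>2) ^ 2"

lemma euler_square_nonzero: "norm q < 1 \<Longrightarrow> euler (q\<^sup>2) \<noteq> 0"
  by (rule euler_nonzero) (simp add: norm_power power_less_one_iff)

lemma alpha_prod_nonzero: "norm q < 1 \<Longrightarrow> alpha_prod q \<noteq> 0"
  by (simp add: alpha_prod_def euler_nonzero euler_square_nonzero)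

lemma dual_prod_nonzero: "norm q < 1 \<Longrightarrow> dual_prod q \<noteq> 0"
  by (simp add: dual_prod_def euler_nonzero euler_square_nonzero)

lemma disc_fps_euler_power: "disc_fps (euler_fps ^ n) (\<lambda>q. euler q ^ n)"
  and disc_fps_euler_square_power: "disc_fps ((euler_fps oo fps_X\<^sup>2) ^ n) (\<lambda>q. euler (q\<^sup>2) ^ n)"
  by (intro disc_fps_power disc_fps_compose_X_power disc_fps_euler; simp)+

lemma euler_fps_power_nth_0: "fps_nth (euler_fps ^ n) 0 = 1"
  and euler_square_fps_power_nth_0: "fps_nth ((euler_fps oo fps_X\<^sup>2) ^ n) 0 = 1"
  by (simp_all add: fps_nth_power_0 fps_nth_compose_X_power)

lemma disc_fps_alpha_prod: "disc_fps alpha_gf alpha_prod"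
proof -
  obtain h where h: "h * euler_fps ^ 2 = (euler_fps oo fps_X\<^sup>2) ^ 3" "disc_fps h alpha_prod"
    unfolding alpha_prod_def [abs_def]
    by (rule disc_fps_divide [OF disc_fps_euler_square_power disc_fps_euler_power
          euler_fps_power_nth_0]) (simp add: euler_nonzero)
  moreover have "euler_fps ^ 2 \<noteq> 0"
    using euler_fps_power_nth_0 [of 2] by auto
  ultimately show ?thesis
    using alpha_gf_times_euler by (metis mult_right_cancel)
qed

lemma disc_fps_dual_prod:
  obtains B where "fps_nth B 0 = 1" "disc_fps B dual_prod"
proof -
  obtain B where B: "B * (euler_fps oo fps_X\<^sup>2) ^ 2 = euler_fps ^ 3" "disc_fps B dual_prod"
    unfolding dual_prod_def [abs_def]
    by (rule disc_fps_divide [OF disc_fps_euler_power disc_fps_euler_square_power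
          euler_square_fps_power_nth_0]) (simp add: euler_square_nonzero)
  have "fps_nth B 0 = 1"
    using arg_cong [OF B(1), of "\<lambda>f. fps_nth f 0"]
    by (simp only: fps_mult_nth_0 euler_fps_power_nth_0 euler_square_fps_power_nth_0 mult_1_right)
  with B(2) that show ?thesis by blast
qed

lemma disc_fps_euler_quotient:
  obtains E where "fps_nth E 0 = 1" "disc_fps E (\<lambda>q. (euler (q\<^sup>2) / euler q) ^ k)"
proof -
  obtain E where E: "E * euler_fps ^ k = (euler_fps oo fps_X\<^sup>2) ^ k"
      "disc_fps E (\<lambda>q. euler (q\<^sup>2) ^ k / euler q ^ k)"
    by (rule disc_fps_divide [OF disc_fps_euler_square_power disc_fps_euler_power
          euler_fps_power_nth_0]) (simp add: euler_nonzero)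
  have "fps_nth E 0 = 1"
    using arg_cong [OF E(1), of "\<lambda>f. fps_nth f 0"]
    by (simp only: fps_mult_nth_0 euler_fps_power_nth_0 euler_square_fps_power_nth_0 mult_1_right)
  with E(2) that show ?thesis by (simp add: power_divide)
qed

section \<open>Poisson summation and theta inversion\<close>

lemma has_integral_diff_orthogonal_kernel:
  fixes D :: "real \<Rightarrow> complex" and K :: "real \<Rightarrow> real"
  assumes D: "continuous_on {0..1} D" and K: "continuous_on {0..1} K"
    and orthogonal: "integral {0..1} (\<lambda>x. D x * of_real (K x)) = 0"
  shows "((\<lambda>x. (z - D x) * of_real (K x)) has_integral z * of_real (integral {0..1} K)) {0..1}"
proof -
  have "(K has_integral integral {0..1} K) {0..1}"
    using K by (intro integrable_integral integrable_continuous_interval)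
  from has_integral_linear [OF this bounded_linear_of_real]
  have "((\<lambda>x. z * of_real (K x)) has_integral z * of_real (integral {0..1} K)) {0..1}"
    by (intro has_integral_mult_right) (simp add: o_def)
  moreover have "(\<lambda>x. D x * of_real (K x)) integrable_on {0..1}"
    by (intro integrable_continuous_interval continuous_intros D K)
  then have "((\<lambda>x. D x * of_real (K x)) has_integral 0) {0..1}"
    using integrable_integral orthogonal by fastforce
  ultimately have "((\<lambda>x. z * of_real (K x) - D x * of_real (K x)) has_integral
      z * of_real (integral {0..1} K) - 0) {0..1}"
    by (rule has_integral_diff)
  then show ?thesis by (simp add: left_diff_distrib)
qed

lemma norm_le_of_orthogonal_kernel:
  fixes D :: "real \<Rightarrow> complex" and K :: "real \<Rightarrow> real"
  defines "I \<equiv> integral {0..1} K"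
  assumes D: "continuous_on {0..1} D" "\<And>x. x \<in> {0..1} \<Longrightarrow> norm (D x) \<le> B" and a: "a \<in> {0..1}"
    and K: "continuous_on {0..1} K" "\<And>x. x \<in> {0..1} \<Longrightarrow> 0 \<le> K x" and mass: "I > 0"
    and orthogonal: "integral {0..1} (\<lambda>x. D x * of_real (K x)) = 0"
    and near: "\<And>x. x \<in> {0..1} \<Longrightarrow> \<bar>x - a\<bar> < d \<Longrightarrow> norm (D a - D x) \<le> \<epsilon>"
    and far: "\<And>x. x \<in> {0..1} \<Longrightarrow> d \<le> \<bar>x - a\<bar> \<Longrightarrow> K x \<le> \<beta> * I"
    and nonneg: "0 \<le> \<epsilon>" "0 \<le> \<beta>"
  shows "norm (D a) \<le> \<epsilon> + 2 * B * \<beta>"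
proof -
  have B_nonneg: "0 \<le> B" using D(2) [OF a] by (meson norm_ge_zero order_trans)
  have pointwise: "norm ((D a - D x) * of_real (K x)) \<le> \<epsilon> * K x + 2 * B * \<beta> * I"
    if x: "x \<in> {0..1}" for x
  proof (cases "\<bar>x - a\<bar> < d")
    case True
    then have "norm (D a - D x) * K x \<le> \<epsilon> * K x"
      using near x K(2) by (intro mult_right_mono) auto
    moreover have "0 \<le> 2 * B * \<beta> * I" using B_nonneg nonneg mass by simp
    ultimately have "norm (D a - D x) * K x \<le> \<epsilon> * K x + 2 * B * \<beta> * I" by linarith
    then show ?thesis using K(2) [OF x] by (simp add: norm_mult)
  next
    case False
    moreover have "norm (D a - D x) \<le> 2 * B"
      using D(2) [OF a] D(2) [OF x] norm_triangle_ineq4 [of "D a" "D x"] by simp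
    ultimately have "norm (D a - D x) * K x \<le> 2 * B * (\<beta> * I)"
      using far x K(2) B_nonneg by (intro mult_mono) auto
    moreover have "0 \<le> \<epsilon> * K x" using K(2) [OF x] nonneg by simp
    ultimately show ?thesis using K(2) [OF x] by (simp add: norm_mult)
  qed
  have K_int: "(K has_integral I) {0..1}"
    unfolding I_def using K(1) by (intro integrable_integral integrable_continuous_interval)
  have lhs: "((\<lambda>x. (D a - D x) * of_real (K x)) has_integral D a * of_real I) {0..1}"
    unfolding I_def by (rule has_integral_diff_orthogonal_kernel [OF D(1) K(1) orthogonal])
  have rhs: "((\<lambda>x. \<epsilon> * K x + 2 * B * \<beta> * I) has_integral \<epsilon> * I + 2 * B * \<beta> * I) {0..1}"
    using has_integral_add [OF has_integral_mult_right [OF K_int]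
        has_integral_const_real [of "2 * B * \<beta> * I" 0 1]] by simp
  have "norm (D a * of_real I) \<le> \<epsilon> * I + 2 * B * \<beta> * I"
    using integral_norm_bound_integral [OF has_integral_integrable [OF lhs]
        has_integral_integrable [OF rhs] pointwise]
    by (simp only: integral_unique [OF lhs] integral_unique [OF rhs])
  then have "norm (D a) * I \<le> (\<epsilon> + 2 * B * \<beta>) * I"
    using mass by (simp add: norm_mult algebra_simps)
  then show ?thesis using mass by simp
qed

definition concentrates_at :: "(nat \<Rightarrow> real \<Rightarrow> real) \<Rightarrow> real \<Rightarrow> bool" where
  "concentrates_at K a \<longleftrightarrow>
     (\<forall>d>0. \<exists>\<beta>. \<beta> \<longlonglongrightarrow> 0 \<and> (\<forall>n. 0 \<le> \<beta> n \<and>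
        (\<forall>x\<in>{0..1}. d \<le> \<bar>x - a\<bar> \<longrightarrow> K n x \<le> \<beta> n * integral {0..1} (K n))))"

lemma concentrating_kernel_orthogonal_imp_zero:
  fixes D :: "real \<Rightarrow> complex" and K :: "nat \<Rightarrow> real \<Rightarrow> real"
  assumes D: "continuous_on {0..1} D" and a: "a \<in> {0..1}"
    and K: "\<And>n. continuous_on {0..1} (K n)" "\<And>n x. x \<in> {0..1} \<Longrightarrow> 0 \<le> K n x"
    and mass: "\<And>n. integral {0..1} (K n) > 0"
    and concentrates: "concentrates_at K a"
    and orthogonal: "\<And>n. integral {0..1} (\<lambda>x. D x * of_real (K n x)) = 0"
  shows "D a = 0"
proof -
  obtain B where "\<forall>y\<in>D ` {0..1}. norm y \<le> B"
    using compact_imp_bounded [OF compact_continuous_image [OF D]] unfolding bounded_iff by blast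
  then have B: "norm (D x) \<le> B" if "x \<in> {0..1}" for x using that by blast
  have "norm (D a) \<le> \<epsilon>" if \<epsilon>: "\<epsilon> > 0" for \<epsilon>
  proof -
    obtain d where d: "d > 0" "\<And>x. x \<in> {0..1} \<Longrightarrow> dist x a < d \<Longrightarrow> dist (D x) (D a) < \<epsilon>"
      using D a \<epsilon> unfolding continuous_on_iff by metis
    then have near: "norm (D a - D x) \<le> \<epsilon>" if "x \<in> {0..1}" "\<bar>x - a\<bar> < d" for x
      using that by (fastforce simp: dist_norm norm_minus_commute)
    obtain \<beta> where \<beta>: "\<beta> \<longlonglongrightarrow> 0" "\<And>n. 0 \<le> \<beta> n"
        "\<And>n x. x \<in> {0..1} \<Longrightarrow> d \<le> \<bar>x - a\<bar> \<Longrightarrow> K n x \<le> \<beta> n * integral {0..1} (K n)"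
      using concentrates d(1) unfolding concentrates_at_def by blast
    have "norm (D a) \<le> \<epsilon> + 2 * B * \<beta> n" for n
      by (rule norm_le_of_orthogonal_kernel [OF D B a K mass orthogonal near \<beta>(3)])
         (use \<epsilon> \<beta>(2) in auto)
    moreover have "(\<lambda>n. \<epsilon> + 2 * B * \<beta> n) \<longlonglongrightarrow> \<epsilon> + 2 * B * 0"
      using \<beta>(1) by (intro tendsto_intros)
    ultimately show ?thesis by (intro LIMSEQ_le_const) auto
  qed
  then show ?thesis by (metis dense_ge norm_le_zero_iff)
qed

lemma abs_cos_pi_le:
  assumes "0 \<le> d" "d \<le> \<bar>u\<bar>" "\<bar>u\<bar> \<le> 1 - d"
  shows "\<bar>cos (pi * u)\<bar> \<le> cos (pi * d)"
proof -
  have "cos (pi * u) = cos (pi * \<bar>u\<bar>)"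
    by (metis abs_if cos_minus mult_minus_right)
  moreover have "cos (pi * \<bar>u\<bar>) \<le> cos (pi * d)" "cos (pi * (1 - d)) \<le> cos (pi * \<bar>u\<bar>)"
    using assms by (auto intro!: cos_monotone_0_pi_le simp: mult_le_cancel_left1)
  moreover have "cos (pi * (1 - d)) = - cos (pi * d)"
    by (simp add: right_diff_distrib cos_diff)
  ultimately show ?thesis by linarith
qed

definition cos_kernel :: "real \<Rightarrow> nat \<Rightarrow> real \<Rightarrow> real" where
  "cos_kernel a n x = cos (pi * (x - a)) ^ (2 * n)"

lemma cos_kernel_nonneg: "0 \<le> cos_kernel a n x"
  by (simp add: cos_kernel_def power_mult)

lemma continuous_on_cos_kernel: "continuous_on S (cos_kernel a n)"
  unfolding cos_kernel_def by (intro continuous_intros)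

lemma cos_kernel_integral_ge:
  assumes "0 < d" "d \<le> 1/2" "d \<le> a" "d \<le> 1 - a"
  shows "d * cos (pi * (d / 2)) ^ (2 * n) \<le> integral {0..1} (cos_kernel a n)"
proof -
  have integrable: "cos_kernel a n integrable_on {l..u}" for l u
    by (intro integrable_continuous_interval continuous_on_cos_kernel)
  have "d * cos (pi * (d / 2)) ^ (2 * n) =
      integral {a - d/2..a + d/2} (\<lambda>_. cos (pi * (d / 2)) ^ (2 * n))"
    using assms by simp
  also have "\<dots> \<le> integral {a - d/2..a + d/2} (cos_kernel a n)"
  proof (rule integral_le [OF integrable_const_ivl integrable])
    fix x assume "x \<in> {a - d/2..a + d/2}"
    then have x: "\<bar>x - a\<bar> \<le> d / 2" unfolding atLeastAtMost_iff by linarith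
    have "cos (pi * (d/2)) \<le> cos (pi * \<bar>x - a\<bar>)"
      using x assms by (intro cos_monotone_0_pi_le) (auto simp: mult_le_cancel_left1)
    also have "\<dots> = cos (pi * (x - a))" by (metis abs_if cos_minus mult_minus_right)
    finally show "cos (pi * (d / 2)) ^ (2 * n) \<le> cos_kernel a n x"
      unfolding cos_kernel_def using assms
      by (intro power_mono cos_ge_zero)
         (auto simp: mult_le_cancel_left1 intro: order_trans [of _ 0])
  qed
  also have "\<dots> \<le> integral {0..1} (cos_kernel a n)"
    by (rule integral_subset_le) (use assms in \<open>auto intro: integrable cos_kernel_nonneg\<close>)
  finally show ?thesis .
qed

lemma cos_kernel_concentrates:
  assumes a: "0 < a" "a < 1"
  shows "concentrates_at (cos_kernel a) a"
  unfolding concentrates_at_def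
proof (intro allI impI)
  fix e :: real assume e: "e > 0"
  define d where "d = min (min e (1/4)) (min a (1 - a))"
  have d: "0 < d" "d \<le> e" "d \<le> 1/4" "d \<le> a" "d \<le> 1 - a"
    unfolding d_def using a e by linarith+
  define \<rho> where "\<rho> = cos (pi * d) ^ 2"
  define \<sigma> where "\<sigma> = cos (pi * (d / 2)) ^ 2"
  have "0 < cos (pi * d)"
    using d by (intro cos_gt_zero_pi) (auto simp: field_simps intro: less_trans [of _ 0])
  moreover have "cos (pi * d) < cos (pi * (d / 2))"
    using d by (intro cos_monotone_0_pi) (auto simp: mult_le_cancel_left1)
  ultimately have \<rho>\<sigma>: "0 < \<rho>" "\<rho> < \<sigma>"
    unfolding \<rho>_def \<sigma>_def by (auto intro: power_strict_mono)
  have tail: "cos_kernel a n x \<le> (\<rho> / \<sigma>) ^ n / d * integral {0..1} (cos_kernel a n)"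
    if x: "x \<in> {0..1}" "e \<le> \<bar>x - a\<bar>" for n x
  proof -
    have "\<bar>cos (pi * (x - a))\<bar> \<le> cos (pi * d)"
      using d x by (intro abs_cos_pi_le) auto
    then have "cos (pi * (x - a)) ^ 2 \<le> \<rho>"
      unfolding \<rho>_def by (metis abs_ge_zero power2_abs power_mono)
    then have "cos_kernel a n x \<le> \<rho> ^ n"
      unfolding cos_kernel_def power_mult by (intro power_mono) auto
    also have "\<rho> ^ n = (\<rho> / \<sigma>) ^ n / d * (d * \<sigma> ^ n)"
      using \<rho>\<sigma> d by (simp add: power_divide)
    also have "\<dots> \<le> (\<rho> / \<sigma>) ^ n / d * integral {0..1} (cos_kernel a n)"
      using cos_kernel_integral_ge [of d a n] d \<rho>\<sigma>
      by (intro mult_left_mono) (auto simp: \<sigma>_def power_mult)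
    finally show ?thesis .
  qed
  have "(\<lambda>n. (\<rho> / \<sigma>) ^ n) \<longlonglongrightarrow> 0"
    by (rule LIMSEQ_realpow_zero) (use \<rho>\<sigma> in auto)
  then have "(\<lambda>n. (\<rho> / \<sigma>) ^ n / d) \<longlonglongrightarrow> 0"
    by (rule tendsto_divide_zero)
  with tail \<rho>\<sigma> d show "\<exists>\<beta>. \<beta> \<longlonglongrightarrow> 0 \<and> (\<forall>n. 0 \<le> \<beta> n \<and> (\<forall>x\<in>{0..1}. e \<le> \<bar>x - a\<bar> \<longrightarrow>
      cos_kernel a n x \<le> \<beta> n * integral {0..1} (cos_kernel a n)))"
    by (intro exI [of _ "\<lambda>n. (\<rho> / \<sigma>) ^ n / d"]) auto
qed

lemma cos_squared_eq_cis:
  "complex_of_real (cos (pi * (x - a)) ^ 2) =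
     1/2 + cis (- 2 * pi * a) / 4 * cis (2 * pi * x) + cis (2 * pi * a) / 4 * cis (- 2 * pi * x)"
proof -
  have "cos (pi * (x - a)) ^ 2 = (1 + cos (2 * pi * x - 2 * pi * a)) / 2"
    using cos_double_cos [of "pi * (x - a)"] by (simp add: algebra_simps)
  moreover have "cis (- 2 * pi * a) * cis (2 * pi * x) = cis (2 * pi * x - 2 * pi * a)"
    "cis (2 * pi * a) * cis (- 2 * pi * x) = cis (- (2 * pi * x - 2 * pi * a))"
    by (simp_all add: cis_mult algebra_simps)
  ultimately show ?thesis by (simp add: complex_eq_iff cis.sel)
qed

lemma cos_kernel_orthogonal:
  fixes D :: "real \<Rightarrow> complex"
  assumes D: "continuous_on {0..1} D"
    and zero: "\<And>m::int. integral {0..1} (\<lambda>x. D x * cis (2 * pi * m * x)) = 0"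
  shows "integral {0..1}
    (\<lambda>x. D x * of_real (cos_kernel a n x) * cis (2 * pi * real_of_int m * x)) = 0"
proof (induction n arbitrary: m)
  case 0
  then show ?case by (simp add: zero cos_kernel_def)
next
  case (Suc n)
  define f where
    "f m x = D x * of_real (cos_kernel a n x) * cis (2 * pi * real_of_int m * x)" for m x
  have f: "(f m has_integral 0) {0..1}" for m
  proof -
    have "f m integrable_on {0..1}"
      unfolding f_def
      by (intro integrable_continuous_interval continuous_intros D continuous_on_cos_kernel)
    from integrable_integral [OF this] show ?thesis
      unfolding f_def by (simp only: Suc.IH)
  qed
  have "D x * of_real (cos_kernel a (Suc n) x) * cis (2 * pi * real_of_int m * x) =
      1/2 * f m x + cis (- 2 * pi * a) / 4 * f (m + 1) x + cis (2 * pi * a) / 4 * f (m - 1) x" for x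
  proof -
    have "cis (2 * pi * real_of_int (m + 1) * x) =
        cis (2 * pi * x) * cis (2 * pi * real_of_int m * x)"
      "cis (2 * pi * real_of_int (m - 1) * x) =
        cis (- 2 * pi * x) * cis (2 * pi * real_of_int m * x)"
      by (simp_all add: cis_mult algebra_simps)
    moreover have "cos_kernel a (Suc n) x = cos (pi * (x - a)) ^ 2 * cos_kernel a n x"
      by (simp add: cos_kernel_def flip: power_add)
    ultimately show ?thesis
      unfolding f_def by (simp only: of_real_mult cos_squared_eq_cis) (simp add: algebra_simps)
  qed
  moreover have "((\<lambda>x. 1/2 * f m x + cis (- 2 * pi * a) / 4 * f (m + 1) x
      + cis (2 * pi * a) / 4 * f (m - 1) x) has_integral
      1/2 * 0 + cis (- 2 * pi * a) / 4 * 0 + cis (2 * pi * a) / 4 * 0) {0..1}"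
    by (intro has_integral_add has_integral_mult_right f)
  ultimately show ?case by (simp add: integral_unique)
qed

theorem fourier_coefficients_zero_imp_zero:
  fixes D :: "real \<Rightarrow> complex"
  assumes D: "continuous_on {0..1} D"
    and zero: "\<And>m::int. integral {0..1} (\<lambda>x. D x * cis (2 * pi * m * x)) = 0"
    and a: "a \<in> {0..1}"
  shows "D a = 0"
proof (rule continuous_constant_on_closure [of "{0<..<1}" D 0 a])
  show "continuous_on (closure {0<..<1}) D" using D by simp
  show "a \<in> closure {0<..<1}" using a by simp
  fix b :: real assume b: "b \<in> {0<..<1}"
  show "D b = 0"
  proof (rule concentrating_kernel_orthogonal_imp_zero [OF D, of b "cos_kernel b"])
    show "integral {0..1} (\<lambda>x. D x * of_real (cos_kernel b n x)) = 0" for n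
      using cos_kernel_orthogonal [OF D zero, of b n 0] by simp
    define d where "d = min (1/2) (min b (1 - b))"
    have d: "0 < d" "d \<le> 1/2" "d \<le> b" "d \<le> 1 - b"
      unfolding d_def using b by (auto simp: min_def)
    have "0 < cos (pi * (d / 2))"
      using d by (intro cos_gt_zero_pi) (auto simp: field_simps intro: less_trans [of _ 0])
    then have "0 < d * cos (pi * (d / 2)) ^ (2 * n)" for n
      using d by simp
    then show "0 < integral {0..1} (cos_kernel b n)" for n
      using cos_kernel_integral_ge [OF d] by (rule less_le_trans)
  qed (use b cos_kernel_concentrates in \<open>auto intro: continuous_on_cos_kernel cos_kernel_nonneg\<close>)
qed

lemma has_sum_int_imp_symmetric_LIMSEQ:
  assumes "(f has_sum S) (UNIV :: int set)"
  shows "(\<lambda>n. \<Sum>k\<in>{- int n..int n}. f k) \<longlonglongrightarrow> S"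
proof -
  have "filterlim (\<lambda>n. {- int n..int n}) (finite_subsets_at_top UNIV) sequentially"
  proof (rule filterlim_finite_subsets_at_top [THEN iffD2], safe)
    fix X :: "int set" assume "finite X"
    define m where "m = nat (\<Sum>x\<in>X. \<bar>x\<bar>)"
    have m: "\<bar>x\<bar> \<le> int m" if "x \<in> X" for x
      unfolding m_def using member_le_sum [of x X abs] that \<open>finite X\<close> by auto
    show "\<forall>\<^sub>F n in sequentially.
        finite {- int n..int n} \<and> X \<subseteq> {- int n..int n} \<and> {- int n..int n} \<subseteq> UNIV"
      using eventually_ge_at_top [of m] by eventually_elim (use m in force)
  qed
  with assms show ?thesis unfolding has_sum_def by (rule filterlim_compose)
qed

context
  fixes f :: "'i \<Rightarrow> real \<Rightarrow> complex" and M :: "'i \<Rightarrow> real"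
  assumes cont: "\<And>k. continuous_on {0..1} (f k)"
    and dominated: "\<And>k x. x \<in> {0..1} \<Longrightarrow> norm (f k x) \<le> M k"
    and summable: "M summable_on UNIV"
begin

private lemma uniform_limit_infsum:
  "uniform_limit {0..1} (\<lambda>X x. \<Sum>k\<in>X. f k x) (\<lambda>x. \<Sum>\<^sub>\<infinity>k. f k x) (finite_subsets_at_top UNIV)"
  by (rule Weierstrass_m_test_general [OF dominated summable])

lemma continuous_on_infsum_dominated: "continuous_on {0..1} (\<lambda>x. \<Sum>\<^sub>\<infinity>k. f k x)"
  by (rule uniform_limit_theorem [OF _ uniform_limit_infsum])
     (auto intro!: always_eventually continuous_intros cont)

lemma has_sum_integral_dominated:
  "((\<lambda>k. integral {0..1} (f k)) has_sum integral {0..1} (\<lambda>x. \<Sum>\<^sub>\<infinity>k. f k x)) UNIV"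
proof -
  have lim: "uniform_limit (cbox 0 1) (\<lambda>X x. \<Sum>k\<in>X. f k x) (\<lambda>x. \<Sum>\<^sub>\<infinity>k. f k x)
      (finite_subsets_at_top UNIV)"
    using uniform_limit_infsum by simp
  have "continuous_on (cbox 0 1) (\<lambda>x. \<Sum>k\<in>X. f k x)" for X
    unfolding box_real by (intro continuous_on_sum cont)
  then obtain I J where I: "\<And>X. ((\<lambda>x. \<Sum>k\<in>X. f k x) has_integral I X) (cbox 0 1)"
    and J: "((\<lambda>x. \<Sum>\<^sub>\<infinity>k. f k x) has_integral J) (cbox 0 1)"
    and I_J: "(I \<longlongrightarrow> J) (finite_subsets_at_top UNIV)"
    by (rule uniform_limit_integral_cbox [OF lim _ finite_subsets_at_top_neq_bot]) blast+
  have "I X = (\<Sum>k\<in>X. integral {0..1} (f k))" if "finite X" for X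
  proof -
    have "((\<lambda>x. \<Sum>k\<in>X. f k x) has_integral (\<Sum>k\<in>X. integral {0..1} (f k))) {0..1}"
      using that
      by (intro has_integral_sum integrable_integral integrable_continuous_interval cont)
    then show ?thesis using I [of X] by (auto dest: has_integral_unique)
  qed
  then have "\<forall>\<^sub>F X in finite_subsets_at_top UNIV. I X = (\<Sum>k\<in>X. integral {0..1} (f k))"
    by (intro eventually_finite_subsets_at_top_weakI)
  moreover have "J = integral {0..1} (\<lambda>x. \<Sum>\<^sub>\<infinity>k. f k x)" using J by (simp add: integral_unique)
  ultimately show ?thesis
    using I_J unfolding has_sum_def by (auto elim!: Lim_transform_eventually)
qed

end

lemma sum_integral_unit_intervals:
  fixes g :: "real \<Rightarrow> complex"
  assumes "continuous_on UNIV g"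
  shows "(\<Sum>k\<in>{- int n..int n}. integral {of_int k..of_int k + 1} g) =
    integral {- real n..real n + 1} g"
proof (induction n)
  case (Suc n)
  have g: "g integrable_on {a..b}" for a b
    using assms by (intro integrable_continuous_interval) (auto intro: continuous_on_subset)
  have "(\<Sum>k\<in>{- int (Suc n)..int (Suc n)}. integral {of_int k..of_int k + 1} g) =
      (integral {- real (Suc n)..- real n} g + integral {- real n..real n + 1} g)
        + integral {real n + 1..real (Suc n) + 1} g"
    unfolding int_symmetric_interval_Suc using Suc.IH by (simp add: add_ac)
  also have "integral {- real (Suc n)..- real n} g + integral {- real n..real n + 1} g =
      integral {- real (Suc n)..real n + 1} g"
    by (rule Henstock_Kurzweil_Integration.integral_combine [OF _ _ g]) auto
  also have "\<dots> + integral {real n + 1..real (Suc n) + 1} g =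
      integral {- real (Suc n)..real (Suc n) + 1} g"
    by (rule Henstock_Kurzweil_Integration.integral_combine [OF _ _ g]) auto
  finally show ?case .
qed simp

lemma LIMSEQ_integral_symmetric:
  fixes g :: "real \<Rightarrow> complex"
  assumes g: "integrable lborel g"
  shows "(\<lambda>n. integral {- real n..real n + 1} g) \<longlonglongrightarrow> (LINT x|lborel. g x)"
proof -
  have "(\<lambda>n. LINT x|lborel. indicator {- real n..real n + 1} x *\<^sub>R g x) \<longlonglongrightarrow> (LINT x|lborel. g x)"
  proof (rule integral_dominated_convergence [where w = "\<lambda>x. norm (g x)"])
    show "AE x in lborel. (\<lambda>n. indicator {- real n..real n + 1} x *\<^sub>R g x) \<longlonglongrightarrow> g x"
    proof (rule AE_I2)
      fix x :: real
      obtain N :: nat where N: "\<bar>x\<bar> \<le> real N" using real_arch_simple by blast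
      have "\<forall>\<^sub>F n in sequentially. indicator {- real n..real n + 1} x *\<^sub>R g x = g x"
        using eventually_ge_at_top [of N]
        by eventually_elim (use N in \<open>auto simp: indicator_def\<close>)
      then show "(\<lambda>n. indicator {- real n..real n + 1} x *\<^sub>R g x) \<longlonglongrightarrow> g x"
        by (rule tendsto_eventually)
    qed
  qed (use g in \<open>auto simp: indicator_def\<close>)
  moreover have "(LINT x|lborel. indicator {a..b} x *\<^sub>R g x) = integral {a..b} g" for a b
    using set_borel_integral_eq_integral(2) [of "{a..b}" g] g
    by (simp add: set_lebesgue_integral_def set_integrable_def integrable_mult_indicator)
  ultimately show ?thesis by simp
qed

lemma integral_periodization:
  fixes g :: "real \<Rightarrow> complex"
  assumes g: "continuous_on UNIV g" "integrable lborel g"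
    and dominated: "\<And>x k. x \<in> {0..1} \<Longrightarrow> norm (g (x + of_int k)) \<le> M k"
    and M: "M summable_on UNIV"
  shows "integral {0..1} (\<lambda>x. \<Sum>\<^sub>\<infinity>k::int. g (x + of_int k)) = (LINT x|lborel. g x)"
proof (rule LIMSEQ_unique)
  have "continuous_on {0..1} (\<lambda>x. g (x + of_int k))" for k :: int
    by (auto intro!: continuous_on_compose2 [OF g(1)] continuous_intros)
  note partial_sums =
    has_sum_int_imp_symmetric_LIMSEQ [OF has_sum_integral_dominated [OF this dominated M]]
  have "integral {0..1} (\<lambda>x. g (x + of_int k)) = integral {of_int k..of_int k + 1} g" for k :: int
    using integral_shift_real_ivl [of "of_int k" "of_int k" "of_int k + 1" g] by simp
  with partial_sums show "(\<lambda>n. integral {- real n..real n + 1} g) \<longlonglongrightarrow>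
      integral {0..1} (\<lambda>x. \<Sum>\<^sub>\<infinity>k::int. g (x + of_int k))"
    by (simp only: sum_integral_unit_intervals [OF g(1)])
qed (rule LIMSEQ_integral_symmetric [OF g(2)])

lemma integral_cis_int:
  fixes m :: int
  shows "integral {0..1} (\<lambda>x. cis (2 * pi * m * x)) = (if m = 0 then 1 else 0)"
proof (cases "m = 0")
  case False
  define c where "c = \<i> * of_real (2 * pi * m)"
  have c: "c \<noteq> 0" using False by (simp add: c_def)
  define F where "F x = exp (c * of_real x) / c" for x :: real
  have "((\<lambda>x. cis (2 * pi * m * x)) has_integral (F 1 - F 0)) {0..1}"
  proof (rule fundamental_theorem_of_calculus)
    fix x :: real
    have "((\<lambda>z. exp (c * z) / c) has_field_derivative exp (c * of_real x)) (at (of_real x))"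
      using c by (auto intro!: derivative_eq_intros)
    then have "(F has_vector_derivative exp (c * of_real x)) (at x within {0..1})"
      unfolding F_def by (rule has_vector_derivative_real_field)
    moreover have "exp (c * of_real x) = cis (2 * pi * m * x)"
      by (simp add: c_def cis_conv_exp mult_ac)
    ultimately show "(F has_vector_derivative cis (2 * pi * m * x)) (at x within {0..1})" by simp
  qed simp
  moreover have "F 1 = F 0"
    using cis_multiple_2pi [of "of_int m"] by (simp add: F_def c_def cis_conv_exp mult_ac)
  ultimately show ?thesis using False by (simp add: integral_unique)
qed simp

lemma fourier_coefficient_of_series:
  fixes c :: "int \<Rightarrow> complex" and m :: int
  assumes c: "(\<lambda>k. norm (c k)) summable_on UNIV"
  shows "integral {0..1} (\<lambda>x. (\<Sum>\<^sub>\<infinity>k. c k * cis (2 * pi * k * x)) * cis (- 2 * pi * m * x)) = c m"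
proof -
  have "((\<lambda>k. integral {0..1} (\<lambda>x. c k * cis (2 * pi * (k - m) * x))) has_sum
      integral {0..1} (\<lambda>x. \<Sum>\<^sub>\<infinity>k. c k * cis (2 * pi * (k - m) * x))) UNIV"
    by (rule has_sum_integral_dominated [OF _ _ c])
       (auto intro!: continuous_intros simp: norm_mult)
  moreover have "integral {0..1} (\<lambda>x. c k * cis (2 * pi * (k - m) * x)) =
      (if k = m then c m else 0)" for k
    using integral_cis_int [of "k - m"] by simp
  ultimately have "((\<lambda>k. if k = m then c m else 0) has_sum
      integral {0..1} (\<lambda>x. \<Sum>\<^sub>\<infinity>k. c k * cis (2 * pi * (k - m) * x))) UNIV"
    by (simp only:)
  moreover have "((\<lambda>k. if k = m then c m else 0) has_sum c m) UNIV"
    by (rule has_sum_finite_neutralI [of "{m}"]) auto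
  ultimately have "integral {0..1} (\<lambda>x. \<Sum>\<^sub>\<infinity>k. c k * cis (2 * pi * (k - m) * x)) = c m"
    by (rule has_sum_unique)
  moreover have "c k * cis (2 * pi * (k - m) * x) =
      c k * cis (2 * pi * k * x) * cis (- 2 * pi * m * x)" for k x
    by (simp add: cis_mult algebra_simps)
  ultimately show ?thesis by (simp only: infsum_cmult_left')
qed

lemma fourier_coefficient_of_periodization:
  fixes g :: "real \<Rightarrow> complex" and m :: int
  assumes g: "continuous_on UNIV g" "integrable lborel g"
    and dominated: "\<And>x k. x \<in> {0..1} \<Longrightarrow> norm (g (x + of_int k)) \<le> M k"
    and M: "M summable_on UNIV"
  shows "integral {0..1} (\<lambda>x. (\<Sum>\<^sub>\<infinity>k::int. g (x + of_int k)) * cis (- 2 * pi * m * x)) =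
    (LINT x|lborel. g x * cis (- 2 * pi * m * x))"
proof -
  define h where "h x = g x * cis (- 2 * pi * m * x)" for x
  have h: "continuous_on UNIV h"
    unfolding h_def by (intro continuous_intros g)
  have "integrable lborel h"
    by (rule Bochner_Integration.integrable_bound [OF g(2)])
       (use h in \<open>auto simp: h_def norm_mult intro: borel_measurable_continuous_onI\<close>)
  moreover have periodic: "h (x + of_int k) = g (x + of_int k) * cis (- 2 * pi * m * x)"
    for x and k :: int
  proof -
    have "cis (- 2 * pi * m * (x + of_int k)) =
        cis (- 2 * pi * m * x) * cis (2 * pi * of_int (- m * k))"
      by (simp add: cis_mult algebra_simps)
    also have "cis (2 * pi * of_int (- m * k)) = 1"
      by (rule cis_multiple_2pi) simp
    finally show ?thesis by (simp add: h_def)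
  qed
  ultimately have "integral {0..1} (\<lambda>x. \<Sum>\<^sub>\<infinity>k::int. h (x + of_int k)) = (LINT x|lborel. h x)"
    using integral_periodization [OF h _ _ M] dominated by (simp add: norm_mult h_def)
  then show ?thesis unfolding periodic by (simp only: infsum_cmult_left' h_def)
qed

theorem poisson_summation:
  fixes g :: "real \<Rightarrow> complex" and c :: "int \<Rightarrow> complex"
  assumes g: "continuous_on UNIV g" "integrable lborel g"
    and dominated: "\<And>x k. x \<in> {0..1} \<Longrightarrow> norm (g (x + of_int k)) \<le> M k"
    and M: "M summable_on UNIV"
    and transform: "\<And>m. (LINT x|lborel. g x * cis (- 2 * pi * of_int m * x)) = c m"
    and c: "(\<lambda>m. norm (c m)) summable_on UNIV" and a: "a \<in> {0..1}"
  shows "(\<Sum>\<^sub>\<infinity>k::int. g (a + of_int k)) = (\<Sum>\<^sub>\<infinity>m. c m * cis (2 * pi * of_int m * a))"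
proof -
  define G where "G x = (\<Sum>\<^sub>\<infinity>k::int. g (x + of_int k))" for x
  define H where "H x = (\<Sum>\<^sub>\<infinity>m. c m * cis (2 * pi * of_int m * x))" for x
  have "continuous_on {0..1} (\<lambda>x. g (x + of_int k))" for k :: int
    by (auto intro!: continuous_on_compose2 [OF g(1)] continuous_intros)
  then have G: "continuous_on {0..1} G"
    unfolding G_def by (rule continuous_on_infsum_dominated [OF _ dominated M])
  have H: "continuous_on {0..1} H"
    unfolding H_def
    by (rule continuous_on_infsum_dominated [OF _ _ c])
       (auto intro!: continuous_intros simp: norm_mult)
  have G_coefficient: "integral {0..1} (\<lambda>x. G x * cis (- 2 * pi * of_int m * x)) = c m" for m
    unfolding G_def transform [symmetric]
    by (rule fourier_coefficient_of_periodization [OF g dominated M])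
  have "G a - H a = 0"
  proof (rule fourier_coefficients_zero_imp_zero [OF _ _ a])
    show "continuous_on {0..1} (\<lambda>x. G x - H x)" by (intro continuous_intros G H)
    fix m :: int
    have "integral {0..1} (\<lambda>x. (G x - H x) * cis (- 2 * pi * of_int (- m) * x)) =
        integral {0..1} (\<lambda>x. G x * cis (- 2 * pi * of_int (- m) * x))
          - integral {0..1} (\<lambda>x. H x * cis (- 2 * pi * of_int (- m) * x))"
      unfolding left_diff_distrib
      by (intro integral_diff integrable_continuous_interval continuous_intros G H)
    also have "\<dots> = 0"
      unfolding G_coefficient H_def fourier_coefficient_of_series [OF c] by simp
    finally show "integral {0..1} (\<lambda>x. (G x - H x) * cis (2 * pi * m * x)) = 0" by simp
  qed
  then show ?thesis by (simp add: G_def H_def)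
qed

lemma summable_on_int_power_abs:
  fixes r :: real assumes "0 \<le> r" "r < 1"
  shows "(\<lambda>k::int. r ^ nat \<bar>k\<bar>) summable_on UNIV"
proof -
  have nat: "(\<lambda>n. r ^ n) summable_on UNIV"
    using assms by (intro norm_summable_imp_summable_on) (simp add: summable_geometric norm_power)
  have "(\<lambda>k::int. r ^ nat \<bar>k\<bar>) summable_on range int"
    using nat by (subst summable_on_reindex) (simp_all add: o_def)
  moreover have "(\<lambda>k::int. r ^ nat \<bar>k\<bar>) summable_on range (\<lambda>n. - int n)"
    using nat by (subst summable_on_reindex) (simp_all add: o_def inj_on_def)
  ultimately have "(\<lambda>k::int. r ^ nat \<bar>k\<bar>) summable_on (range int \<union> range (\<lambda>n. - int n))"
    by (rule summable_on_union)
  moreover have "range int \<union> range (\<lambda>n. - int n) = UNIV"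
    by (auto simp: image_iff) (metis int_cases2)
  ultimately show ?thesis by simp
qed

definition gaussian :: "real \<Rightarrow> real \<Rightarrow> real" where
  "gaussian t x = exp (- pi * t * x\<^sup>2)"

lemma gaussian_shift_le:
  fixes x t :: real and k :: int
  assumes t: "t > 0" and x: "x \<in> {0..1}"
  shows "gaussian t (x + k) \<le> exp (pi * t) * exp (- pi * t) ^ nat \<bar>k\<bar>"
proof -
  have "\<bar>real_of_int k\<bar> - 1 \<le> (x + k)\<^sup>2"
  proof (cases "k = 0")
    case False
    define j where "j = \<bar>k\<bar> - 1"
    have j: "\<bar>real_of_int k\<bar> - 1 = real_of_int j" "j \<ge> 0"
      using False by (simp_all add: j_def)
    then have "j \<le> j\<^sup>2"
      by (cases "j = 0") (auto simp: power2_eq_square mult_le_cancel_left1)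
    then have "\<bar>real_of_int k\<bar> - 1 \<le> (\<bar>real_of_int k\<bar> - 1)\<^sup>2"
      unfolding j(1) by (metis of_int_le_iff of_int_power)
    also have "\<dots> \<le> \<bar>x + k\<bar>\<^sup>2" using j x by (intro power_mono) auto
    finally show ?thesis by simp
  qed (auto intro: order_trans [of _ 0])
  then have "pi * t * (\<bar>real_of_int k\<bar> - 1) \<le> pi * t * (x + k)\<^sup>2"
    using t by (intro mult_left_mono) auto
  then have "gaussian t (x + k) \<le> exp (pi * t + real (nat \<bar>k\<bar>) * (- pi * t))"
    by (simp add: gaussian_def algebra_simps)
  also have "\<dots> = exp (pi * t) * exp (- pi * t) ^ nat \<bar>k\<bar>"
    by (simp only: exp_add exp_of_nat_mult)
  finally show ?thesis .
qed

lemma summable_gaussian_majorant: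
  "t > 0 \<Longrightarrow> (\<lambda>k::int. exp (pi * t) * exp (- pi * t) ^ nat \<bar>k\<bar>) summable_on UNIV"
  by (intro summable_on_cmult_right summable_on_int_power_abs) auto

lemma summable_gaussian_shift:
  assumes "t > 0" "x \<in> {0..1}" shows "(\<lambda>k::int. gaussian t (x + k)) summable_on UNIV"
  by (rule summable_on_comparison_test [OF summable_gaussian_majorant [OF assms(1)]])
     (use gaussian_shift_le [OF assms] in \<open>auto simp: gaussian_def\<close>)

lemma gaussian_fourier_transform:
  fixes t \<xi> :: real assumes t: "t > 0"
  shows "has_bochner_integral lborel (\<lambda>x. of_real (gaussian t x) * cis (2 * pi * \<xi> * x))
           (complex_of_real (gaussian (1 / t) \<xi> / sqrt t))"
proof -
  define c where "c = sqrt (2 * pi * t)"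
  have c: "c > 0" "c\<^sup>2 = 2 * pi * t" using t by (auto simp: c_def)
  define s where "s = 2 * pi * \<xi> / c"
  let ?f = "\<lambda>x. of_real (std_normal_density x) * cis (s * x)"
  have "integrable lborel ?f"
  proof (rule Bochner_Integration.integrable_bound [of lborel std_normal_density])
    have "?f \<in> borel_measurable borel"
      unfolding normal_density_def by (intro borel_measurable_continuous_onI continuous_intros) auto
    then show "?f \<in> borel_measurable lborel" by simp
  qed (simp_all add: norm_mult)
  moreover have "(LINT x|lborel. ?f x) = of_real (exp (- (s\<^sup>2) / 2))"
    using char_std_normal_distribution unfolding char_def
    by (subst (asm) integral_density) (auto simp: cis_conv_exp scaleR_conv_of_real fun_eq_iff)
  ultimately have "has_bochner_integral lborel ?f (of_real (exp (- (s\<^sup>2) / 2)))"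
    by (simp add: has_bochner_integral_iff)
  then have "has_bochner_integral lborel (\<lambda>x. ?f (0 + c * x))
      (of_real (exp (- (s\<^sup>2) / 2)) /\<^sub>R \<bar>c\<bar>)"
    by (rule lborel_has_bochner_integral_real_affine_iff [THEN iffD1, rotated]) (use c in simp)
  then have "has_bochner_integral lborel (\<lambda>x. of_real (sqrt (2 * pi)) * ?f (0 + c * x))
      (of_real (sqrt (2 * pi)) * (of_real (exp (- (s\<^sup>2) / 2)) /\<^sub>R \<bar>c\<bar>))"
    by (rule has_bochner_integral_mult_right)
  moreover have "of_real (sqrt (2 * pi)) * ?f (0 + c * x) =
      of_real (gaussian t x) * cis (2 * pi * \<xi> * x)" for x
    using c t by (simp add: std_normal_density_def power_mult_distrib s_def mult_ac gaussian_def)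
  moreover have "- (s\<^sup>2) / 2 = - pi * (1 / t) * \<xi>\<^sup>2"
    unfolding s_def power_divide c using t by (simp add: power2_eq_square field_simps)
  then have "sqrt (2 * pi) * (exp (- (s\<^sup>2) / 2) / \<bar>c\<bar>) = gaussian (1 / t) \<xi> / sqrt t"
    using t by (simp add: c_def real_sqrt_mult gaussian_def)
  then have "of_real (sqrt (2 * pi)) * (of_real (exp (- (s\<^sup>2) / 2)) /\<^sub>R \<bar>c\<bar>) =
      complex_of_real (gaussian (1 / t) \<xi> / sqrt t)"
    by (simp only: scaleR_conv_of_real divide_inverse flip: of_real_mult) (simp add: mult_ac)
  ultimately show ?thesis by simp
qed

theorem theta_inversion:
  fixes t a :: real assumes t: "t > 0" and a: "a \<in> {0..1}"
  shows "(\<Sum>\<^sub>\<infinity>k::int. complex_of_real (gaussian t (a + k))) =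
    (\<Sum>\<^sub>\<infinity>k::int. of_real (gaussian (1 / t) k) * cis (2 * pi * k * a)) / sqrt t"
proof -
  have "(\<Sum>\<^sub>\<infinity>k::int. complex_of_real (gaussian t (a + k))) =
      (\<Sum>\<^sub>\<infinity>m::int. of_real (gaussian (1 / t) m / sqrt t) * cis (2 * pi * m * a))"
  proof (rule poisson_summation [OF _ _ _ summable_gaussian_majorant [OF t] _ _ a])
    show "continuous_on UNIV (\<lambda>x. complex_of_real (gaussian t x))"
      unfolding gaussian_def by (intro continuous_intros)
    show "integrable lborel (\<lambda>x. complex_of_real (gaussian t x))"
      using gaussian_fourier_transform [OF t, of 0] by (auto simp: has_bochner_integral_iff)
    show "norm (complex_of_real (gaussian t (x + of_int k))) \<le>
        exp (pi * t) * exp (- pi * t) ^ nat \<bar>k\<bar>"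
      if "x \<in> {0..1}" for x and k :: int
      using gaussian_shift_le [OF t that, of k] by (simp add: gaussian_def)
    show "(LINT x|lborel. of_real (gaussian t x) * cis (- 2 * pi * of_int m * x)) =
        of_real (gaussian (1 / t) (of_int m) / sqrt t)" for m :: int
      using gaussian_fourier_transform [OF t, of "- of_int m"]
      by (simp add: has_bochner_integral_iff gaussian_def)
    have "(\<lambda>m::int. gaussian (1 / t) m / sqrt t) summable_on UNIV"
      using summable_gaussian_shift [of "1 / t" 0] t
      unfolding divide_inverse by (intro summable_on_cmult_left) simp
    then show "(\<lambda>m::int. norm (complex_of_real (gaussian (1 / t) m / sqrt t))) summable_on UNIV"
      using t by (simp add: gaussian_def norm_divide)
  qed
  also have "\<dots> =
      (\<Sum>\<^sub>\<infinity>m::int. of_real (gaussian (1 / t) m) * cis (2 * pi * m * a) * inverse (of_real (sqrt t)))"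
    by (simp add: field_simps)
  also have "\<dots> =
      (\<Sum>\<^sub>\<infinity>m::int. of_real (gaussian (1 / t) m) * cis (2 * pi * m * a)) * inverse (of_real (sqrt t))"
    by (rule infsum_cmult_left')
  finally show ?thesis by (simp add: divide_inverse)
qed

section \<open>Gauss sums\<close>

definition unity_root :: "int \<Rightarrow> int \<Rightarrow> complex" where
  "unity_root c n = cis (2 * pi * (of_int n / of_int c))"

lemma unity_root_0 [simp]: "unity_root c 0 = 1"
  by (simp add: unity_root_def)

lemma norm_unity_root [simp]: "norm (unity_root c n) = 1"
  by (simp add: unity_root_def)

lemma unity_root_add: "unity_root c (m + n) = unity_root c m * unity_root c n"
  by (simp add: unity_root_def cis_mult ring_distribs add_divide_distrib)

lemma unity_root_self: "c \<noteq> 0 \<Longrightarrow> unity_root c (c * k) = 1"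
  using cis_multiple_2pi [of "of_int k"] by (simp add: unity_root_def)

lemma unity_root_cong:
  assumes "[m = n] (mod c)" shows "unity_root c m = unity_root c n"
proof (cases "c = 0")
  case False
  obtain k where "m = n + c * k" using assms by (metis cong_iff_lin cong_sym)
  then show ?thesis using False by (simp add: unity_root_add unity_root_self)
qed (use assms in \<open>simp add: cong_def\<close>)

lemma unity_root_mult_cancel: "k \<noteq> 0 \<Longrightarrow> unity_root (k * c) (k * n) = unity_root c n"
  by (simp add: unity_root_def)

lemma unity_root_mult_of_nat: "unity_root c (n * int k) = unity_root c n ^ k"
  by (induction k) (auto simp: ring_distribs unity_root_add)

lemma unity_root_plus_conjugate:
  "unity_root c n + unity_root c (- n) = of_real (2 * cos (2 * pi * (of_int n / of_int c)))"
  by (simp add: unity_root_def complex_eq_iff)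

lemma unity_root_eq_1_iff:
  assumes "c > 0" shows "unity_root c n = 1 \<longleftrightarrow> c dvd n"
proof
  assume "unity_root c n = 1"
  then have "cos (2 * pi * (of_int n / of_int c)) = 1"
    by (metis unity_root_def cis.sel(1) one_complex.sel(1))
  then obtain k :: int where "2 * pi * (real_of_int n / of_int c) = of_int k * 2 * pi"
    by (auto simp: cos_one_2pi_int)
  then have "real_of_int n = real_of_int (k * c)" using assms by (simp add: field_simps)
  then have "n = k * c" by (simp only: of_int_eq_iff)
  then show "c dvd n" by simp
next
  assume "c dvd n"
  then show "unity_root c n = 1" using assms by (auto elim!: dvdE simp: unity_root_self)
qed

lemma sum_unity_root:
  assumes "c > 0"
  shows "(\<Sum>x\<in>{0..<c}. unity_root c (n * x)) = (if c dvd n then of_int c else 0)"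
proof -
  define w where "w = unity_root c n"
  have "(\<Sum>x\<in>{0..<c}. unity_root c (n * x)) = (\<Sum>k<nat c. unity_root c (n * int k))"
    by (rule sum.reindex_bij_witness [of _ int nat]) (use assms in auto)
  also have "\<dots> = (\<Sum>k<nat c. w ^ k)"
    by (simp add: w_def unity_root_mult_of_nat)
  also have "\<dots> = (if w = 1 then of_nat (nat c) else (1 - w ^ nat c) / (1 - w))"
    by (simp add: sum_gp_strict)
  also have "w ^ nat c = 1"
    using assms unity_root_mult_of_nat [of c n "nat c"] unity_root_self [of c n]
    by (simp add: w_def mult.commute)
  finally show ?thesis using assms unity_root_eq_1_iff [of c n] by (simp add: w_def)
qed

lemma sum_residues_reindex:
  fixes f :: "int \<Rightarrow> 'a::comm_monoid_add"
  assumes c: "c > 0" and periodic: "\<And>x. f (x mod c) = f x"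
    and inj: "\<And>x y. [g x = g y] (mod c) \<Longrightarrow> [x = y] (mod c)"
  shows "(\<Sum>x\<in>{0..<c}. f (g x)) = (\<Sum>x\<in>{0..<c}. f x)"
proof -
  have inj_on: "inj_on (\<lambda>x. g x mod c) {0..<c}"
  proof (rule inj_onI)
    fix x y assume xy: "x \<in> {0..<c}" "y \<in> {0..<c}" and "g x mod c = g y mod c"
    then have "[x = y] (mod c)" using inj [of x y] by (simp only: cong_def)
    then show "x = y" using xy by (simp add: cong_def)
  qed
  have "(\<lambda>x. g x mod c) ` {0..<c} \<subseteq> {0..<c}" using c by auto
  then have "(\<lambda>x. g x mod c) ` {0..<c} = {0..<c}"
    using inj_on by (intro card_subset_eq) (auto simp: card_image)
  then have "(\<Sum>x\<in>{0..<c}. f x) = sum f ((\<lambda>x. g x mod c) ` {0..<c})" by (simp only:)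
  also have "\<dots> = (\<Sum>x\<in>{0..<c}. f (g x mod c))"
    by (simp only: sum.reindex [OF inj_on] o_def)
  finally show ?thesis by (simp only: periodic)
qed

lemma sum_residues_mult_coprime:
  fixes f :: "int \<Rightarrow> 'a::comm_monoid_add"
  assumes a: "a > 0" and c: "c > 0" and coprime: "coprime a c"
    and periodic: "\<And>n. f (n mod (a * c)) = f n"
  shows "(\<Sum>n\<in>{0..<a * c}. f n) = (\<Sum>x\<in>{0..<c}. \<Sum>y\<in>{0..<a}. f (a * x + c * y))"
proof -
  define g where "g = (\<lambda>(x, y). (a * x + c * y) mod (a * c))"
  have inj: "inj_on g ({0..<c} \<times> {0..<a})"
  proof (rule inj_onI, clarify)
    fix x y x' y'
    assume range: "x \<in> {0..<c}" "y \<in> {0..<a}" "x' \<in> {0..<c}" "y' \<in> {0..<a}"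
      and "g (x, y) = g (x', y')"
    then have eq: "[a * x + c * y = a * x' + c * y'] (mod a * c)" by (simp add: g_def cong_def)
    then have "[a * x + c * y = a * x' + c * y'] (mod c)" by (rule cong_dvd_modulus) simp
    then have "[a * x = a * x'] (mod c)" by (simp add: cong_def)
    then have "[x = x'] (mod c)" using coprime by (simp add: cong_mult_lcancel)
    moreover have "[a * x + c * y = a * x' + c * y'] (mod a)"
      using eq by (rule cong_dvd_modulus) simp
    then have "[c * y = c * y'] (mod a)" by (simp add: cong_def)
    then have "[y = y'] (mod a)" using coprime by (simp add: cong_mult_lcancel coprime_commute)
    ultimately show "x = x' \<and> y = y'" using range by (simp add: cong_def)
  qed
  have "g ` ({0..<c} \<times> {0..<a}) \<subseteq> {0..<a * c}" using a c by (auto simp: g_def)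
  then have "g ` ({0..<c} \<times> {0..<a}) = {0..<a * c}"
    using a c by (intro card_subset_eq) (auto simp: card_image [OF inj] nat_mult_distrib)
  then have "(\<Sum>n\<in>{0..<a * c}. f n) = (\<Sum>z\<in>{0..<c} \<times> {0..<a}. f (g z))"
    by (metis sum.reindex_cong [OF inj])
  also have "\<dots> = (\<Sum>(x, y)\<in>{0..<c} \<times> {0..<a}. f (a * x + c * y))"
    by (intro sum.cong) (auto simp: g_def periodic)
  finally show ?thesis by (simp only: sum.cartesian_product)
qed

lemma sum_residues_mult:
  fixes f :: "int \<Rightarrow> 'a::comm_monoid_add"
  assumes a: "a > 0" and c: "c > 0"
  shows "(\<Sum>n\<in>{0..<a * c}. f n) = (\<Sum>u\<in>{0..<a}. \<Sum>v\<in>{0..<c}. f (u + a * v))"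
proof -
  have "(\<Sum>n\<in>{0..<a * c}. f n) = (\<Sum>(u, v)\<in>{0..<a} \<times> {0..<c}. f (u + a * v))"
  proof (rule sum.reindex_bij_witness [of _ "\<lambda>(u, v). u + a * v" "\<lambda>n. (n mod a, n div a)"])
    fix z assume "z \<in> {0..<a} \<times> {0..<c}"
    then obtain u v where z: "z = (u, v)" "0 \<le> u" "u < a" "0 \<le> v" "v \<le> c - 1" by auto
    then have "u + a * v < a + a * (c - 1)" using a by (intro add_less_le_mono mult_left_mono) auto
    then show "(case z of (u, v) \<Rightarrow> u + a * v) \<in> {0..<a * c}"
      using z a by (simp add: algebra_simps)
  next
    fix n assume n: "n \<in> {0..<a * c}"
    have "a * (n div a) \<le> n"
      using mult_div_mod_eq [of a n] pos_mod_sign [OF a, of n] by linarith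
    also have "n < a * c" using n by simp
    finally have "n div a < c" using a by simp
    then show "(n mod a, n div a) \<in> {0..<a} \<times> {0..<c}"
      using n a by (simp add: pos_imp_zdiv_nonneg_iff)
  qed (use a in auto)
  then show ?thesis by (simp only: sum.cartesian_product)
qed

definition character_sum :: "(int \<Rightarrow> int) \<Rightarrow> int \<Rightarrow> int \<Rightarrow> complex" where
  "character_sum \<psi> c m = (\<Sum>u\<in>{0..<c}. of_int (\<psi> u) * unity_root c (m * u))"

locale real_character =
  fixes \<psi> :: "int \<Rightarrow> int" and c :: int
  assumes modulus_pos: "c > 0"
    and mod [simp]: "\<And>n. \<psi> (n mod c) = \<psi> n"
    and mult: "\<And>m n. \<psi> (m * n) = \<psi> m * \<psi> n"
    and square: "\<And>n. coprime n c \<Longrightarrow> \<psi> n * \<psi> n = 1"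
begin

lemma cong: "[m = n] (mod c) \<Longrightarrow> \<psi> m = \<psi> n"
  by (metis cong_def mod)

lemma character_sum_mult:
  assumes "coprime k c"
  shows "character_sum \<psi> c (k * m) = of_int (\<psi> k) * character_sum \<psi> c m"
proof -
  define f where "f u = of_int (\<psi> u) * unity_root c (m * u)" for u
  have "f (u mod c) = f u" for u
    by (auto simp: f_def intro!: unity_root_cong cong_mult)
  moreover have "[x = y] (mod c)" if "[k * x = k * y] (mod c)" for x y
    using that assms by (simp add: cong_mult_lcancel)
  ultimately have "(\<Sum>u\<in>{0..<c}. f (k * u)) = (\<Sum>u\<in>{0..<c}. f u)"
    by (rule sum_residues_reindex [OF modulus_pos])
  moreover have "of_int (\<psi> u) * unity_root c (k * m * u) = of_int (\<psi> k) * f (k * u)" for u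
  proof -
    have "of_int (\<psi> k) * f (k * u) =
        of_int (\<psi> k * \<psi> k) * (of_int (\<psi> u) * unity_root c (k * m * u))"
      by (simp add: f_def mult mult_ac)
    then show ?thesis by (simp add: square [OF assms])
  qed
  ultimately show ?thesis
    by (simp add: character_sum_def f_def sum_distrib_left [symmetric])
qed

end

definition chi12 :: "int \<Rightarrow> int" where
  "chi12 n = (if n mod 12 = 1 \<or> n mod 12 = 11 then 1
     else if n mod 12 = 5 \<or> n mod 12 = 7 then -1 else 0)"

lemma int_interval_12: "{0..<12::int} = {0,1,2,3,4,5,6,7,8,9,10,11}"
proof -
  have "{0..<12::int} = set [0..11]" by auto
  also have "\<dots> = {0,1,2,3,4,5,6,7,8,9,10,11}" by (simp add: upto.simps del: set_upto)
  finally show ?thesis .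
qed

lemma mod_12_cases:
  fixes n :: int
  obtains "n mod 12 = 0" | "n mod 12 = 1" | "n mod 12 = 2" | "n mod 12 = 3" | "n mod 12 = 4"
    | "n mod 12 = 5" | "n mod 12 = 6" | "n mod 12 = 7" | "n mod 12 = 8" | "n mod 12 = 9"
    | "n mod 12 = 10" | "n mod 12 = 11"
proof -
  have "n mod 12 \<in> {0..<12}" by simp
  then show ?thesis unfolding int_interval_12 using that by auto
qed

lemma coprime_12_iff: "coprime n 12 \<longleftrightarrow> \<not> 2 dvd n \<and> \<not> 3 dvd (n::int)"
proof -
  have "coprime n 12 \<longleftrightarrow> coprime n 2 \<and> coprime n 3"
    using coprime_mult_right_iff [of n 4 3] coprime_mult_right_iff [of n 2 2] by simp
  moreover have "coprime n 2 \<longleftrightarrow> \<not> 2 dvd n" "coprime n 3 \<longleftrightarrow> \<not> 3 dvd n"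
    using prime_imp_coprime [of 2 n] prime_imp_coprime [of 3 n]
    by (auto simp: coprime_commute)
  ultimately show ?thesis by simp
qed

interpretation chi12: real_character chi12 12
proof
  show "chi12 (n mod 12) = chi12 n" for n by (simp add: chi12_def)
  show "chi12 (m * n) = chi12 m * chi12 n" for m n
  proof -
    have "chi12 (m * n) = chi12 ((m mod 12) * (n mod 12))"
      by (simp add: chi12_def mod_mult_eq)
    also have "\<dots> = chi12 (m mod 12) * chi12 (n mod 12)"
      by (cases m rule: mod_12_cases; cases n rule: mod_12_cases) (simp_all add: chi12_def)
    finally show ?thesis by (simp add: chi12_def)
  qed
  show "chi12 n * chi12 n = 1" if "coprime n 12" for n
  proof -
    have "coprime (n mod 12) 12" using that by simp
    then show ?thesis
      by (cases n rule: mod_12_cases) (simp_all add: chi12_def coprime_12_iff)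
  qed
qed simp

lemma chi12_minus [simp]: "chi12 (- n) = chi12 n"
  using chi12.mult [of "- 1" n] by (simp add: chi12_def [of "- 1"])

lemma chi12_eq_0:
  assumes "\<not> coprime n 12" shows "chi12 n = 0"
proof -
  have "\<not> coprime (n mod 12) 12" using assms by simp
  then show ?thesis by (cases n rule: mod_12_cases) (simp_all add: chi12_def coprime_12_iff)
qed

lemma character_sum_chi12_1: "character_sum chi12 12 1 = sqrt 12"
proof -
  have "unity_root 12 11 = unity_root 12 (- 1)" "unity_root 12 7 = unity_root 12 (- 5)"
    by (auto intro!: unity_root_cong simp: cong_def)
  then have "character_sum chi12 12 1 =
      (unity_root 12 1 + unity_root 12 (- 1)) - (unity_root 12 5 + unity_root 12 (- 5))"
    unfolding character_sum_def int_interval_12 by (simp add: chi12_def)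
  also have "\<dots> = of_real (2 * cos (pi / 6) - 2 * cos (pi - pi / 6))"
    unfolding unity_root_plus_conjugate by (simp add: field_simps)
  also have "2 * cos (pi / 6) - 2 * cos (pi - pi / 6) = 2 * sqrt 3"
    unfolding cos_pi_minus cos_30 by simp
  also have "2 * sqrt 3 = sqrt 12"
    using real_sqrt_mult [of 4 3] by simp
  finally show ?thesis .
qed

text \<open>
  The character is primitive: if \<open>m\<close> is not coprime to 12, then \<open>k m \<equiv> m\<close> for some \<open>k\<close> with
  \<open>chi12 k = -1\<close>.
\<close>

lemma chi12_fourier: "character_sum chi12 12 m = of_int (chi12 m) * sqrt 12"
proof (cases "coprime m 12")
  case True
  then show ?thesis
    using chi12.character_sum_mult [of m 1] by (simp add: character_sum_chi12_1)
next
  case False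
  have zero: "character_sum chi12 12 m = 0"
    if "coprime k 12" "chi12 k = - 1" "12 dvd k * m - m" for k
  proof -
    have "unity_root 12 (k * m * u) = unity_root 12 (m * u)" for u
      using that(3) by (intro unity_root_cong cong_mult cong_refl) (simp add: cong_iff_dvd_diff)
    then have "character_sum chi12 12 (k * m) = character_sum chi12 12 m"
      by (simp add: character_sum_def)
    then show ?thesis using chi12.character_sum_mult [OF that(1), of m] that(2) by simp
  qed
  from False have "2 dvd m \<or> 3 dvd m" by (auto simp: coprime_12_iff)
  then have "character_sum chi12 12 m = 0"
  proof
    assume "2 dvd m"
    then show ?thesis by (intro zero [of 7]) (auto simp: chi12_def coprime_12_iff elim!: dvdE)
  next
    assume "3 dvd m"
    then show ?thesis by (intro zero [of 5]) (auto simp: chi12_def coprime_12_iff elim!: dvdE)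
  qed
  then show ?thesis by (simp add: chi12_eq_0 [OF False])
qed

definition quad_gauss_sum :: "int \<Rightarrow> int \<Rightarrow> complex" where
  "quad_gauss_sum a c = (\<Sum>x\<in>{0..<c}. unity_root c (a * x\<^sup>2))"

lemma quad_gauss_complete_square:
  assumes c: "c > 0" and inverse: "[4 * a * b = - 1] (mod c)"
  shows "(\<Sum>x\<in>{0..<c}. unity_root c (a * x\<^sup>2 + m * x)) =
    unity_root c (b * m\<^sup>2) * quad_gauss_sum a c"
proof -
  define h where "h = - 2 * b * m"
  obtain k where k: "4 * a * b = - 1 + c * k" using inverse by (metis cong_iff_lin cong_sym)
  have "unity_root c (a * x\<^sup>2 + m * x) =
      unity_root c (b * m\<^sup>2) * unity_root c (a * (x + h)\<^sup>2)" for x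
  proof -
    have "a * x\<^sup>2 + m * x - (b * m\<^sup>2 + a * (x + h)\<^sup>2) =
        m * x * (1 + 4 * a * b) - b * m\<^sup>2 * (1 + 4 * a * b)"
      unfolding h_def by (simp add: power2_eq_square algebra_simps)
    also have "\<dots> = c * (k * (m * x - b * m\<^sup>2))"
      unfolding k by (simp add: algebra_simps)
    finally have "[a * x\<^sup>2 + m * x = b * m\<^sup>2 + a * (x + h)\<^sup>2] (mod c)"
      by (simp add: cong_iff_dvd_diff)
    then show ?thesis by (metis unity_root_cong unity_root_add)
  qed
  then have "(\<Sum>x\<in>{0..<c}. unity_root c (a * x\<^sup>2 + m * x)) =
      unity_root c (b * m\<^sup>2) * (\<Sum>x\<in>{0..<c}. unity_root c (a * (x + h)\<^sup>2))"
    by (simp add: sum_distrib_left)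
  also have "(\<Sum>x\<in>{0..<c}. unity_root c (a * (x + h)\<^sup>2)) = quad_gauss_sum a c"
    unfolding quad_gauss_sum_def
  proof (rule sum_residues_reindex [OF c, of "\<lambda>x. unity_root c (a * x\<^sup>2)"])
    show "unity_root c (a * (x mod c)\<^sup>2) = unity_root c (a * x\<^sup>2)" for x
      by (intro unity_root_cong cong_mult cong_pow) auto
  qed (simp add: cong_add_rcancel)
  finally show ?thesis .
qed

definition chi12_quad :: "int \<Rightarrow> int \<Rightarrow> int \<Rightarrow> complex" where
  "chi12_quad c b n = of_int (chi12 n) * unity_root c (b * n\<^sup>2)"

lemma chi12_quad_mod: "chi12_quad c b (n mod (12 * c)) = chi12_quad c b n"
proof -
  have "[n mod (12 * c) = n] (mod 12)" "[n mod (12 * c) = n] (mod c)"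
    by (rule cong_dvd_modulus [of _ _ "12 * c"]; simp)+
  then have "chi12 (n mod (12 * c)) = chi12 n"
    "unity_root c (b * (n mod (12 * c))\<^sup>2) = unity_root c (b * n\<^sup>2)"
    by (auto intro!: chi12.cong unity_root_cong cong_mult cong_pow)
  then show ?thesis by (simp add: chi12_quad_def)
qed

theorem chi12_quad_fourier:
  assumes c: "c > 0" "coprime c 12" and inverse: "[576 * b * b' = - 1] (mod c)"
  shows "(\<Sum>r\<in>{0..<12 * c}. chi12_quad c b r * unity_root (12 * c) (m * r)) =
    of_int (chi12 c) * quad_gauss_sum (144 * b) c * sqrt 12 * chi12_quad c b' m"
proof -
  define f where "f r = chi12_quad c b r * unity_root (12 * c) (m * r)" for r
  have "unity_root (12 * c) (m * (r mod (12 * c))) = unity_root (12 * c) (m * r)" for r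
    by (intro unity_root_cong cong_mult) auto
  then have periodic: "f (r mod (12 * c)) = f r" for r
    by (simp add: f_def chi12_quad_mod)
  have factor: "f (12 * x + c * y) = unity_root c (144 * b * x\<^sup>2 + m * x) *
      (of_int (chi12 c) * (of_int (chi12 y) * unity_root 12 (m * y)))" for x y
  proof -
    have "chi12 (12 * x + c * y) = chi12 c * chi12 y"
      unfolding chi12.mult [symmetric] by (rule chi12.cong) (simp add: cong_def)
    moreover have "unity_root c (b * (12 * x + c * y)\<^sup>2) = unity_root c (144 * b * x\<^sup>2)"
    proof (rule unity_root_cong)
      have "b * (12 * x + c * y)\<^sup>2 - 144 * b * x\<^sup>2 = c * (b * y * (24 * x + c * y))"
        by (simp add: power2_eq_square algebra_simps)
      then show "[b * (12 * x + c * y)\<^sup>2 = 144 * b * x\<^sup>2] (mod c)"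
        by (simp add: cong_iff_dvd_diff)
    qed
    moreover have "unity_root (12 * c) (m * (12 * x + c * y)) =
        unity_root c (m * x) * unity_root 12 (m * y)"
      using unity_root_mult_cancel [of 12 c "m * x"] unity_root_mult_cancel [of c 12 "m * y"] c
      by (simp add: unity_root_add ring_distribs mult_ac)
    ultimately show ?thesis
      unfolding f_def chi12_quad_def by (simp add: unity_root_add mult_ac)
  qed
  have "(\<Sum>r\<in>{0..<12 * c}. f r) = (\<Sum>x\<in>{0..<c}. \<Sum>y\<in>{0..<12}. f (12 * x + c * y))"
    using c by (intro sum_residues_mult_coprime periodic) (simp_all add: coprime_commute)
  also have "\<dots> = (\<Sum>x\<in>{0..<c}. unity_root c (144 * b * x\<^sup>2 + m * x)) *
      (of_int (chi12 c) * character_sum chi12 12 m)"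
    unfolding factor character_sum_def
    by (simp only: sum_distrib_left [of "of_int (chi12 c)"] sum_product)
  also have "\<dots> = of_int (chi12 c) * quad_gauss_sum (144 * b) c * sqrt 12 * chi12_quad c b' m"
    using quad_gauss_complete_square [of c "144 * b" b' m] c inverse
    by (simp add: chi12_fourier chi12_quad_def mult_ac)
  finally show ?thesis by (simp add: f_def)
qed

locale odd_prime =
  fixes p :: int
  assumes prime: "prime p" and gt_2: "p > 2"
begin

lemma pos: "p > 0"
  using gt_2 by simp

lemma not_dvd_2: "\<not> p dvd 2"
  using gt_2 by (auto dest: zdvd_imp_le)

lemma coprime_iff: "coprime n p \<longleftrightarrow> \<not> p dvd n"
  using prime by (metis coprime_commute coprime_absorb_left not_prime_unit prime_imp_coprime)

lemma dvd_mult_iff: "p dvd m * n \<longleftrightarrow> p dvd m \<or> p dvd n"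
  using prime by (rule prime_dvd_mult_iff)

lemma dvd_residue_iff: "x \<in> {0..<p} \<Longrightarrow> p dvd x \<longleftrightarrow> x = 0"
  by (auto dest: zdvd_imp_le)

lemma quad_gauss_sum_prime_square:
  assumes a: "\<not> p dvd a"
  shows "quad_gauss_sum a (p\<^sup>2) = of_int p"
proof -
  have summand: "unity_root (p\<^sup>2) (a * (u + p * v)\<^sup>2) =
      unity_root (p\<^sup>2) (a * u\<^sup>2) * unity_root p (2 * a * u * v)" for u v
  proof -
    have "a * (u + p * v)\<^sup>2 - (a * u\<^sup>2 + p * (2 * a * u * v)) = p\<^sup>2 * (a * v\<^sup>2)"
      by (simp add: power2_eq_square algebra_simps)
    then have "[a * (u + p * v)\<^sup>2 = a * u\<^sup>2 + p * (2 * a * u * v)] (mod p\<^sup>2)"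
      by (simp add: cong_iff_dvd_diff)
    then have "unity_root (p\<^sup>2) (a * (u + p * v)\<^sup>2) =
        unity_root (p\<^sup>2) (a * u\<^sup>2) * unity_root (p * p) (p * (2 * a * u * v))"
      by (metis unity_root_cong unity_root_add power2_eq_square)
    then show ?thesis using pos unity_root_mult_cancel by simp
  qed
  have "quad_gauss_sum a (p\<^sup>2) =
      (\<Sum>u\<in>{0..<p}. \<Sum>v\<in>{0..<p}. unity_root (p\<^sup>2) (a * (u + p * v)\<^sup>2))"
    unfolding quad_gauss_sum_def using sum_residues_mult [OF pos pos]
    by (simp add: power2_eq_square)
  also have "\<dots> = (\<Sum>u\<in>{0..<p}. unity_root (p\<^sup>2) (a * u\<^sup>2) *
      (\<Sum>v\<in>{0..<p}. unity_root p (2 * a * u * v)))"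
    unfolding summand by (simp only: sum_distrib_left)
  also have "\<dots> = (\<Sum>u\<in>{0..<p}. if u = 0 then of_int p else 0)"
  proof (intro sum.cong refl)
    fix u assume "u \<in> {0..<p}"
    then have "p dvd 2 * a * u \<longleftrightarrow> u = 0"
      using a not_dvd_2 by (simp add: dvd_mult_iff dvd_residue_iff)
    then show "unity_root (p\<^sup>2) (a * u\<^sup>2) * (\<Sum>v\<in>{0..<p}. unity_root p (2 * a * u * v)) =
        (if u = 0 then of_int p else 0)"
      by (simp add: sum_unity_root [OF pos])
  qed
  also have "\<dots> = of_int p" using pos by simp
  finally show ?thesis .
qed

lemma Legendre_eq_0_iff: "Legendre a p = 0 \<longleftrightarrow> p dvd a"
  by (simp add: Legendre_def cong_0_iff)

lemma Legendre_mult: "Legendre (a * b) p = Legendre a p * Legendre b p"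
proof -
  define q where "q = nat p"
  have q: "prime q" "2 < q" "int q = p" using prime gt_2 by (auto simp: q_def)
  have euler: "[Legendre n p = n ^ ((q - 1) div 2)] (mod p)" for n
    using euler_criterion [OF q(1,2)] q by simp
  have "[Legendre (a * b) p = Legendre a p * Legendre b p] (mod p)"
    using euler [of "a * b"] cong_mult [OF euler [of a] euler [of b]]
    by (metis cong_sym cong_trans power_mult_distrib)
  then have dvd: "p dvd Legendre (a * b) p - Legendre a p * Legendre b p"
    by (simp add: cong_iff_dvd_diff)
  have "\<bar>Legendre (a * b) p - Legendre a p * Legendre b p\<bar> \<le> 2"
    by (auto simp: Legendre_def)
  then have "\<not> \<bar>p\<bar> \<le> \<bar>Legendre (a * b) p - Legendre a p * Legendre b p\<bar>" using gt_2 by linarith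
  then have "Legendre (a * b) p - Legendre a p * Legendre b p = 0"
    using dvd dvd_imp_le_int by blast
  then show ?thesis by simp
qed

lemma Legendre_square: "\<not> p dvd a \<Longrightarrow> Legendre (a\<^sup>2) p = 1"
  by (auto simp: Legendre_def cong_0_iff QuadRes_def power2_eq_square dvd_mult_iff
      intro!: exI [of _ a])

lemma Legendre_mult_self: "\<not> p dvd a \<Longrightarrow> Legendre a p * Legendre a p = 1"
  using Legendre_square [of a] by (simp add: power2_eq_square Legendre_mult)

sublocale Legendre: real_character "\<lambda>n. Legendre n p" p
proof
  show "Legendre (n mod p) p = Legendre n p" for n
    by (simp add: Legendre_def QuadRes_def cong_def)
qed (use pos in \<open>simp_all add: Legendre_mult Legendre_mult_self coprime_iff\<close>)

lemma square_roots_mod: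
  assumes s: "s \<in> {1..<p}"
  shows "{x\<in>{0..<p}. [x\<^sup>2 = s\<^sup>2] (mod p)} = {s, p - s}"
proof (intro equalityI subsetI)
  fix x assume "x \<in> {x\<in>{0..<p}. [x\<^sup>2 = s\<^sup>2] (mod p)}"
  then have x: "x \<in> {0..<p}" and "p dvd x\<^sup>2 - s\<^sup>2"
    by (auto simp: cong_iff_dvd_diff)
  then have "p dvd x - s \<or> p dvd x + s"
    by (auto simp: power2_eq_square square_diff_square_factored dvd_mult_iff)
  then have "[x = s] (mod p) \<or> [x = p - s] (mod p)"
    by (auto simp: cong_iff_dvd_diff) (metis diff_diff_eq2 dvd_diff dvd_refl)
  then show "x \<in> {s, p - s}"
    using x s cong_less_imp_eq_int [of x p s] cong_less_imp_eq_int [of x p "p - s"] by auto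
next
  fix x assume x: "x \<in> {s, p - s}"
  have "(p - s)\<^sup>2 - s\<^sup>2 = p * (p - 2 * s)" by (simp add: power2_eq_square algebra_simps)
  then have "[(p - s)\<^sup>2 = s\<^sup>2] (mod p)" by (simp add: cong_iff_dvd_diff)
  then show "x \<in> {x\<in>{0..<p}. [x\<^sup>2 = s\<^sup>2] (mod p)}" using x s by auto
qed

lemma card_square_roots:
  "int (card {x\<in>{0..<p}. [x\<^sup>2 = u] (mod p)}) = 1 + Legendre u p"
proof -
  consider (zero) "p dvd u" | (non_residue) "\<not> p dvd u" "\<not> QuadRes p u"
    | (residue) y where "\<not> p dvd u" "[y\<^sup>2 = u] (mod p)"
    by (auto simp: QuadRes_def)
  then show ?thesis
  proof cases
    case zero
    then have "[x\<^sup>2 = u] (mod p) \<longleftrightarrow> p dvd x" for x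
      by (metis cong_dvd_iff cong_0_iff cong_sym cong_trans dvd_mult_iff power2_eq_square)
    then have "{x\<in>{0..<p}. [x\<^sup>2 = u] (mod p)} = {0}" using pos by (auto simp: dvd_residue_iff)
    then show ?thesis using zero by (simp add: Legendre_eq_0_iff)
  next
    case non_residue
    then have "{x\<in>{0..<p}. [x\<^sup>2 = u] (mod p)} = {}" by (auto simp: QuadRes_def)
    then show ?thesis
      using non_residue by (simp only: card.empty) (auto simp: Legendre_def cong_0_iff)
  next
    case residue
    define s where "s = y mod p"
    have "[s\<^sup>2 = y\<^sup>2] (mod p)" unfolding s_def by (intro cong_pow) simp
    then have su: "[s\<^sup>2 = u] (mod p)" using residue(2) by (rule cong_trans)
    have "\<not> p dvd s"
      using residue(1) su by (metis cong_dvd_iff dvd_mult power2_eq_square)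
    then have s: "s \<in> {1..<p}"
      using pos by (auto simp: s_def)
        (metis dvd_0_right order_le_less pos_mod_sign zless_imp_add1_zle add_0)
    have "{x\<in>{0..<p}. [x\<^sup>2 = u] (mod p)} = {x\<in>{0..<p}. [x\<^sup>2 = s\<^sup>2] (mod p)}"
      using su by (auto intro: cong_trans cong_sym)
    also have "\<dots> = {s, p - s}" using s by (rule square_roots_mod)
    finally have roots: "{x\<in>{0..<p}. [x\<^sup>2 = u] (mod p)} = {s, p - s}" .
    have "s \<noteq> p - s"
    proof
      assume "s = p - s"
      then have "p dvd 2 * s" by (metis diff_add_cancel dvd_refl mult_2)
      then show False using \<open>\<not> p dvd s\<close> not_dvd_2 by (simp add: dvd_mult_iff)
    qed
    moreover have "Legendre u p = 1"
      using residue by (auto simp: Legendre_def cong_0_iff QuadRes_def)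
    ultimately show ?thesis unfolding roots by simp
  qed
qed

lemma sum_squares_Legendre:
  fixes f :: "int \<Rightarrow> complex"
  assumes periodic: "\<And>x. f (x mod p) = f x"
  shows "(\<Sum>x\<in>{0..<p}. f (x\<^sup>2)) = (\<Sum>u\<in>{0..<p}. (1 + of_int (Legendre u p)) * f u)"
proof -
  have "(\<Sum>x\<in>{0..<p}. f (x\<^sup>2)) = (\<Sum>x\<in>{0..<p}. f (x\<^sup>2 mod p))" by (simp add: periodic)
  also have "\<dots> = (\<Sum>u\<in>{0..<p}. \<Sum>x\<in>{x\<in>{0..<p}. x\<^sup>2 mod p = u}. f (x\<^sup>2 mod p))"
    using pos by (intro sum.group [symmetric]) auto
  also have "\<dots> = (\<Sum>u\<in>{0..<p}. (1 + of_int (Legendre u p)) * f u)"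
  proof (intro sum.cong refl)
    fix u assume "u \<in> {0..<p}"
    then have roots: "{x\<in>{0..<p}. x\<^sup>2 mod p = u} = {x\<in>{0..<p}. [x\<^sup>2 = u] (mod p)}"
      by (auto simp: cong_def)
    have "(\<Sum>x\<in>{x\<in>{0..<p}. x\<^sup>2 mod p = u}. f (x\<^sup>2 mod p)) =
        of_int (int (card {x\<in>{0..<p}. x\<^sup>2 mod p = u})) * f u"
      by simp
    then show "(\<Sum>x\<in>{x\<in>{0..<p}. x\<^sup>2 mod p = u}. f (x\<^sup>2 mod p)) =
        (1 + of_int (Legendre u p)) * f u"
      by (simp only: roots card_square_roots of_int_add of_int_1)
  qed
  finally show ?thesis .
qed

definition gauss_sum :: complex where
  "gauss_sum = character_sum (\<lambda>u. Legendre u p) p 1"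

lemma Legendre_fourier: "character_sum (\<lambda>u. Legendre u p) p a = of_int (Legendre a p) * gauss_sum"
proof (cases "p dvd a")
  case True
  have "(\<Sum>u\<in>{0..<p}. complex_of_int (Legendre u p)) = 0"
    using sum_squares_Legendre [of "\<lambda>_. 1"] by (simp add: sum.distrib)
  moreover have "unity_root p (a * u) = 1" for u
    using True pos by (simp add: unity_root_eq_1_iff)
  ultimately show ?thesis
    using True by (simp add: character_sum_def Legendre_eq_0_iff)
next
  case False
  then show ?thesis
    using Legendre.character_sum_mult [of a 1] by (simp add: coprime_iff gauss_sum_def)
qed

lemma quad_gauss_sum_prime:
  assumes "\<not> p dvd a" shows "quad_gauss_sum a p = of_int (Legendre a p) * gauss_sum"
proof -
  have "unity_root p (a * (x mod p)) = unity_root p (a * x)" for x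
    by (intro unity_root_cong cong_mult) auto
  then have "quad_gauss_sum a p = (\<Sum>u\<in>{0..<p}. (1 + of_int (Legendre u p)) * unity_root p (a * u))"
    unfolding quad_gauss_sum_def by (rule sum_squares_Legendre)
  also have "\<dots> = (\<Sum>u\<in>{0..<p}. unity_root p (a * u)) + character_sum (\<lambda>u. Legendre u p) p a"
    by (simp add: character_sum_def ring_distribs sum.distrib)
  finally show ?thesis
    using assms by (simp add: sum_unity_root [OF pos] Legendre_fourier)
qed

lemma gauss_sum_squared: "gauss_sum * gauss_sum = of_int (Legendre (-1) p * p)"
proof -
  have "gauss_sum * gauss_sum =
      (\<Sum>x\<in>{0..<p}. unity_root p x * (of_int (Legendre x p) * gauss_sum))"
    by (subst (1) gauss_sum_def) (simp add: character_sum_def sum_distrib_left mult_ac)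
  also have "\<dots> = (\<Sum>x\<in>{0..<p}. \<Sum>y\<in>{0..<p}. of_int (Legendre y p) * unity_root p ((1 + y) * x))"
    unfolding Legendre_fourier [symmetric] character_sum_def sum_distrib_left
    by (intro sum.cong refl) (simp add: ring_distribs unity_root_add mult_ac)
  also have "\<dots> = (\<Sum>y\<in>{0..<p}. of_int (Legendre y p) * (\<Sum>x\<in>{0..<p}. unity_root p ((1 + y) * x)))"
    unfolding sum_distrib_left by (rule sum.swap)
  also have "\<dots> = (\<Sum>y\<in>{0..<p}. if y = p - 1 then of_int (Legendre (-1) p * p) else 0)"
  proof (intro sum.cong refl)
    fix y assume y: "y \<in> {0..<p}"
    have "p dvd 1 + y \<longleftrightarrow> y = p - 1" using y by (auto dest: zdvd_imp_le)
    moreover have "Legendre (p - 1) p = Legendre (-1) p"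
      by (rule Legendre.cong) (simp add: cong_iff_dvd_diff)
    ultimately show "of_int (Legendre y p) * (\<Sum>x\<in>{0..<p}. unity_root p ((1 + y) * x)) =
        (if y = p - 1 then of_int (Legendre (-1) p * p) else 0)"
      by (auto simp: sum_unity_root [OF pos])
  qed
  also have "\<dots> = of_int (Legendre (-1) p * p)" using pos by simp
  finally show ?thesis .
qed

lemma not_dvd_minus_1: "\<not> p dvd - 1"
  using gt_2 by auto

lemma gauss_sum_nonzero: "gauss_sum \<noteq> 0"
  using gauss_sum_squared not_dvd_minus_1 pos by (auto simp: Legendre_eq_0_iff)

lemma Legendre_minus_1_gauss_sum: "of_int (Legendre (-1) p) * gauss_sum = of_int p / gauss_sum"
proof -
  have "of_int (Legendre (-1) p) * gauss_sum * gauss_sum =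
      of_int (Legendre (-1) p * Legendre (-1) p) * of_int p"
    by (simp add: mult.assoc gauss_sum_squared)
  then show ?thesis
    using gauss_sum_nonzero Legendre_mult_self [OF not_dvd_minus_1] by (simp add: field_simps)
qed

end

lemma Legendre_mod_3: "Legendre n 3 = (if n mod 3 = 0 then 0 else if n mod 3 = 1 then 1 else - 1)"
proof -
  interpret odd_prime 3 by (rule odd_prime.intro) simp_all
  have "y\<^sup>2 mod 3 \<noteq> 2" for y :: int
  proof -
    have "y mod 3 \<in> {0, 1, 2}" by (simp; presburger)
    then show ?thesis using power_mod [of y 3 2] by auto
  qed
  then have "\<not> QuadRes 3 2" by (simp add: QuadRes_def cong_def)
  then have "Legendre 2 3 = - 1" by (simp add: Legendre_def cong_def)
  moreover have "QuadRes 3 1" by (auto simp: QuadRes_def intro!: exI [of _ 1])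
  then have "Legendre 1 3 = 1" by (simp add: Legendre_def cong_def)
  moreover have "Legendre 0 3 = 0" by (simp add: Legendre_def)
  moreover have "n mod 3 \<in> {0, 1, 2}" by (simp; presburger)
  ultimately show ?thesis
    by (metis Legendre.mod empty_iff insert_iff zero_neq_one)
qed

locale prime_gt_3 =
  fixes p :: int
  assumes prime: "prime p" and gt_3: "p > 3"
begin

sublocale odd_prime p
  by unfold_locales (use prime gt_3 in auto)

lemma not_dvd_3: "\<not> p dvd 3"
  using gt_3 by (auto dest: zdvd_imp_le)

lemma not_dvd_2_3_smooth: "\<not> p dvd 2 ^ m * 3 ^ n"
  using not_dvd_2 not_dvd_3 by (metis dvd_mult_iff prime prime_dvd_power)

lemma coprime_12: "coprime p 12"
  using not_dvd_2_3_smooth [of 2 1] coprime_iff [of 12] by (simp add: coprime_commute)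

lemma mod_12: "p mod 12 \<in> {1, 5, 7, 11}"
proof -
  have "coprime (p mod 12) 12" using coprime_12 by simp
  then show ?thesis by (cases p rule: mod_12_cases) (simp_all add: coprime_12_iff)
qed

lemma Legendre_3_eq_chi12: "Legendre 3 p = chi12 p"
proof -
  have "odd p" using coprime_12 by (simp add: coprime_12_iff)
  then have "even ((p - 1) div 2) \<longleftrightarrow> p mod 4 = 1" by presburger
  then have "even (nat ((p - 1) div 2)) \<longleftrightarrow> p mod 4 = 1"
    using gt_3 even_nat_iff [of "(p - 1) div 2"] by linarith
  moreover have "Legendre 3 p * Legendre p 3 = (-1) ^ nat ((p - 1) div 2)"
    using Quadratic_Reciprocity_int [of 3 p] prime gt_3 by simp
  ultimately have reciprocity: "Legendre 3 p * Legendre p 3 = (if p mod 4 = 1 then 1 else - 1)"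
    by simp
  have "p mod 4 = p mod 12 mod 4" "p mod 3 = p mod 12 mod 3"
    by (simp_all add: mod_mod_cancel)
  with reciprocity mod_12 show ?thesis
    by (auto simp: Legendre_mod_3 chi12_def simp del: mod_mod_cancel)
qed

end

section \<open>The Dedekind eta function\<close>

lemma has_sum_sum:
  fixes f :: "'i \<Rightarrow> 'a \<Rightarrow> 'b::{topological_comm_monoid_add}"
  assumes "finite I" "\<And>i. i \<in> I \<Longrightarrow> (f i has_sum s i) A"
  shows "((\<lambda>x. \<Sum>i\<in>I. f i x) has_sum (\<Sum>i\<in>I. s i)) A"
  using assms by (induction I rule: finite_induct) (auto intro: has_sum_add)

lemma has_sum_residue_class:
  fixes f :: "int \<Rightarrow> 'a::{topological_comm_monoid_add, t2_space}"
  assumes N: "N > 0" and r: "r \<in> {0..<N}" and f: "((\<lambda>k. f (N * k + r)) has_sum S) UNIV"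
  shows "((\<lambda>n. if n mod N = r then f n else 0) has_sum S) UNIV"
proof -
  have inj: "inj (\<lambda>k. N * k + r)" using N by (auto simp: inj_on_def)
  have range: "range (\<lambda>k. N * k + r) = {n. n mod N = r}"
  proof (intro equalityI subsetI)
    fix n assume "n \<in> {n. n mod N = r}"
    then have "n = N * (n div N) + r" by auto
    then show "n \<in> range (\<lambda>k. N * k + r)" by blast
  qed (use r in auto)
  have "(f has_sum S) {n. n mod N = r}"
    using f has_sum_reindex [OF inj, of f S] unfolding range by (simp add: o_def)
  then show ?thesis
    by (rule has_sum_cong_neutral [THEN iffD1, rotated -1]) auto
qed

lemma gaussian_residue_class:
  fixes y :: real
  assumes N: "N > 0" and r: "r \<in> {0..<N}" and y: "y > 0"
  shows "((\<lambda>k. complex_of_real (gaussian (1 / (of_int N * y)) (of_int (N * k + r)))) has_sum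
    of_real (sqrt (y / of_int N)) *
      (\<Sum>\<^sub>\<infinity>m. of_real (gaussian (y / of_int N) (of_int m)) * unity_root N (m * r))) UNIV"
proof -
  define t where "t = of_int N / y"
  define a where "a = real_of_int r / of_int N"
  have t: "t > 0" using N y by (simp add: t_def)
  have a: "a \<in> {0..1}" using r N by (auto simp: a_def field_simps)
  have scale: "gaussian (1 / (of_int N * y)) (of_int (N * k + r)) = gaussian t (a + k)" for k
  proof -
    have "real_of_int (N * k + r) = of_int N * (a + k)" using N by (simp add: a_def field_simps)
    then show ?thesis
      using N y by (simp add: gaussian_def t_def power_mult_distrib power2_eq_square)
  qed
  have "(\<lambda>k::int. complex_of_real (gaussian t (a + k))) summable_on UNIV"
    by (intro summable_on_of_real summable_gaussian_shift t a)
  then have "((\<lambda>k::int. complex_of_real (gaussian t (a + k))) has_sum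
      (\<Sum>\<^sub>\<infinity>m::int. of_real (gaussian (1 / t) m) * cis (2 * pi * m * a)) / sqrt t) UNIV"
    using theta_inversion [OF t a] by (metis has_sum_infsum)
  moreover have "cis (2 * pi * m * a) = unity_root N (m * r)" for m :: int
    by (simp add: unity_root_def a_def mult_ac)
  moreover have "1 / t = y / of_int N" "S / of_real (sqrt t) = of_real (sqrt (y / of_int N)) * S"
    for S :: complex
    by (simp_all add: t_def real_sqrt_divide)
  ultimately show ?thesis
    unfolding scale by (simp only:)
qed

theorem poisson_periodic_gaussian:
  fixes \<phi> :: "int \<Rightarrow> complex" and y :: real
  assumes N: "N > 0" and periodic: "\<And>n. \<phi> (n mod N) = \<phi> n" and y: "y > 0"
  shows "(\<Sum>\<^sub>\<infinity>n. \<phi> n * of_real (gaussian (1 / (of_int N * y)) (of_int n))) =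
    of_real (sqrt (y / of_int N)) *
      (\<Sum>\<^sub>\<infinity>m. (\<Sum>r\<in>{0..<N}. \<phi> r * unity_root N (m * r)) *
        of_real (gaussian (y / of_int N) (of_int m)))"
proof -
  define g where "g n = complex_of_real (gaussian (1 / (of_int N * y)) (of_int n))" for n
  define h where "h m = complex_of_real (gaussian (y / of_int N) (of_int m))" for m
  define S where "S r = (\<Sum>\<^sub>\<infinity>m. h m * unity_root N (m * r))" for r
  have "(\<lambda>m. norm (h m)) summable_on UNIV"
    using summable_gaussian_shift [of "y / of_int N" 0] N y by (simp add: h_def gaussian_def)
  then have "(\<lambda>m. h m * unity_root N (m * r)) summable_on UNIV" for r
    by (intro abs_summable_summable [where f = "\<lambda>m. h m * unity_root N (m * r)"])
       (simp add: norm_mult)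
  then have S: "((\<lambda>m. h m * unity_root N (m * r)) has_sum S r) UNIV" for r
    unfolding S_def by (rule has_sum_infsum)
  have "((\<lambda>n. \<Sum>r\<in>{0..<N}. \<phi> r * (if n mod N = r then g n else 0)) has_sum
      (\<Sum>r\<in>{0..<N}. \<phi> r * (of_real (sqrt (y / of_int N)) * S r))) UNIV"
    unfolding g_def S_def h_def
    by (intro has_sum_sum has_sum_cmult_right has_sum_residue_class [OF N]
        gaussian_residue_class N y) auto
  moreover have "(\<Sum>r\<in>{0..<N}. \<phi> r * (if n mod N = r then g n else 0)) = \<phi> n * g n" for n
  proof -
    have "(\<Sum>r\<in>{0..<N}. \<phi> r * (if n mod N = r then g n else 0)) =
        (\<Sum>r\<in>{0..<N}. if r = n mod N then \<phi> r * g n else 0)"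
      by (intro sum.cong) auto
    also have "\<dots> = \<phi> n * g n" using N by (simp add: periodic)
    finally show ?thesis .
  qed
  ultimately have lhs: "((\<lambda>n. \<phi> n * g n) has_sum
      (\<Sum>r\<in>{0..<N}. \<phi> r * (of_real (sqrt (y / of_int N)) * S r))) UNIV"
    by (simp only:)
  have "((\<lambda>m. \<Sum>r\<in>{0..<N}. \<phi> r * (h m * unity_root N (m * r))) has_sum
      (\<Sum>r\<in>{0..<N}. \<phi> r * S r)) UNIV"
    by (intro has_sum_sum has_sum_cmult_right S) auto
  then have rhs: "((\<lambda>m. (\<Sum>r\<in>{0..<N}. \<phi> r * unity_root N (m * r)) * h m) has_sum
      (\<Sum>r\<in>{0..<N}. \<phi> r * S r)) UNIV"
    by (simp add: sum_distrib_left mult_ac)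
  show ?thesis
    using infsumI [OF lhs] infsumI [OF rhs] unfolding g_def h_def
    by (simp add: sum_distrib_left mult_ac)
qed

definition qexp :: "complex \<Rightarrow> complex" where
  "qexp w = exp (2 * of_real pi * \<i> * w)"

lemma qexp_nonzero [simp]: "qexp w \<noteq> 0"
  by (simp add: qexp_def)

lemma qexp_add: "qexp (v + w) = qexp v * qexp w"
  by (simp add: qexp_def ring_distribs exp_add)

lemma qexp_minus: "qexp (- w) = inverse (qexp w)"
  by (simp add: qexp_def exp_minus)

lemma qexp_of_nat_mult: "qexp (of_nat n * w) = qexp w ^ n"
  using exp_of_nat_mult [of n "2 * of_real pi * \<i> * w"] by (simp add: qexp_def mult_ac)

lemma qexp_of_real: "qexp (of_real x) = cis (2 * pi * x)"
  by (simp add: qexp_def cis_conv_exp mult_ac)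

lemma qexp_of_int_divide: "qexp (of_int n / of_int c) = unity_root c n"
  using qexp_of_real [of "of_int n / of_int c"] by (simp add: unity_root_def)

lemma qexp_of_int [simp]: "qexp (of_int k) = 1"
  using qexp_of_int_divide [of k 1] unity_root_self [of 1 k] by simp

lemma qexp_imaginary: "qexp (\<i> * of_real x) = of_real (exp (- 2 * pi * x))"
proof -
  have "2 * of_real pi * \<i> * (\<i> * of_real x) = complex_of_real (- 2 * pi * x)"
    by (simp add: complex_eq_iff)
  then show ?thesis unfolding qexp_def by (metis exp_of_real)
qed

lemma norm_qexp: "norm (qexp w) = exp (- 2 * pi * Im w)"
  by (simp add: qexp_def norm_exp_eq_Re)

lemma norm_qexp_less_1: "Im w > 0 \<Longrightarrow> norm (qexp w) < 1"
  by (simp add: norm_qexp)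

lemma qexp_surj:
  assumes "q \<noteq> 0" "norm q < 1"
  obtains w where "Im w > 0" "qexp w = q"
proof -
  define w where "w = Ln q / (2 * of_real pi * \<i>)"
  have "qexp w = q" using assms by (simp add: qexp_def w_def)
  moreover from this have "exp (- 2 * pi * Im w) < 1" using assms norm_qexp [of w] by simp
  then have "Im w > 0" by (simp add: zero_less_mult_iff)
  ultimately show ?thesis using that by blast
qed

lemma qexp_holomorphic [holomorphic_intros]:
  "f holomorphic_on S \<Longrightarrow> (\<lambda>z. qexp (f z)) holomorphic_on S"
  unfolding qexp_def by (intro holomorphic_intros)

definition eta :: "complex \<Rightarrow> complex" where
  "eta w = qexp (w / 24) * euler (qexp w)"

lemma eta_nonzero: "Im w > 0 \<Longrightarrow> eta w \<noteq> 0"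
  by (simp add: eta_def euler_nonzero norm_qexp_less_1)

lemma chi12_6k_plus_1: "chi12 (6 * k + 1) = parity_sign k"
proof -
  have "(6 * k + 1) mod 12 = (if even k then 1 else 7)" by presburger
  then show ?thesis by (simp add: chi12_def parity_sign_def)
qed

lemma chi12_support:
  assumes "chi12 n \<noteq> 0"
  shows "n \<in> range (\<lambda>k. 6 * k + 1) \<union> range (\<lambda>k. - (6 * k + 1))"
proof -
  have "n mod 12 = 1 \<or> n mod 12 = 5 \<or> n mod 12 = 7 \<or> n mod 12 = 11"
    using assms by (auto simp: chi12_def split: if_splits)
  then have "n mod 6 = 1 \<or> n mod 6 = 5" by presburger
  then have "n = 6 * (n div 6) + 1 \<or> n = - (6 * (- (n div 6) - 1) + 1)"
    by presburger
  then show ?thesis by blast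
qed

lemma square_6k_plus_1: "(6 * k + 1)\<^sup>2 = 24 * int (pent k) + 1"
  using two_pent [of k] by (simp add: power2_eq_square algebra_simps)

lemma eta_series:
  assumes w: "Im w > 0"
  shows "((\<lambda>n. of_int (chi12 n) * qexp (w * (of_int n)\<^sup>2 / 24)) has_sum 2 * eta w) UNIV"
proof -
  define f where "f n = of_int (chi12 n) * qexp (w * (of_int n)\<^sup>2 / 24)" for n
  have "f (6 * k + 1) = qexp (w / 24) * (parity_sign k * qexp w ^ pent k)" for k
  proof -
    have "(complex_of_int (6 * k + 1))\<^sup>2 = 24 * of_nat (pent k) + 1"
      using arg_cong [OF square_6k_plus_1, of complex_of_int k] by simp
    then have "w * (of_int (6 * k + 1))\<^sup>2 / 24 = w / 24 + of_nat (pent k) * w"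
      by (simp add: field_simps)
    then show ?thesis
      unfolding f_def chi12_6k_plus_1
      by (simp only: qexp_add qexp_of_nat_mult of_int_parity_sign mult.left_commute)
  qed
  then have half: "((\<lambda>k. f (6 * k + 1)) has_sum eta w) UNIV"
    by (simp only:) (unfold eta_def, intro has_sum_cmult_right euler_pentagonal norm_qexp_less_1 w)
  let ?A = "range (\<lambda>k::int. 6 * k + 1)" and ?B = "range (\<lambda>k::int. - (6 * k + 1))"
  have "(f has_sum eta w) ?A"
    using half by (subst has_sum_reindex) (auto simp: o_def inj_on_def)
  moreover have "f (- n) = f n" for n by (simp add: f_def)
  then have "(f has_sum eta w) ?B"
    using half by (subst has_sum_reindex) (auto simp: o_def inj_on_def simp del: minus_add_distrib)
  moreover have "6 * k + 1 \<noteq> - (6 * k' + 1)" for k k' :: int by presburger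
  then have "?A \<inter> ?B = {}" by blast
  ultimately have "(f has_sum (eta w + eta w)) (?A \<union> ?B)"
    by (rule has_sum_Un_disjoint)
  then have "(f has_sum (eta w + eta w)) UNIV"
    by (rule has_sum_cong_neutral [THEN iffD1, rotated -1])
       (use chi12_support in \<open>auto simp: f_def\<close>)
  then show ?thesis by (simp add: f_def [abs_def])
qed

lemma eta_rational_series:
  assumes c: "c > 0" and y: "y > 0"
  shows "2 * eta ((24 * of_int b + \<i> * of_real y) / of_int c) =
    (\<Sum>\<^sub>\<infinity>n. chi12_quad c b n * of_real (gaussian (y / of_int (12 * c)) (of_int n)))"
proof -
  define w where "w = (24 * of_int b + \<i> * of_real y) / of_int c"
  have w: "Im w > 0" using c y by (simp add: w_def)
  have "qexp (w * (of_int n)\<^sup>2 / 24) =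
      unity_root c (b * n\<^sup>2) * of_real (gaussian (y / of_int (12 * c)) (of_int n))" for n
  proof -
    have "w * (of_int n)\<^sup>2 / 24 =
        of_int (b * n\<^sup>2) / of_int c + \<i> * of_real (y * (of_int n)\<^sup>2 / (24 * of_int c))"
      using c by (simp add: w_def field_simps)
    then show ?thesis
      using c by (simp only: qexp_add qexp_of_int_divide qexp_imaginary)
        (simp add: gaussian_def field_simps)
  qed
  then show ?thesis
    using infsumI [OF eta_series [OF w]] by (simp add: w_def chi12_quad_def mult_ac)
qed

definition eta_factor :: "int \<Rightarrow> int \<Rightarrow> complex" where
  "eta_factor c b = of_int (chi12 c) * quad_gauss_sum (144 * b) c / sqrt (of_int c)"

theorem eta_transform:
  assumes c: "c > 0" "coprime c 12" and inverse: "[576 * b * b' = - 1] (mod c)" and y: "y > 0"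
  shows "eta ((24 * of_int b + \<i> * of_real (1 / y)) / of_int c) =
    eta_factor c b * sqrt y * eta ((24 * of_int b' + \<i> * of_real y) / of_int c)"
proof -
  define G where "G = of_int (chi12 c) * quad_gauss_sum (144 * b) c * complex_of_real (sqrt 12)"
  let ?g = "\<lambda>m. complex_of_real (gaussian (y / of_int (12 * c)) (of_int m))"
  have "2 * eta ((24 * of_int b + \<i> * of_real (1 / y)) / of_int c) =
      (\<Sum>\<^sub>\<infinity>n. chi12_quad c b n * of_real (gaussian (1 / (of_int (12 * c) * y)) (of_int n)))"
    using y by (subst eta_rational_series [OF c(1)]) (auto simp: mult_ac)
  also have "\<dots> = of_real (sqrt (y / of_int (12 * c))) *
      (\<Sum>\<^sub>\<infinity>m. (\<Sum>r\<in>{0..<12 * c}. chi12_quad c b r * unity_root (12 * c) (m * r)) * ?g m)"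
    using c y by (intro poisson_periodic_gaussian chi12_quad_mod) auto
  also have "(\<lambda>m. (\<Sum>r\<in>{0..<12 * c}. chi12_quad c b r * unity_root (12 * c) (m * r)) * ?g m) =
      (\<lambda>m. G * (chi12_quad c b' m * ?g m))"
    unfolding chi12_quad_fourier [OF c inverse] G_def by (simp add: mult_ac)
  also have "infsum \<dots> UNIV = G * (2 * eta ((24 * of_int b' + \<i> * of_real y) / of_int c))"
    unfolding eta_rational_series [OF c(1) y] by (rule infsum_cmult_right')
  also have "of_real (sqrt (y / of_int (12 * c))) * \<dots> =
      2 * (eta_factor c b * sqrt y * eta ((24 * of_int b' + \<i> * of_real y) / of_int c))"
    using c by (simp add: G_def eta_factor_def real_sqrt_divide real_sqrt_mult field_simps)
  finally show ?thesis by simp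
qed

lemma eta_factor_1_0: "eta_factor 1 0 = 1"
  by (simp add: eta_factor_def quad_gauss_sum_def chi12_def)

corollary eta_transform_imaginary:
  "y > 0 \<Longrightarrow> eta (\<i> * of_real (1 / y)) = sqrt y * eta (\<i> * of_real y)"
  using eta_transform [of 1 0 0 y] by (simp add: eta_factor_1_0)

definition eta_quot :: "complex \<Rightarrow> complex" where
  "eta_quot w = eta (2 * w) ^ 3 / eta w ^ 2"

definition eta_quot_dual :: "complex \<Rightarrow> complex" where
  "eta_quot_dual w = eta w ^ 3 / eta (2 * w) ^ 2"

lemma eta_quot_transform:
  assumes c: "c > 0" "coprime c 12" and inverse: "[1152 * b * b' = - 1] (mod c)" and y: "y > 0"
  shows "eta_quot ((24 * of_int b + \<i> * of_real (1 / (2 * y))) / of_int c) =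
    eta_factor c (2 * b) ^ 3 / eta_factor c b ^ 2 * (of_real (sqrt y) / 2) *
      eta_quot_dual ((24 * of_int b' + \<i> * of_real y) / of_int c)"
proof -
  define w where "w = (24 * of_int b + \<i> * of_real (1 / (2 * y))) / of_int c"
  define z where "z = (24 * of_int b' + \<i> * of_real y) / of_int c"
  have inverses: "[576 * (2 * b) * b' = - 1] (mod c)" "[576 * b * (2 * b') = - 1] (mod c)"
    using inverse by (simp_all add: mult_ac)
  have "2 * w = (24 * of_int (2 * b) + \<i> * of_real (1 / y)) / of_int c"
    using c y by (simp add: w_def field_simps)
  then have two_w: "eta (2 * w) = eta_factor c (2 * b) * sqrt y * eta z"
    using eta_transform [OF c inverses(1) y] by (simp add: z_def)
  have "eta w = eta_factor c b * sqrt (2 * y) *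
      eta ((24 * of_int (2 * b') + \<i> * of_real (2 * y)) / of_int c)"
    using eta_transform [OF c inverses(2), of "2 * y"] y by (simp add: w_def)
  also have "(24 * of_int (2 * b') + \<i> * of_real (2 * y)) / of_int c = 2 * z"
    using c by (simp add: z_def field_simps)
  finally have one_w: "eta w = eta_factor c b * sqrt (2 * y) * eta (2 * z)" .
  have powers: "complex_of_real (sqrt y) ^ 3 = of_real y * of_real (sqrt y)"
    "complex_of_real (sqrt (2 * y)) ^ 2 = 2 * of_real y"
    using y by (simp_all add: power3_eq_cube flip: of_real_mult of_real_power) simp
  show ?thesis
    unfolding w_def [symmetric] z_def [symmetric] eta_quot_def eta_quot_dual_def
    unfolding two_w one_w power_mult_distrib powers using y by (simp add: field_simps)
qed

corollary eta_quot_transform_imaginary: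
  assumes "y > 0"
  shows "eta_quot (\<i> * of_real (1 / (2 * y))) =
    of_real (sqrt y) / 2 * eta_quot_dual (\<i> * of_real y)"
  using eta_quot_transform [of 1 0 0 y] assms by (simp add: eta_factor_1_0)

lemma eta_quot_eq: "eta_quot w = qexp (w / 6) * alpha_prod (qexp w)"
proof -
  define x where "x = qexp (w / 24)"
  have "qexp (w / 6) = x ^ 4" "qexp (2 * w / 24) = x ^ 2" "qexp (2 * w) = (qexp w)\<^sup>2" "x \<noteq> 0"
    using qexp_of_nat_mult [of 4 "w / 24"] qexp_of_nat_mult [of 2 "w / 24"]
      qexp_of_nat_mult [of 2 w]
    by (simp_all add: x_def)
  moreover have "(x\<^sup>2 * a) ^ 3 / (x * b)\<^sup>2 = x ^ 4 * (a ^ 3 / b\<^sup>2)" if "x \<noteq> 0" for a b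
    using that by (cases "b = 0") (simp_all add: field_simps eval_nat_numeral)
  ultimately show ?thesis
    unfolding eta_quot_def alpha_prod_def eta_def x_def [symmetric] by simp
qed

lemma eta_quot_dual_eq: "eta_quot_dual w = qexp (- w / 24) * dual_prod (qexp w)"
proof -
  define x where "x = qexp (w / 24)"
  have "qexp (2 * w / 24) = x ^ 2" "qexp (2 * w) = (qexp w)\<^sup>2" "qexp (- w / 24) = inverse x" "x \<noteq> 0"
    using qexp_of_nat_mult [of 2 "w / 24"] qexp_of_nat_mult [of 2 w] qexp_minus [of "w / 24"]
    by (simp_all add: x_def)
  moreover have "(x * b) ^ 3 / (x\<^sup>2 * a)\<^sup>2 = inverse x * (b ^ 3 / a\<^sup>2)" if "x \<noteq> 0" for a b
    using that by (cases "a = 0") (simp_all add: field_simps eval_nat_numeral)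
  ultimately show ?thesis
    unfolding eta_quot_dual_def dual_prod_def eta_def x_def [symmetric] by simp
qed

section \<open>The Hecke operator\<close>

definition unit_residues :: "int \<Rightarrow> int set" where
  "unit_residues c = {b\<in>{0..<c}. coprime b c}"

lemma finite_unit_residues [simp]: "finite (unit_residues c)"
  by (rule finite_subset [of _ "{0..<c}"]) (auto simp: unit_residues_def)

lemma sum_unit_residues_negative_inverse:
  fixes f g :: "int \<Rightarrow> 'a::comm_monoid_add"
  assumes c: "c > 0" and k: "coprime k c"
    and summand: "\<And>b b'. b \<in> unit_residues c \<Longrightarrow> [k * b * b' = - 1] (mod c) \<Longrightarrow> f b = g b'"
  shows "(\<Sum>b\<in>unit_residues c. f b) = (\<Sum>b\<in>unit_residues c. g b)"
proof -
  have "\<exists>b'\<in>unit_residues c. [k * b * b' = - 1] (mod c)" if "b \<in> unit_residues c" for b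
  proof -
    have "coprime (k * b) c" using that k by (simp add: unit_residues_def)
    then obtain x where x: "[k * b * x = 1] (mod c)" using cong_solve_coprime_int by blast
    define b' where "b' = (- x) mod c"
    have "[k * b * b' = k * b * (- x)] (mod c)" by (rule cong_scalar_left) (simp add: b'_def)
    also have "k * b * (- x) = - (k * b * x)" by simp
    also have "[- (k * b * x) = - 1] (mod c)" using x by (simp add: cong_minus_minus_iff)
    finally have inverse: "[k * b * b' = - 1] (mod c)" .
    then have "coprime (k * b * b') c"
      by (metis cong_imp_coprime cong_sym coprime_1_left coprime_minus_left_iff)
    then have "b' \<in> unit_residues c" using c by (simp add: unit_residues_def b'_def)
    then show ?thesis using inverse by blast
  qed
  then obtain \<sigma> where \<sigma>: "\<And>b. b \<in> unit_residues c \<Longrightarrow> \<sigma> b \<in> unit_residues c"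
      "\<And>b. b \<in> unit_residues c \<Longrightarrow> [k * b * \<sigma> b = - 1] (mod c)"
    by metis
  have "inj_on \<sigma> (unit_residues c)"
  proof (rule inj_onI)
    fix x y assume xy: "x \<in> unit_residues c" "y \<in> unit_residues c" "\<sigma> x = \<sigma> y"
    have "[k * x * \<sigma> x = k * y * \<sigma> x] (mod c)"
      using \<sigma>(2) [OF xy(1)] \<sigma>(2) [OF xy(2)] xy(3) by (metis cong_sym cong_trans)
    moreover have "coprime (\<sigma> x) c" using \<sigma>(1) [OF xy(1)] by (simp add: unit_residues_def)
    ultimately have "[x = y] (mod c)" using k by (simp add: cong_mult_rcancel cong_mult_lcancel)
    then show "x = y" using xy by (simp add: unit_residues_def cong_def)
  qed
  then have bij: "bij_betw \<sigma> (unit_residues c) (unit_residues c)"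
    unfolding bij_betw_def using \<sigma>(1)
    by (metis endo_inj_surj finite_unit_residues image_subsetI)
  have "(\<Sum>b\<in>unit_residues c. f b) = (\<Sum>b\<in>unit_residues c. g (\<sigma> b))"
    by (intro sum.cong refl summand \<sigma>)
  also have "\<dots> = (\<Sum>b\<in>unit_residues c. g b)"
    by (rule sum.reindex_bij_betw [OF bij])
  finally show ?thesis .
qed

lemma has_sum_multiples_iff:
  fixes k :: int
  assumes "k \<noteq> 0"
  shows "((\<lambda>e. if k dvd e then g e else 0) has_sum S) UNIV \<longleftrightarrow> ((\<lambda>e. g (k * e)) has_sum S) UNIV"
proof -
  have "((\<lambda>e. if k dvd e then g e else 0) has_sum S) UNIV \<longleftrightarrow> (g has_sum S) (range ((*) k))"
    by (rule has_sum_cong_neutral) (auto elim!: dvdE)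
  also have "\<dots> \<longleftrightarrow> (g \<circ> (*) k has_sum S) UNIV"
    using assms by (intro has_sum_reindex) (simp add: inj_on_def)
  finally show ?thesis by (simp add: o_def)
qed

lemma Im_divide_of_int: "Im (z / of_int c) = Im z / of_int c"
  by (metis Im_divide_of_real of_real_of_int_eq)

lemma qexp_rational_shift:
  assumes "c > 0"
  shows "qexp ((24 * of_int b + z) / of_int c * of_int e / 24) =
    qexp (z * of_int e / (24 * of_int c)) * unity_root c (e * b)"
proof -
  have "(24 * of_int b + z) / of_int c * of_int e / 24 =
      z * of_int e / (24 * of_int c) + of_int (e * b) / of_int c"
    using assms by (simp add: field_simps)
  then show ?thesis by (simp only: qexp_add qexp_of_int_divide)
qed

context odd_prime
begin

lemma unit_residues_not_dvd: "b \<in> unit_residues p \<Longrightarrow> \<not> p dvd b"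
  by (simp add: unit_residues_def coprime_iff)

lemma unit_residues_square_not_dvd: "b \<in> unit_residues (p\<^sup>2) \<Longrightarrow> \<not> p dvd b"
  by (simp add: unit_residues_def coprime_iff)

lemma sum_unit_residues_Legendre:
  fixes h :: "int \<Rightarrow> complex"
  shows "(\<Sum>b\<in>{0..<p}. of_int (Legendre b p) * h b) =
    (\<Sum>b\<in>unit_residues p. of_int (Legendre b p) * h b)"
  by (rule sum.mono_neutral_right) (auto simp: unit_residues_def coprime_iff Legendre_eq_0_iff)

lemma sum_prime_square_split:
  fixes h :: "int \<Rightarrow> complex"
  shows "(\<Sum>b\<in>{0..<p\<^sup>2}. h b) =
    h 0 + (\<Sum>b\<in>unit_residues p. h (p * b)) + (\<Sum>b\<in>unit_residues (p\<^sup>2). h b)"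
proof -
  let ?V = "{b\<in>{0..<p\<^sup>2}. p dvd b}"
  have "{0..<p\<^sup>2} = unit_residues (p\<^sup>2) \<union> ?V" "unit_residues (p\<^sup>2) \<inter> ?V = {}"
    by (auto simp: unit_residues_def coprime_iff)
  moreover have "finite ?V" by (rule finite_subset [of _ "{0..<p\<^sup>2}"]) auto
  ultimately have "(\<Sum>b\<in>{0..<p\<^sup>2}. h b) = (\<Sum>b\<in>?V. h b) + (\<Sum>b\<in>unit_residues (p\<^sup>2). h b)"
    by (metis add.commute finite_unit_residues sum.union_disjoint)
  also have "?V = (*) p ` {0..<p}"
    using pos by (auto simp: power2_eq_square elim!: dvdE simp: zero_le_mult_iff image_iff)
  also have "(\<Sum>b\<in>(*) p ` {0..<p}. h b) = (\<Sum>b\<in>{0..<p}. h (p * b))"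
    using pos by (subst sum.reindex) (auto simp: inj_on_def)
  also have "{0..<p} = insert 0 (unit_residues p)"
    using pos by (auto simp: unit_residues_def coprime_iff dest!: zdvd_imp_le)
  also have "(\<Sum>b\<in>\<dots>. h (p * b)) = h 0 + (\<Sum>b\<in>unit_residues p. h (p * b))"
    using unit_residues_not_dvd [of 0] by (subst sum.insert) auto
  finally show ?thesis .
qed

text \<open>
  The weight 1/2 Hecke operator \<open>T(p\<^sup>2)\<close> on functions with expansions in \<open>q\<close> to exponents \<open>e / 24\<close>:
  the coefficient at \<open>e\<close> becomes \<open>p a(p\<^sup>2 e) + s (e/p) a(e) + a(e/p\<^sup>2)\<close>.
\<close>

definition hecke :: "int \<Rightarrow> (complex \<Rightarrow> complex) \<Rightarrow> complex \<Rightarrow> complex" where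
  "hecke s f w =
     (\<Sum>b\<in>{0..<p\<^sup>2}. f ((24 * of_int b + w) / of_int (p\<^sup>2))) / of_int p
     + of_int s / gauss_sum *
         (\<Sum>b\<in>{0..<p}. of_int (Legendre b p) * f ((24 * of_int b + of_int p * w) / of_int p))
     + f (of_int (p\<^sup>2) * w)"

definition hecke_coeff :: "int \<Rightarrow> (int \<Rightarrow> int) \<Rightarrow> int \<Rightarrow> int" where
  "hecke_coeff s a e =
     p * a (p\<^sup>2 * e) + s * Legendre e p * a e + (if p\<^sup>2 dvd e then a (e div p\<^sup>2) else 0)"

context
  fixes a :: "int \<Rightarrow> int" and f :: "complex \<Rightarrow> complex" and w :: complex
  assumes f: "\<And>w. Im w > 0 \<Longrightarrow> ((\<lambda>e. of_int (a e) * qexp (w * of_int e / 24)) has_sum f w) UNIV"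
    and w: "Im w > 0"
begin

lemma average_has_sum:
  "((\<lambda>e. of_int (p * a (p\<^sup>2 * e)) * qexp (w * of_int e / 24)) has_sum
    (\<Sum>b\<in>{0..<p\<^sup>2}. f ((24 * of_int b + w) / of_int (p\<^sup>2))) / of_int p) UNIV"
proof -
  let ?g = "\<lambda>e. of_int (p * a e) * qexp (w * of_int e / (24 * of_int (p\<^sup>2)))"
  have "((\<lambda>e. (\<Sum>b\<in>{0..<p\<^sup>2}. of_int (a e) *
        qexp ((24 * of_int b + w) / of_int (p\<^sup>2) * of_int e / 24)) * inverse (of_int p)) has_sum
      (\<Sum>b\<in>{0..<p\<^sup>2}. f ((24 * of_int b + w) / of_int (p\<^sup>2))) * inverse (of_int p)) UNIV"
    using w pos by (intro has_sum_cmult_left has_sum_sum f) (simp_all add: Im_divide_of_int)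
  moreover have "(\<Sum>b\<in>{0..<p\<^sup>2}. of_int (a e) *
      qexp ((24 * of_int b + w) / of_int (p\<^sup>2) * of_int e / 24)) * inverse (of_int p) =
      (if p\<^sup>2 dvd e then ?g e else 0)" for e
  proof -
    have "(\<Sum>b\<in>{0..<p\<^sup>2}. of_int (a e) *
        qexp ((24 * of_int b + w) / of_int (p\<^sup>2) * of_int e / 24)) =
        of_int (a e) * qexp (w * of_int e / (24 * of_int (p\<^sup>2))) *
          (\<Sum>b\<in>{0..<p\<^sup>2}. unity_root (p\<^sup>2) (e * b))"
      using pos qexp_rational_shift [of "p\<^sup>2"]
      by (simp only: zero_less_power sum_distrib_left mult.assoc)
    also have "(\<Sum>b\<in>{0..<p\<^sup>2}. unity_root (p\<^sup>2) (e * b)) =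
        (if p\<^sup>2 dvd e then of_int (p\<^sup>2) else 0)"
      using pos by (intro sum_unity_root) simp
    finally show ?thesis using pos by (simp add: power2_eq_square)
  qed
  ultimately have "((\<lambda>e. if p\<^sup>2 dvd e then ?g e else 0) has_sum
      (\<Sum>b\<in>{0..<p\<^sup>2}. f ((24 * of_int b + w) / of_int (p\<^sup>2))) / of_int p) UNIV"
    by (simp only: divide_inverse)
  then show ?thesis
    using pos by (subst (asm) has_sum_multiples_iff) (simp_all add: field_simps)
qed

lemma Legendre_twist_has_sum:
  "((\<lambda>e. of_int (s * Legendre e p * a e) * qexp (w * of_int e / 24)) has_sum
    of_int s / gauss_sum *
      (\<Sum>b\<in>{0..<p}. of_int (Legendre b p) * f ((24 * of_int b + of_int p * w) / of_int p))) UNIV"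
proof -
  have "((\<lambda>e. of_int s / gauss_sum * (\<Sum>b\<in>{0..<p}. of_int (Legendre b p) * (of_int (a e) *
        qexp ((24 * of_int b + of_int p * w) / of_int p * of_int e / 24)))) has_sum
      of_int s / gauss_sum *
        (\<Sum>b\<in>{0..<p}. of_int (Legendre b p) * f ((24 * of_int b + of_int p * w) / of_int p))) UNIV"
    using w pos by (intro has_sum_cmult_right has_sum_sum f) (simp_all add: Im_divide_of_int)
  moreover have "of_int s / gauss_sum * (\<Sum>b\<in>{0..<p}. of_int (Legendre b p) * (of_int (a e) *
      qexp ((24 * of_int b + of_int p * w) / of_int p * of_int e / 24))) =
      of_int (s * Legendre e p * a e) * qexp (w * of_int e / 24)" for e
  proof -
    have "of_int p * w * of_int e / (24 * of_int p) = w * of_int e / 24"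
      using pos by simp
    then have "(\<Sum>b\<in>{0..<p}. of_int (Legendre b p) * (of_int (a e) *
        qexp ((24 * of_int b + of_int p * w) / of_int p * of_int e / 24))) =
        of_int (a e) * qexp (w * of_int e / 24) * character_sum (\<lambda>u. Legendre u p) p e"
      unfolding qexp_rational_shift [OF pos] character_sum_def sum_distrib_left
      by (intro sum.cong refl) (simp add: mult_ac)
    then show ?thesis using gauss_sum_nonzero by (simp add: Legendre_fourier)
  qed
  ultimately show ?thesis by (simp only:)
qed

lemma dilation_has_sum:
  "((\<lambda>e. of_int (if p\<^sup>2 dvd e then a (e div p\<^sup>2) else 0) * qexp (w * of_int e / 24)) has_sum
    f (of_int (p\<^sup>2) * w)) UNIV"
proof -
  let ?g = "\<lambda>e. of_int (a (e div p\<^sup>2)) * qexp (w * of_int e / 24)"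
  have "((\<lambda>e. ?g (p\<^sup>2 * e)) has_sum f (of_int (p\<^sup>2) * w)) UNIV"
    using f [of "of_int (p\<^sup>2) * w"] w pos by (simp add: mult_ac)
  then have "((\<lambda>e. if p\<^sup>2 dvd e then ?g e else 0) has_sum f (of_int (p\<^sup>2) * w)) UNIV"
    using pos by (subst has_sum_multiples_iff) simp_all
  moreover have "of_int (if p\<^sup>2 dvd e then a (e div p\<^sup>2) else 0) * qexp (w * of_int e / 24) =
      (if p\<^sup>2 dvd e then ?g e else 0)" for e
    by simp
  ultimately show ?thesis by (simp only:)
qed

theorem hecke_has_sum:
  "((\<lambda>e. of_int (hecke_coeff s a e) * qexp (w * of_int e / 24)) has_sum hecke s f w) UNIV"
  using has_sum_add [OF has_sum_add [OF average_has_sum Legendre_twist_has_sum] dilation_has_sum]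
  by (simp only: hecke_def hecke_coeff_def of_int_add ring_distribs)

end

end

context prime_gt_3
begin

lemma eta_factor_prime:
  assumes "\<not> p dvd b"
  shows "eta_factor p b = of_int (Legendre 3 p * Legendre b p) * gauss_sum / sqrt (of_int p)"
proof -
  have "\<not> p dvd 144 * b" "\<not> p dvd 12"
    using assms not_dvd_2_3_smooth [of 4 2] not_dvd_2_3_smooth [of 2 1]
    by (simp_all add: dvd_mult_iff)
  moreover from this have "Legendre (144 * b) p = Legendre b p"
    using Legendre_mult [of "12\<^sup>2" b] Legendre_square [of 12] by simp
  ultimately show ?thesis
    by (simp add: eta_factor_def quad_gauss_sum_prime Legendre_3_eq_chi12)
qed

lemma eta_factor_prime_square:
  assumes "\<not> p dvd b"
  shows "eta_factor (p\<^sup>2) b = 1"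
proof -
  have "\<not> p dvd 144 * b"
    using assms not_dvd_2_3_smooth [of 4 2] by (simp add: dvd_mult_iff)
  then have "quad_gauss_sum (144 * b) (p\<^sup>2) = of_int p"
    by (rule quad_gauss_sum_prime_square)
  moreover have "chi12 (p\<^sup>2) = 1"
    using chi12.square [OF coprime_12] by (simp add: power2_eq_square chi12.mult)
  ultimately show ?thesis using pos by (simp add: eta_factor_def)
qed

lemma Legendre_6: "Legendre 6 p = Legendre 3 p * Legendre 2 p"
  using Legendre_mult [of 3 2] by simp

lemma eta_quot_transform_prime:
  assumes b: "\<not> p dvd b" and inverse: "[1152 * b * b' = - 1] (mod p)" and y: "y > 0"
  shows "eta_quot ((24 * of_int b + \<i> * of_real (1 / (2 * y))) / of_int p) =
    of_int (Legendre 6 p * Legendre b p) * gauss_sum * (of_real (sqrt (y / of_int p)) / 2) *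
      eta_quot_dual ((24 * of_int b' + \<i> * of_real y) / of_int p)"
proof -
  have two_b: "\<not> p dvd 2 * b" using b not_dvd_2 by (simp add: dvd_mult_iff)
  have "eta_factor p a ^ 2 = gauss_sum ^ 2 / of_int p" if "\<not> p dvd a" for a
  proof -
    have "(complex_of_int (Legendre 3 p * Legendre a p))\<^sup>2 = 1"
      using Legendre_square [of "3 * a"] that not_dvd_3
      by (metis Legendre_mult dvd_mult_iff of_int_1 of_int_power power2_eq_square)
    then show ?thesis
      unfolding eta_factor_prime [OF that] using pos
      by (simp add: power_divide power_mult_distrib flip: of_real_power)
  qed
  from this [OF b] this [OF two_b]
  have "eta_factor p (2 * b) ^ 2 = eta_factor p b ^ 2" "eta_factor p b ^ 2 \<noteq> 0"
    using pos gauss_sum_nonzero by auto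
  then have "eta_factor p (2 * b) ^ 3 / eta_factor p b ^ 2 = eta_factor p (2 * b)"
    by (simp add: power3_eq_cube power2_eq_square)
  then have "eta_quot ((24 * of_int b + \<i> * of_real (1 / (2 * y))) / of_int p) =
      eta_factor p (2 * b) * (of_real (sqrt y) / 2) *
        eta_quot_dual ((24 * of_int b' + \<i> * of_real y) / of_int p)"
    using eta_quot_transform [OF pos coprime_12 inverse y] by simp
  then show ?thesis
    unfolding eta_factor_prime [OF two_b] using pos
    by (simp add: real_sqrt_divide Legendre_6 Legendre_mult mult_ac)
qed

lemma Legendre_negative_inverse:
  assumes "[1152 * b * b' = - 1] (mod p)"
  shows "Legendre 6 p * Legendre b p = Legendre 3 p * Legendre (-1) p * Legendre b' p"
proof -
  have "\<not> p dvd 1152 * b * b'"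
    using assms not_dvd_minus_1 by (metis cong_dvd_iff)
  then have b': "\<not> p dvd b'" by (simp add: dvd_mult_iff)
  have "\<not> p dvd 24" using not_dvd_2_3_smooth [of 3 1] by simp
  then have "Legendre (24\<^sup>2) p = 1" by (rule Legendre_square)
  moreover have "Legendre (24\<^sup>2 * (2 * b * b')) p = Legendre (-1) p"
    using assms by (intro Legendre.cong) (simp add: mult_ac)
  ultimately have "Legendre 2 p * Legendre b p * Legendre b' p = Legendre (-1) p"
    by (simp only: Legendre_mult mult_1_left)
  then have "Legendre 2 p * Legendre b p * (Legendre b' p * Legendre b' p) =
      Legendre (-1) p * Legendre b' p"
    by (simp add: mult.assoc)
  then show ?thesis using Legendre_mult_self [OF b'] by (simp add: Legendre_6 mult_ac)
qed

lemma coprime_1152: "coprime 1152 p"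
  using not_dvd_2_3_smooth [of 7 2] by (simp add: coprime_iff)

context
  fixes y :: real
  assumes y: "y > 0"
begin

lemma sum_eta_quot_prime:
  "(\<Sum>b\<in>unit_residues p. eta_quot ((24 * of_int b + \<i> * of_real (1 / (2 * y))) / of_int p)) =
    of_real (sqrt (y / of_int p)) / 2 * (of_int p * of_int (Legendre 3 p) / gauss_sum) *
      (\<Sum>b\<in>unit_residues p. of_int (Legendre b p) *
         eta_quot_dual ((24 * of_int b + \<i> * of_real y) / of_int p))"
proof -
  define r where "r = complex_of_real (sqrt (y / of_int p)) / 2"
  define G where "G b = eta_quot_dual ((24 * of_int b + \<i> * of_real y) / of_int p)" for b
  have "eta_quot ((24 * of_int b + \<i> * of_real (1 / (2 * y))) / of_int p) =
      r * (of_int p * of_int (Legendre 3 p) / gauss_sum) * (of_int (Legendre b' p) * G b')"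
    if b: "b \<in> unit_residues p" and inverse: "[1152 * b * b' = - 1] (mod p)" for b b'
  proof -
    have "eta_quot ((24 * of_int b + \<i> * of_real (1 / (2 * y))) / of_int p) =
        of_int (Legendre 6 p * Legendre b p) * gauss_sum * r * G b'"
      unfolding r_def G_def using unit_residues_not_dvd [OF b] inverse y
      by (rule eta_quot_transform_prime)
    also have "\<dots> = of_int (Legendre 3 p) * (of_int (Legendre (-1) p) * gauss_sum) *
        r * (of_int (Legendre b' p) * G b')"
      unfolding Legendre_negative_inverse [OF inverse] by simp
    finally show ?thesis by (simp add: Legendre_minus_1_gauss_sum)
  qed
  then have "(\<Sum>b\<in>unit_residues p.
      eta_quot ((24 * of_int b + \<i> * of_real (1 / (2 * y))) / of_int p)) =
      (\<Sum>b\<in>unit_residues p.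
        r * (of_int p * of_int (Legendre 3 p) / gauss_sum) * (of_int (Legendre b p) * G b))"
    by (rule sum_unit_residues_negative_inverse [OF pos coprime_1152])
  then show ?thesis by (simp only: sum_distrib_left r_def G_def)
qed

lemma sum_Legendre_eta_quot_prime:
  "(\<Sum>b\<in>unit_residues p. of_int (Legendre b p) *
      eta_quot ((24 * of_int b + \<i> * of_real (1 / (2 * y))) / of_int p)) =
    of_real (sqrt (y / of_int p)) / 2 * of_int (Legendre 6 p) * gauss_sum *
      (\<Sum>b\<in>unit_residues p. eta_quot_dual ((24 * of_int b + \<i> * of_real y) / of_int p))"
proof -
  define r where "r = complex_of_real (sqrt (y / of_int p)) / 2"
  define G where "G b = eta_quot_dual ((24 * of_int b + \<i> * of_real y) / of_int p)" for b
  have "of_int (Legendre b p) * eta_quot ((24 * of_int b + \<i> * of_real (1 / (2 * y))) / of_int p) =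
      r * of_int (Legendre 6 p) * gauss_sum * G b'"
    if b: "b \<in> unit_residues p" and inverse: "[1152 * b * b' = - 1] (mod p)" for b b'
  proof -
    have "eta_quot ((24 * of_int b + \<i> * of_real (1 / (2 * y))) / of_int p) =
        of_int (Legendre 6 p * Legendre b p) * gauss_sum * r * G b'"
      unfolding r_def G_def using unit_residues_not_dvd [OF b] inverse y
      by (rule eta_quot_transform_prime)
    then have "of_int (Legendre b p) *
        eta_quot ((24 * of_int b + \<i> * of_real (1 / (2 * y))) / of_int p) =
        of_int (Legendre b p * Legendre b p) * (r * of_int (Legendre 6 p) * gauss_sum * G b')"
      by simp
    then show ?thesis by (simp add: Legendre_mult_self [OF unit_residues_not_dvd [OF b]])
  qed
  then have "(\<Sum>b\<in>unit_residues p. of_int (Legendre b p) *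
      eta_quot ((24 * of_int b + \<i> * of_real (1 / (2 * y))) / of_int p)) =
      (\<Sum>b\<in>unit_residues p. r * of_int (Legendre 6 p) * gauss_sum * G b)"
    by (rule sum_unit_residues_negative_inverse [OF pos coprime_1152])
  then show ?thesis by (simp only: sum_distrib_left r_def G_def)
qed

lemma sum_eta_quot_prime_square:
  "(\<Sum>b\<in>unit_residues (p\<^sup>2).
      eta_quot ((24 * of_int b + \<i> * of_real (1 / (2 * y))) / of_int (p\<^sup>2))) =
    of_real (sqrt y) / 2 *
      (\<Sum>b\<in>unit_residues (p\<^sup>2). eta_quot_dual ((24 * of_int b + \<i> * of_real y) / of_int (p\<^sup>2)))"
  unfolding sum_distrib_left
proof (rule sum_unit_residues_negative_inverse)
  fix b b' assume b: "b \<in> unit_residues (p\<^sup>2)" and inverse: "[1152 * b * b' = - 1] (mod p\<^sup>2)"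
  have "\<not> p dvd b" "\<not> p dvd 2 * b"
    using unit_residues_square_not_dvd [OF b] not_dvd_2 by (simp_all add: dvd_mult_iff)
  then show "eta_quot ((24 * of_int b + \<i> * of_real (1 / (2 * y))) / of_int (p\<^sup>2)) =
      of_real (sqrt y) / 2 * eta_quot_dual ((24 * of_int b' + \<i> * of_real y) / of_int (p\<^sup>2))"
    using eta_quot_transform [of "p\<^sup>2" b b' y] inverse y pos coprime_12
    by (simp add: eta_factor_prime_square)
qed (use pos coprime_1152 in simp_all)

end

context
  fixes y :: real and w z :: complex
  assumes y: "y > 0" and w: "w = \<i> * of_real (1 / (2 * y))" and z: "z = \<i> * of_real y"
begin

lemma sum_eta_quot_multiples:
  "(\<Sum>b\<in>unit_residues p. eta_quot ((24 * of_int (p * b) + w) / of_int (p\<^sup>2))) =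
    of_real (sqrt y) / 2 * (of_int p * of_int (Legendre 3 p) / gauss_sum) *
      (\<Sum>b\<in>unit_residues p.
         of_int (Legendre b p) * eta_quot_dual ((24 * of_int b + of_int p * z) / of_int p))"
proof -
  have "p * y > 0" "sqrt (p * y / p) = sqrt y" using y pos by simp_all
  moreover have "(24 * of_int (p * b) + w) / of_int (p\<^sup>2) =
      (24 * of_int b + \<i> * of_real (1 / (2 * (p * y)))) / of_int p" for b
    using pos y by (simp add: w field_simps power2_eq_square)
  moreover have "of_int p * z = \<i> * of_real (p * y)" by (simp add: z)
  ultimately show ?thesis
    using sum_eta_quot_prime [of "p * y"] by (simp only:)
qed

lemma twisted_sum_eta_quot:
  "of_int (Legendre 6 p) / gauss_sum * (\<Sum>b\<in>unit_residues p.
      of_int (Legendre b p) * eta_quot ((24 * of_int b + of_int p * w) / of_int p)) =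
    of_real (sqrt y) / 2 / of_int p *
      (\<Sum>b\<in>unit_residues p. eta_quot_dual ((24 * of_int (p * b) + z) / of_int (p\<^sup>2)))"
proof -
  define A where
    "A = (\<Sum>b\<in>unit_residues p. eta_quot_dual ((24 * of_int (p * b) + z) / of_int (p\<^sup>2)))"
  have "y / p > 0" "sqrt (y / p / p) = sqrt y / p"
    using y pos by (simp_all add: real_sqrt_divide)
  moreover have "of_int p * w = \<i> * of_real (1 / (2 * (y / p)))"
    using pos y by (simp add: w field_simps)
  moreover have "(24 * of_int (p * b) + z) / of_int (p\<^sup>2) =
      (24 * of_int b + \<i> * of_real (y / p)) / of_int p" for b
    using pos by (simp add: z field_simps power2_eq_square)
  ultimately have "(\<Sum>b\<in>unit_residues p.
      of_int (Legendre b p) * eta_quot ((24 * of_int b + of_int p * w) / of_int p)) =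
      of_real (sqrt y / p) / 2 * of_int (Legendre 6 p) * gauss_sum * A"
    using sum_Legendre_eta_quot_prime [of "y / p"] by (simp only: A_def)
  moreover have "\<not> p dvd 6" using not_dvd_2_3_smooth [of 1 1] by simp
  then have "complex_of_int (Legendre 6 p) * of_int (Legendre 6 p) = 1"
    using Legendre_mult_self by (metis of_int_1 of_int_mult)
  ultimately show ?thesis
    unfolding A_def [symmetric] using gauss_sum_nonzero by (simp add: mult_ac)
qed

text \<open>
  Splitting the average over \<open>b\<close> mod \<open>p\<^sup>2\<close> by the divisor \<open>gcd (b, p\<^sup>2)\<close>, the involution exchanges
  the term for \<open>b = 0\<close> with the dilation and the terms for \<open>gcd (b, p\<^sup>2) = p\<close> with the twisted sum.
\<close>

theorem hecke_eta_quot_transform: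
  "hecke (Legendre 6 p) eta_quot w = of_real (sqrt y) / 2 * hecke (Legendre 3 p) eta_quot_dual z"
proof -
  define S where
    "S = (\<Sum>b\<in>unit_residues (p\<^sup>2). eta_quot_dual ((24 * of_int b + z) / of_int (p\<^sup>2)))"
  define A where
    "A = (\<Sum>b\<in>unit_residues p. eta_quot_dual ((24 * of_int (p * b) + z) / of_int (p\<^sup>2)))"
  define T where
    "T = (\<Sum>b\<in>unit_residues p.
       of_int (Legendre b p) * eta_quot_dual ((24 * of_int b + of_int p * z) / of_int p))"
  have scaled: "p\<^sup>2 * y > 0" "y / p\<^sup>2 > 0" using y pos by simp_all
  have sqrt: "sqrt (p\<^sup>2 * y) = p * sqrt y" "sqrt (y / p\<^sup>2) = sqrt y / p"
    using pos by (simp_all add: real_sqrt_mult real_sqrt_divide)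
  have dilation: "eta_quot (of_int (p\<^sup>2) * w) =
      of_real (sqrt y) / 2 / of_int p * eta_quot_dual ((24 * of_int 0 + z) / of_int (p\<^sup>2))"
    using eta_quot_transform_imaginary [OF scaled(2)] unfolding sqrt
    by (simp add: w z field_simps)
  have zero: "eta_quot ((24 * of_int 0 + w) / of_int (p\<^sup>2)) =
      of_int p * (of_real (sqrt y) / 2) * eta_quot_dual (of_int (p\<^sup>2) * z)"
    using eta_quot_transform_imaginary [OF scaled(1)] unfolding sqrt
    by (simp add: w z field_simps)
  have units: "(\<Sum>b\<in>unit_residues (p\<^sup>2). eta_quot ((24 * of_int b + w) / of_int (p\<^sup>2))) =
      of_real (sqrt y) / 2 * S"
    unfolding S_def w z by (rule sum_eta_quot_prime_square [OF y])
  show ?thesis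
    unfolding hecke_def sum_unit_residues_Legendre sum_prime_square_split
      dilation zero units sum_eta_quot_multiples twisted_sum_eta_quot
    unfolding A_def [symmetric] S_def [symmetric] T_def [symmetric]
    using pos gauss_sum_nonzero by (simp add: field_simps)
qed

end

end

section \<open>Fricke-invariant functions\<close>

lemma Im_fricke_pos: "Im z > 0 \<Longrightarrow> Im (- 1 / (2 * z)) > 0"
  by (auto simp: Im_divide intro!: divide_pos_pos) (smt (verit) sum_power2_gt_zero_iff)

lemma fricke_fricke: "Im z > 0 \<Longrightarrow> - 1 / (2 * (- 1 / (2 * z))) = z"
  by auto

lemma Im_fricke_ge:
  assumes re: "\<bar>Re z\<bar> \<le> 1 / 2" and im: "0 < Im z" "Im z \<le> 1 / 4"
  shows "Im (- 1 / (2 * z)) \<ge> Im z / (5 / 8)"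
proof -
  have "(Re z)\<^sup>2 \<le> (1 / 2)\<^sup>2" using re by (metis abs_ge_zero power2_abs power_mono)
  moreover have "(Im z)\<^sup>2 \<le> (1 / 4)\<^sup>2" using im by (intro power_mono) auto
  ultimately have upper: "(norm z)\<^sup>2 \<le> 5 / 16" by (simp add: cmod_power2 power_divide)
  have lower: "(norm z)\<^sup>2 > 0" using im by auto
  then have "Im (- 1 / (2 * z)) = Im z / (2 * (norm z)\<^sup>2)"
    unfolding cmod_power2 by (simp add: Im_divide power_mult_distrib divide_simps)
  also have "\<dots> \<ge> Im z / (5 / 8)"
    using lower upper im by (intro divide_left_mono) auto
  finally show ?thesis .
qed

text \<open>
  As long as \<open>Im z < 1/4\<close>, translating to \<open>\<bar>Re z\<bar> \<le> 1/2\<close> and applying the involution raises the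
  imaginary part by a factor of at least 8/5.
\<close>

lemma fricke_reduction:
  assumes shift: "\<And>z k. Im z > 0 \<Longrightarrow> K (z - of_int k) = K z"
    and fricke: "\<And>z. Im z > 0 \<Longrightarrow> K (- 1 / (2 * z)) = K z"
    and z: "Im z > 0"
  obtains z' where "Im z' \<ge> 1 / 4" "K z' = K z"
proof -
  have reduce: "\<exists>z'. Im z' \<ge> 1 / 4 \<and> K z' = K z" if "Im z \<ge> (5 / 8) ^ n / 4" for n z
    using that
  proof (induction n arbitrary: z)
    case (Suc n)
    show ?case
    proof (cases "Im z \<ge> 1 / 4")
      case False
      have pos: "Im z > 0" using Suc.prems by (smt (verit) divide_pos_pos zero_less_power)
      define z1 where "z1 = z - of_int (round (Re z))"
      have im: "Im z1 = Im z" by (simp add: z1_def)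
      have "\<bar>Re z1\<bar> \<le> 1 / 2"
        using of_int_round_abs_le [of "Re z"] by (simp add: z1_def abs_minus_commute)
      then have "Im (- 1 / (2 * z1)) \<ge> Im z / (5 / 8)"
        using Im_fricke_ge [of z1] False pos im by simp
      then have "Im (- 1 / (2 * z1)) \<ge> (5 / 8) ^ n / 4" using Suc.prems by simp
      moreover have "K (- 1 / (2 * z1)) = K z"
        using fricke [of z1] shift [of z "round (Re z)"] pos im by (simp add: z1_def)
      ultimately show ?thesis using Suc.IH by metis
    qed auto
  qed auto
  have "(\<lambda>n. (5 / 8 :: real) ^ n / 4) \<longlonglongrightarrow> 0 / 4"
    by (intro tendsto_divide LIMSEQ_realpow_zero tendsto_const) auto
  then have "\<forall>\<^sub>F n in sequentially. (5 / 8 :: real) ^ n / 4 < Im z"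
    using z by (intro order_tendstoD(2)) auto
  then obtain n where "(5 / 8 :: real) ^ n / 4 < Im z" by (auto simp: eventually_sequentially)
  then show ?thesis using reduce [of n z] that by auto
qed

theorem fricke_invariant_constant:
  assumes f: "f holomorphic_on ball 0 1"
    and invariant: "\<And>z. Im z > 0 \<Longrightarrow> f (qexp (- 1 / (2 * z))) = f (qexp z)"
    and q: "norm q < 1"
  shows "f q = f 0"
proof -
  define \<rho> where "\<rho> = exp (- pi / 2)"
  have \<rho>: "0 < \<rho>" "\<rho> < 1" by (auto simp: \<rho>_def)
  have "continuous_on (cball 0 \<rho>) (\<lambda>q. norm (f q))"
    using \<rho> by (intro continuous_intros holomorphic_on_imp_continuous_on
        holomorphic_on_subset [OF f]) auto
  then obtain q0 where q0: "q0 \<in> cball 0 \<rho>" "\<And>q. q \<in> cball 0 \<rho> \<Longrightarrow> norm (f q) \<le> norm (f q0)"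
    using continuous_attains_sup [of "cball 0 \<rho>" "\<lambda>q. norm (f q)"] \<rho> by auto
  have "norm (f q) \<le> norm (f q0)" if q: "q \<in> ball 0 1" for q
  proof (cases "q = 0")
    case False
    obtain w where w: "Im w > 0" "qexp w = q" using False q by (auto elim: qexp_surj)
    have shift: "f (qexp (z - of_int k)) = f (qexp z)" for z k
      using qexp_add [of z "of_int (- k)"] qexp_of_int [of "- k"] by simp
    obtain z where z: "Im z \<ge> 1 / 4" "f (qexp z) = f (qexp w)"
      using fricke_reduction [of "\<lambda>z. f (qexp z)" w] shift invariant w(1) by metis
    have "- 2 * pi * Im z \<le> - 2 * pi * (1 / 4)" using z(1) by (intro mult_left_mono_neg) auto
    then have "qexp z \<in> cball 0 \<rho>" by (simp add: norm_qexp \<rho>_def)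
    then show ?thesis using q0(2) [of "qexp z"] z(2) w(2) by simp
  qed (use q0(2) [of 0] \<rho> in auto)
  then have "f constant_on ball 0 1"
    by (intro maximum_modulus_principle [OF f _ _ _ subset_refl, of q0]) (use q0(1) \<rho> in auto)
  then show ?thesis using q by (auto simp: constant_on_def)
qed

lemma holomorphic_upper_half_plane_eqI:
  assumes "f holomorphic_on {z. Im z > 0}" "g holomorphic_on {z. Im z > 0}"
    and imaginary: "\<And>y. y > 0 \<Longrightarrow> f (\<i> * of_real y) = g (\<i> * of_real y)"
    and z: "Im z > 0"
  shows "f z = g z"
proof -
  have "f z - g z = 0"
  proof (rule analytic_continuation
      [of "\<lambda>z. f z - g z" "{z. Im z > 0}" "{z. Re z = 0 \<and> Im z > 0}" \<i>])
    show "(\<lambda>z. f z - g z) holomorphic_on {z. Im z > 0}" using assms by (intro holomorphic_intros)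
    show "connected {z. Im z > 0}" by (intro convex_connected convex_halfspace_Im_gt)
    show "\<i> islimpt {z. Re z = 0 \<and> Im z > 0}"
      unfolding islimpt_approachable
    proof safe
      fix e :: real assume "e > 0"
      then show "\<exists>x'\<in>{z. Re z = 0 \<and> 0 < Im z}. x' \<noteq> \<i> \<and> dist x' \<i> < e"
        by (intro bexI [of _ "\<i> * of_real (1 + e / 2)"])
           (auto simp: dist_norm ring_distribs norm_mult complex_eq_iff)
    qed
    fix x assume "x \<in> {z. Re z = 0 \<and> Im z > 0}"
    then have "x = \<i> * of_real (Im x)" "Im x > 0" by (auto simp: complex_eq_iff)
    then show "f x - g x = 0" using imaginary by (metis right_minus_eq)
  qed (use z open_halfspace_Im_gt in auto)
  then show ?thesis by simp
qed

lemma holomorphic_on_compose_qexp: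
  assumes f: "f holomorphic_on ball 0 1" and g: "g holomorphic_on S" "\<And>z. z \<in> S \<Longrightarrow> Im (g z) > 0"
  shows "(\<lambda>z. f (qexp (g z))) holomorphic_on S"
proof -
  have "(\<lambda>z. qexp (g z)) ` S \<subseteq> ball 0 1" using g(2) by (auto simp: norm_qexp_less_1)
  then show ?thesis
    using holomorphic_on_compose_gen [OF qexp_holomorphic [OF g(1)] f] by (simp add: o_def)
qed

text \<open>
  The sum and the product of the two functions are invariant, hence constant, so that \<open>H'\<close> takes
  at most two values.
\<close>

theorem fricke_pair_vanishes:
  assumes H: "H holomorphic_on ball 0 1" and H': "H' holomorphic_on ball 0 1"
    and imaginary: "\<And>y. y > 0 \<Longrightarrow> H (qexp (\<i> * of_real (1 / (2 * y)))) = H' (qexp (\<i> * of_real y))"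
    and zero: "H' 0 = 0" and q: "norm q < 1"
  shows "H q = 0"
proof -
  have swap: "H (qexp (- 1 / (2 * z))) = H' (qexp z)" if z: "Im z > 0" for z
  proof (rule holomorphic_upper_half_plane_eqI [OF _ _ _ z])
    show "(\<lambda>z. H (qexp (- 1 / (2 * z)))) holomorphic_on {z. Im z > 0}"
      using Im_fricke_pos by (intro holomorphic_on_compose_qexp [OF H] holomorphic_intros) auto
    show "(\<lambda>z. H' (qexp z)) holomorphic_on {z. Im z > 0}"
      by (intro holomorphic_on_compose_qexp [OF H'] holomorphic_intros) auto
    fix y :: real assume "y > 0"
    moreover from this have "- 1 / (2 * (\<i> * complex_of_real y)) = \<i> * of_real (1 / (2 * y))"
      by (simp add: field_simps)
    ultimately show "H (qexp (- 1 / (2 * (\<i> * of_real y)))) = H' (qexp (\<i> * of_real y))"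
      using imaginary by simp
  qed
  have swap': "H' (qexp (- 1 / (2 * z))) = H (qexp z)" if "Im z > 0" for z
    using swap [OF Im_fricke_pos [OF that]] fricke_fricke [OF that] by simp
  have product: "H q * H' q = 0" if "norm q < 1" for q
    using fricke_invariant_constant [of "\<lambda>q. H q * H' q" q] H H' swap swap' zero that
    by (simp add: holomorphic_on_mult mult.commute)
  have sum: "H q + H' q = H 0" if "norm q < 1" for q
    using fricke_invariant_constant [of "\<lambda>q. H q + H' q" q] H H' swap swap' zero that
    by (simp add: holomorphic_on_add add.commute)
  have "H' ` ball 0 1 \<subseteq> {0, H 0}"
    using product sum by fastforce
  then have "H' constant_on ball 0 1"
    by (intro continuous_finite_range_constant holomorphic_on_imp_continuous_on H')
       (auto intro: finite_subset)
  then have H'_zero: "H' q = 0" if "norm q < 1" for q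
    using that zero by (auto simp: constant_on_def)
  have "H (qexp (- 1 / (2 * \<i>))) = H' (qexp \<i>)" by (rule swap) simp
  also have "\<dots> = 0" by (intro H'_zero norm_qexp_less_1) simp
  finally have "H 0 = 0"
    using sum [of "qexp (- 1 / (2 * \<i>))"] H'_zero [of "qexp (- 1 / (2 * \<i>))"]
    by (simp add: norm_qexp_less_1)
  then show ?thesis using sum [OF q] H'_zero [OF q] by simp
qed

section \<open>Expansions in fractional powers of \<open>q\<close>\<close>

lemma disc_fps_has_sum:
  assumes f: "disc_fps f \<phi>" and q: "norm q < 1"
  shows "((\<lambda>n. of_int (fps_nth f n) * q ^ n) has_sum \<phi> q) UNIV"
proof (rule norm_summable_imp_has_sum [OF _ disc_fps_sums [OF f q]])
  obtain r where r: "norm q < r" "r < 1" using dense [OF q] by blast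
  moreover have "0 \<le> r" using r(1) by (meson norm_ge_zero less_imp_le order_trans)
  ultimately have "summable (\<lambda>n. of_int (fps_nth f n) * complex_of_real r ^ n)"
    by (intro sums_summable [OF disc_fps_sums [OF f]]) simp
  then show "summable (\<lambda>n. norm (of_int (fps_nth f n) * q ^ n))"
    by (rule powser_insidea) (use r \<open>0 \<le> r\<close> in simp)
qed

lemma disc_fps_of_has_sum_qexp:
  assumes "\<And>w. Im w > 0 \<Longrightarrow> ((\<lambda>n. of_int (fps_nth f n) * qexp w ^ n) has_sum S w) UNIV"
  obtains \<phi> where "disc_fps f \<phi>" "\<And>w. Im w > 0 \<Longrightarrow> S w = \<phi> (qexp w)"
proof -
  define \<phi> where "\<phi> q = (\<Sum>n. of_int (fps_nth f n) * q ^ n)" for q :: complex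
  have sums: "(\<lambda>n. of_int (fps_nth f n) * qexp w ^ n) sums S w" if "Im w > 0" for w
    using assms [OF that] by (rule has_sum_imp_sums)
  have "disc_fps f \<phi>"
  proof (rule disc_fpsI)
    fix q :: complex assume q: "norm q < 1"
    show "(\<lambda>n. of_int (fps_nth f n) * q ^ n) sums \<phi> q"
    proof (cases "q = 0")
      case True
      then show ?thesis
        using powser_sums_zero [of "\<lambda>n. complex_of_int (fps_nth f n)"] unfolding \<phi>_def
        by (auto simp: sums_iff)
    next
      case False
      obtain w where "Im w > 0" "qexp w = q" by (rule qexp_surj [OF False q])
      then show ?thesis using sums [of w] by (auto simp: sums_iff \<phi>_def)
    qed
  qed
  moreover have "S w = \<phi> (qexp w)" if "Im w > 0" for w
    using sums [OF that] by (simp add: sums_iff \<phi>_def)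
  ultimately show ?thesis by (rule that)
qed

text \<open>The coefficient of \<open>qexp (w * e / 24)\<close> in \<open>qexp (w * h / 24) * A (qexp w)\<close>.\<close>

definition exponent_coeff :: "int \<Rightarrow> int fps \<Rightarrow> int \<Rightarrow> int" where
  "exponent_coeff h A e =
     (if 24 dvd e - h \<and> h \<le> e then fps_nth A (nat ((e - h) div 24)) else 0)"

lemma exponents_iff: "24 dvd e - h \<and> h \<le> e \<longleftrightarrow> e \<in> range (\<lambda>n. 24 * int n + h)"
proof
  assume "24 dvd e - h \<and> h \<le> e"
  then obtain k where "e - h = 24 * k" "k \<ge> 0" by (auto elim!: dvdE)
  then have "e = 24 * int (nat k) + h" by simp
  then show "e \<in> range (\<lambda>n. 24 * int n + h)" by blast
qed auto

lemma qexp_exponent: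
  "qexp (w * of_int (24 * int n + h) / 24) = qexp (w * of_int h / 24) * qexp w ^ n"
proof -
  have "w * of_int (24 * int n + h) / 24 = w * of_int h / 24 + of_nat n * w"
    by (simp add: field_simps)
  then show ?thesis by (simp only: qexp_add qexp_of_nat_mult)
qed

lemma has_sum_exponents_iff:
  assumes "\<And>e. c e \<noteq> 0 \<Longrightarrow> 24 dvd e - h \<and> h \<le> e"
  shows "((\<lambda>e. of_int (c e) * qexp (w * of_int e / 24)) has_sum qexp (w * of_int h / 24) * S) UNIV \<longleftrightarrow>
    ((\<lambda>n. of_int (c (24 * int n + h)) * qexp w ^ n) has_sum S) UNIV"
proof -
  let ?g = "\<lambda>e. of_int (c e) * qexp (w * of_int e / 24)"
  have "(?g has_sum qexp (w * of_int h / 24) * S) UNIV \<longleftrightarrow>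
      (?g has_sum qexp (w * of_int h / 24) * S) (range (\<lambda>n. 24 * int n + h))"
    by (rule has_sum_cong_neutral) (use assms exponents_iff in auto)
  also have "\<dots> \<longleftrightarrow> ((\<lambda>n. ?g (24 * int n + h)) has_sum qexp (w * of_int h / 24) * S) UNIV"
    by (subst has_sum_reindex) (auto simp: inj_on_def o_def)
  also have "(\<lambda>n. ?g (24 * int n + h)) =
      (\<lambda>n. qexp (w * of_int h / 24) * (of_int (c (24 * int n + h)) * qexp w ^ n))"
    unfolding qexp_exponent by (simp add: mult_ac)
  also have "((\<lambda>n. qexp (w * of_int h / 24) * (of_int (c (24 * int n + h)) * qexp w ^ n)) has_sum
      qexp (w * of_int h / 24) * S) UNIV \<longleftrightarrow>
      ((\<lambda>n. of_int (c (24 * int n + h)) * qexp w ^ n) has_sum S) UNIV"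
    by (subst has_sum_cmult_right_iff) simp_all
  finally show ?thesis .
qed

lemma exponent_coeff_has_sum:
  assumes "disc_fps A F" "Im w > 0"
  shows "((\<lambda>e. of_int (exponent_coeff h A e) * qexp (w * of_int e / 24)) has_sum
    qexp (w * of_int h / 24) * F (qexp w)) UNIV"
proof -
  have "exponent_coeff h A (24 * int n + h) = fps_nth A n" for n
    by (simp add: exponent_coeff_def)
  then show ?thesis
    using disc_fps_has_sum [OF assms(1) norm_qexp_less_1 [OF assms(2)]]
    by (subst has_sum_exponents_iff) (auto simp: exponent_coeff_def split: if_splits)
qed

context prime_gt_3
begin

lemma square_mod_24: "24 dvd p\<^sup>2 - 1"
proof -
  define k r where "k = p div 12" and "r = p mod 12"
  have "r \<in> {1, 5, 7, 11}" unfolding r_def by (rule mod_12)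
  then have "24 dvd r\<^sup>2 - 1" by auto
  moreover have "p\<^sup>2 - 1 = 24 * (6 * k\<^sup>2 + k * r) + (r\<^sup>2 - 1)"
  proof -
    have "p = 12 * k + r" by (simp add: k_def r_def)
    then show ?thesis by (simp add: power2_eq_square algebra_simps)
  qed
  ultimately show ?thesis by (metis dvd_add dvd_triv_left)
qed

lemma hecke_coeff_support:
  assumes h: "h < 24" "24 dvd h' - h" "h' \<le> h" "h' \<le> p\<^sup>2 * h"
    and nonzero: "hecke_coeff s (exponent_coeff h A) e \<noteq> 0"
  shows "24 dvd e - h' \<and> h' \<le> e"
proof -
  have square_ge_1: "1 \<le> p\<^sup>2" using pos by (simp add: one_le_power)
  from nonzero consider (average) "24 dvd p\<^sup>2 * e - h" "h \<le> p\<^sup>2 * e"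
    | (twist) "24 dvd e - h" "h \<le> e"
    | (dilate) e' where "e = p\<^sup>2 * e'" "24 dvd e' - h" "h \<le> e'"
    using pos by (auto simp: hecke_coeff_def exponent_coeff_def split: if_splits elim!: dvdE)
  then show ?thesis
  proof cases
    case average
    have "24 dvd (p\<^sup>2 * e - h) - (p\<^sup>2 - 1) * e - (h' - h)"
      by (rule dvd_diff [OF dvd_diff [OF average(1) dvd_mult2 [OF square_mod_24]] h(2)])
    then have dvd: "24 dvd e - h'" by (simp add: algebra_simps)
    moreover have "h' \<le> e"
    proof (rule ccontr)
      assume "\<not> h' \<le> e"
      then have "24 \<le> h' - e" using dvd by (intro zdvd_imp_le) (simp_all add: dvd_diff_commute)
      then have "e < 0" "e < h" using h(1,3) by simp_all
      moreover from \<open>e < 0\<close> have "p\<^sup>2 * e \<le> 1 * e"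
        using square_ge_1 by (intro mult_right_mono_neg) auto
      ultimately show False using average(2) by simp
    qed
    ultimately show ?thesis by simp
  next
    case twist
    have "24 dvd (e - h) - (h' - h)" by (rule dvd_diff [OF twist(1) h(2)])
    then show ?thesis using twist(2) h(3) by simp
  next
    case dilate
    have "24 dvd (p\<^sup>2 - 1) * e' + (e' - h) - (h' - h)"
      by (rule dvd_diff [OF dvd_add [OF dvd_mult2 [OF square_mod_24] dilate(2)] h(2)])
    then have "24 dvd e - h'" by (simp add: dilate(1) algebra_simps)
    moreover have "p\<^sup>2 * h \<le> e" unfolding dilate(1) using dilate(3) by (intro mult_left_mono) auto
    ultimately show ?thesis using h(4) by simp
  qed
qed

theorem hecke_expansion:
  assumes A: "disc_fps A F" and f: "\<And>w. Im w > 0 \<Longrightarrow> f w = qexp (w * of_int h / 24) * F (qexp w)"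
    and h: "h < 24" "24 dvd h' - h" "h' \<le> h" "h' \<le> p\<^sup>2 * h"
  obtains \<phi> where
    "disc_fps (Abs_fps (\<lambda>n. hecke_coeff s (exponent_coeff h A) (24 * int n + h'))) \<phi>"
    "\<And>w. Im w > 0 \<Longrightarrow> hecke s f w = qexp (w * of_int h' / 24) * \<phi> (qexp w)"
proof -
  define c where "c = hecke_coeff s (exponent_coeff h A)"
  have "((\<lambda>n. of_int (c (24 * int n + h')) * qexp w ^ n) has_sum
      hecke s f w / qexp (w * of_int h' / 24)) UNIV" if "Im w > 0" for w
  proof -
    have "((\<lambda>e. of_int (c e) * qexp (w * of_int e / 24)) has_sum hecke s f w) UNIV"
      unfolding c_def using that
      by (intro hecke_has_sum) (simp_all add: f exponent_coeff_has_sum [OF A])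
    moreover have "24 dvd e - h' \<and> h' \<le> e" if "c e \<noteq> 0" for e
      using that unfolding c_def by (rule hecke_coeff_support [OF h])
    ultimately show ?thesis
      using has_sum_exponents_iff [of c h' w "hecke s f w / qexp (w * of_int h' / 24)"] by simp
  qed
  then obtain \<phi> where "disc_fps (Abs_fps (\<lambda>n. c (24 * int n + h'))) \<phi>"
      "\<And>w. Im w > 0 \<Longrightarrow> hecke s f w / qexp (w * of_int h' / 24) = \<phi> (qexp w)"
    using disc_fps_of_has_sum_qexp [of "Abs_fps (\<lambda>n. c (24 * int n + h'))"
        "\<lambda>w. hecke s f w / qexp (w * of_int h' / 24)"] by auto
  then show ?thesis
    using that [of \<phi>] unfolding c_def
    by (metis nonzero_mult_div_cancel_left qexp_nonzero times_divide_eq_right)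
qed

end

section \<open>The congruence\<close>

definition hauptmodul :: "complex \<Rightarrow> complex" where
  "hauptmodul q = q * (euler (q\<^sup>2) / euler q) ^ 24"

lemma hauptmodul_qexp: "hauptmodul (qexp w) = (eta (2 * w) / eta w) ^ 24"
proof -
  define x where "x = qexp (w / 24)"
  have x: "x ^ 24 = qexp w" "qexp (2 * w / 24) = x ^ 2" "qexp (2 * w) = (qexp w)\<^sup>2" "x \<noteq> 0"
    using qexp_of_nat_mult [of 24 "w / 24"] qexp_of_nat_mult [of 2 "w / 24"]
      qexp_of_nat_mult [of 2 w]
    by (simp_all add: x_def)
  then have "eta (2 * w) / eta w = x * (euler ((qexp w)\<^sup>2) / euler (qexp w))"
    unfolding eta_def x_def [symmetric] by (simp add: power2_eq_square)
  then show ?thesis by (simp only: power_mult_distrib x hauptmodul_def)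
qed

lemma hauptmodul_fricke:
  assumes y: "y > 0"
  shows "2 ^ 12 * hauptmodul (qexp (\<i> * of_real (1 / (2 * y)))) =
    1 / hauptmodul (qexp (\<i> * of_real y))"
proof -
  define w z where "w = \<i> * complex_of_real (1 / (2 * y))" and "z = \<i> * complex_of_real y"
  have z: "eta z \<noteq> 0" "eta (2 * z) \<noteq> 0" using y by (auto intro!: eta_nonzero simp: z_def)
  have "eta (2 * w) = of_real (sqrt y) * eta z"
    using eta_transform_imaginary [OF y] by (simp add: w_def z_def)
  moreover have "eta w = of_real (sqrt (2 * y)) * eta (2 * z)"
    using eta_transform_imaginary [of "2 * y"] y by (simp add: w_def z_def mult_ac)
  ultimately have "eta (2 * w) / eta w = of_real (sqrt y / sqrt (2 * y)) * (eta z / eta (2 * z))"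
    by simp
  also have "sqrt y / sqrt (2 * y) = 1 / sqrt 2" using y by (simp add: real_sqrt_mult)
  finally have "(eta (2 * w) / eta w) * (eta (2 * z) / eta z) = of_real (1 / sqrt 2)"
    using z by simp
  then have "((eta (2 * w) / eta w) * (eta (2 * z) / eta z)) ^ 24 = of_real ((1 / sqrt 2) ^ 24)"
    by (simp only: of_real_power)
  also have "(1 / sqrt 2) ^ 24 = ((1 / sqrt 2)\<^sup>2) ^ 12" by (simp only: power_mult [symmetric]) simp
  also have "\<dots> = (1 / 2 ^ 12 :: real)" by (simp add: power_divide)
  finally have product: "hauptmodul (qexp w) * hauptmodul (qexp z) = 1 / 2 ^ 12"
    by (simp only: hauptmodul_qexp power_mult_distrib of_real_divide of_real_1 of_real_power
        of_real_numeral)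
  then have "hauptmodul (qexp z) \<noteq> 0" by auto
  with product have "2 ^ 12 * hauptmodul (qexp w) = 1 / hauptmodul (qexp z)"
    by (simp add: field_simps)
  then show ?thesis by (simp only: w_def z_def)
qed

lemma disc_fps_hauptmodul:
  obtains T where "fps_nth T 0 = 0" "fps_nth T 1 = 1" "disc_fps T hauptmodul"
proof -
  obtain E where E: "fps_nth E 0 = 1" "disc_fps E (\<lambda>q. (euler (q\<^sup>2) / euler q) ^ 24)"
    by (rule disc_fps_euler_quotient)
  have "disc_fps (fps_X * E) hauptmodul"
    using disc_fps_mult [OF disc_fps_X E(2)] by (simp add: hauptmodul_def [abs_def])
  with E(1) show ?thesis by (intro that) simp_all
qed

lemma fps_expand_in_powers:
  fixes S T :: "'a::comm_ring_1 fps"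
  assumes T: "fps_nth T 0 = 0" "fps_nth T 1 = 1"
  shows "\<exists>r. fps_X ^ n dvd S - (\<Sum>j<n. fps_const (r j) * T ^ j)"
proof (induction n)
  case (Suc n)
  then obtain r where r: "fps_X ^ n dvd S - (\<Sum>j<n. fps_const (r j) * T ^ j)" by blast
  define D where "D = S - (\<Sum>j<n. fps_const (r j) * T ^ j)"
  define r' where "r' = r(n := fps_nth D n)"
  have "(\<Sum>j<n. fps_const (r' j) * T ^ j) = (\<Sum>j<n. fps_const (r j) * T ^ j)"
    by (intro sum.cong) (auto simp: r'_def)
  then have remainder:
    "S - (\<Sum>j<Suc n. fps_const (r' j) * T ^ j) = D - fps_const (fps_nth D n) * T ^ n"
    by (simp add: D_def r'_def)
  have "fps_nth (D - fps_const (fps_nth D n) * T ^ n) i = 0" if "i < Suc n" for i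
  proof (cases "i = n")
    case True
    then show ?thesis using startsby_zero_power_nth_same [OF T(1), of n] T(2) by simp
  next
    case False
    then have "i < n" using that by simp
    moreover from this have "fps_nth D i = 0"
      using r unfolding D_def [symmetric] fps_X_power_dvd_iff_nth by blast
    ultimately show ?thesis using startsby_zero_power_prefix [OF T(1), of n] by simp
  qed
  then have "fps_X ^ Suc n dvd S - (\<Sum>j<Suc n. fps_const (r' j) * T ^ j)"
    unfolding remainder fps_X_power_dvd_iff_nth by blast
  then show ?case by blast
qed auto

lemma disc_fps_expand_in_hauptmodul:
  assumes S: "disc_fps S \<Psi>"
  obtains r :: "nat \<Rightarrow> int" and g \<gamma> where "disc_fps g \<gamma>"
    "\<And>q. norm q < 1 \<Longrightarrow> \<Psi> q - (\<Sum>j\<le>M. of_int (r j) * hauptmodul q ^ j) = q ^ Suc M * \<gamma> q"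
proof -
  obtain T where T: "fps_nth T 0 = 0" "fps_nth T 1 = 1" "disc_fps T hauptmodul"
    by (rule disc_fps_hauptmodul)
  obtain r where r: "fps_X ^ Suc M dvd S - (\<Sum>j<Suc M. fps_const (r j) * T ^ j)"
    using fps_expand_in_powers [OF T(1,2)] by blast
  have "disc_fps (S - (\<Sum>j<Suc M. fps_const (r j) * T ^ j))
      (\<lambda>q. \<Psi> q - (\<Sum>j<Suc M. of_int (r j) * hauptmodul q ^ j))"
    by (intro disc_fps_diff disc_fps_sum disc_fps_mult disc_fps_power disc_fps_const S T(3))
  then obtain g \<gamma> where "disc_fps g \<gamma>"
    "\<And>q. norm q < 1 \<Longrightarrow> \<Psi> q - (\<Sum>j<Suc M. of_int (r j) * hauptmodul q ^ j) = q ^ Suc M * \<gamma> q"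
    by (rule disc_fps_dividend_X_power [OF _ r]) blast
  then show ?thesis
    unfolding lessThan_Suc_atMost by (rule that)
qed

text \<open>
  The principal part of \<open>\<Psi> / t ^ M\<close> at \<open>q = 0\<close> is a polynomial in \<open>1/t\<close>, which the involution
  sends to a polynomial in \<open>2 ^ 12 * t\<close>.
\<close>

theorem fricke_polynomial_in_hauptmodul:
  assumes \<Phi>: "\<Phi> holomorphic_on ball 0 1" and S: "disc_fps S \<Psi>"
    and fricke: "\<And>y. y > 0 \<Longrightarrow> \<Phi> (qexp (\<i> * of_real (1 / (2 * y)))) =
      \<Psi> (qexp (\<i> * of_real y)) / hauptmodul (qexp (\<i> * of_real y)) ^ M"
  obtains r :: "nat \<Rightarrow> int" where
    "\<And>q. norm q < 1 \<Longrightarrow> \<Phi> q = (\<Sum>k\<le>M. of_int (r k) * (2 ^ 12 * hauptmodul q) ^ k)"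
proof -
  define \<epsilon> where "\<epsilon> q = (euler (q\<^sup>2) / euler q) ^ 24" for q
  have \<epsilon>: "\<epsilon> q \<noteq> 0" if "norm q < 1" for q
    using that by (simp add: \<epsilon>_def euler_nonzero euler_square_nonzero)
  have t: "hauptmodul q = q * \<epsilon> q" for q by (simp add: hauptmodul_def \<epsilon>_def)
  obtain E where "disc_fps E (\<lambda>q. (euler (q\<^sup>2) / euler q) ^ 24)"
    by (rule disc_fps_euler_quotient)
  then have \<epsilon>_holomorphic: "\<epsilon> holomorphic_on ball 0 1"
    unfolding \<epsilon>_def [abs_def] by (rule disc_fps_holomorphic)
  obtain r g \<gamma> where \<gamma>: "disc_fps g \<gamma>"
    "\<And>q. norm q < 1 \<Longrightarrow> \<Psi> q - (\<Sum>j\<le>M. of_int (r j) * hauptmodul q ^ j) = q ^ Suc M * \<gamma> q"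
    by (rule disc_fps_expand_in_hauptmodul [OF S]) (rule that)
  define H where "H q = \<Phi> q - (\<Sum>j\<le>M. of_int (r j) * (2 ^ 12 * hauptmodul q) ^ (M - j))" for q
  define H' where "H' q = q * \<gamma> q / \<epsilon> q ^ M" for q
  have "H q = 0" if "norm q < 1" for q
  proof (rule fricke_pair_vanishes [of H H'])
    show "H holomorphic_on ball 0 1"
      unfolding H_def t by (intro holomorphic_intros \<Phi> \<epsilon>_holomorphic)
    show "H' holomorphic_on ball 0 1"
      unfolding H'_def using \<epsilon>
      by (intro holomorphic_intros \<epsilon>_holomorphic disc_fps_holomorphic [OF \<gamma>(1)]) auto
    show "H' 0 = 0" by (simp add: H'_def)
    fix y :: real assume y: "y > 0"
    define u v where "u = qexp (\<i> * of_real (1 / (2 * y)))" and "v = qexp (\<i> * of_real y)"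
    have v: "norm v < 1" "v \<noteq> 0" using y by (simp_all add: v_def norm_qexp_less_1)
    have tv: "hauptmodul v \<noteq> 0" using v \<epsilon> by (simp add: t)
    have inverse: "2 ^ 12 * hauptmodul u = 1 / hauptmodul v"
      unfolding u_def v_def using y by (rule hauptmodul_fricke)
    have "(2 ^ 12 * hauptmodul u) ^ (M - j) = hauptmodul v ^ j / hauptmodul v ^ M" if "j \<le> M" for j
      unfolding inverse using tv that by (simp add: power_diff field_simps)
    moreover have "\<Phi> u = \<Psi> v / hauptmodul v ^ M"
      unfolding u_def v_def using y by (rule fricke)
    ultimately have "H u = (\<Psi> v - (\<Sum>j\<le>M. of_int (r j) * hauptmodul v ^ j)) / hauptmodul v ^ M"
      by (simp add: H_def diff_divide_distrib sum_divide_distrib)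
    also have "\<dots> = H' v"
      unfolding \<gamma>(2) [OF v(1)] using v by (simp add: H'_def t power_mult_distrib)
    finally show "H (qexp (\<i> * of_real (1 / (2 * y)))) = H' (qexp (\<i> * of_real y))"
      by (simp only: u_def v_def)
  qed (rule that)
  moreover have "(\<Sum>j\<le>M. of_int (r j) * (2 ^ 12 * hauptmodul q) ^ (M - j)) =
      (\<Sum>k\<le>M. of_int (r (M - k)) * (2 ^ 12 * hauptmodul q) ^ k)" for q
    by (rule sum.reindex_bij_witness [of _ "\<lambda>k. M - k" "\<lambda>k. M - k"]) auto
  ultimately show ?thesis
    using that [of "\<lambda>k. r (M - k)"] by (simp add: H_def)
qed

lemma fps_nth_mult_polynomial_cong:
  fixes A T :: "int fps"
  shows "[fps_nth (A * (\<Sum>k\<le>M. fps_const (r k * c ^ k) * T ^ k)) n = r 0 * fps_nth A n] (mod c)"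
proof -
  define Q where "Q = (\<Sum>k<M. fps_const (r (Suc k) * c ^ k) * T ^ Suc k)"
  have "(\<Sum>k\<le>M. fps_const (r k * c ^ k) * T ^ k) = fps_const (r 0) + fps_const c * Q"
    unfolding Q_def sum_distrib_left sum.atMost_shift
    by (simp add: fps_const_mult [symmetric] mult_ac del: fps_const_mult)
  then have "A * (\<Sum>k\<le>M. fps_const (r k * c ^ k) * T ^ k) =
      fps_const (r 0) * A + fps_const c * (A * Q)"
    by (simp only: ring_distribs mult_ac)
  then show ?thesis by (simp add: cong_def)
qed

lemma alpha_gf_nth_0: "fps_nth alpha_gf 0 = 1"
  using disc_fps_at_0 [OF disc_fps_alpha_prod] disc_fps_at_0 [OF disc_fps_euler]
  by (simp add: alpha_prod_def)

lemma exponent_coeff_alpha: "exponent_coeff 4 alpha_gf e = alpha (of_int (e - 4) / 24)"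
proof (cases "24 dvd e - 4 \<and> 4 \<le> e")
  case True
  then obtain n where n: "e = 24 * int n + 4" unfolding exponents_iff by blast
  then have "of_int (e - 4) / 24 = (of_nat n :: rat)" by simp
  then show ?thesis using n by (simp only: alpha_of_nat) (simp add: exponent_coeff_def)
next
  case False
  have "of_int (e - 4) / 24 \<notin> (\<nat> :: rat set)"
  proof
    assume "of_int (e - 4) / 24 \<in> (\<nat> :: rat set)"
    then obtain n where "of_int (e - 4) / 24 = (of_nat n :: rat)" by (elim Nats_cases)
    then have "rat_of_int (e - 4) = of_int (24 * int n)" by (simp add: field_simps)
    then have "e = 24 * int n + 4" by (simp only: of_int_eq_iff)
    with False show False unfolding exponents_iff by blast
  qed
  then show ?thesis using False by (auto simp: alpha_def exponent_coeff_def)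
qed

context prime_gt_3
begin

definition hecke_alpha_fps :: "int fps" where
  "hecke_alpha_fps =
     Abs_fps (\<lambda>n. hecke_coeff (Legendre 6 p) (exponent_coeff 4 alpha_gf) (24 * int n + 4))"

lemma hecke_eta_quot_expansion:
  obtains \<phi> where "disc_fps hecke_alpha_fps \<phi>"
    "\<And>w. Im w > 0 \<Longrightarrow> hecke (Legendre 6 p) eta_quot w = qexp (w * of_int 4 / 24) * \<phi> (qexp w)"
  unfolding hecke_alpha_fps_def
  by (rule hecke_expansion [OF disc_fps_alpha_prod, of eta_quot 4 4 "Legendre 6 p"])
     (use pos in \<open>simp_all add: eta_quot_eq one_le_power\<close>)

lemma hecke_eta_quot_dual_expansion:
  obtains b \<psi> where "disc_fps b \<psi>"
    "\<And>w. Im w > 0 \<Longrightarrow>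
       hecke (Legendre 3 p) eta_quot_dual w = qexp (w * of_int (- (p\<^sup>2)) / 24) * \<psi> (qexp w)"
proof -
  obtain B where B: "disc_fps B dual_prod" by (rule disc_fps_dual_prod)
  show ?thesis
    by (rule hecke_expansion [OF B, of eta_quot_dual "- 1" "- (p\<^sup>2)" "Legendre 3 p"])
       (use that square_mod_24 pos in
         \<open>simp_all add: eta_quot_dual_eq dvd_diff_commute one_le_power\<close>)
qed

lemma hecke_quotient_fricke:
  fixes y :: real
  defines "u \<equiv> qexp (\<i> * of_real (1 / (2 * y)))" and "v \<equiv> qexp (\<i> * of_real y)"
  assumes M: "p\<^sup>2 = 24 * int M + 1" and y: "y > 0"
    and \<phi>: "\<And>w. Im w > 0 \<Longrightarrow>
      hecke (Legendre 6 p) eta_quot w = qexp (w * of_int 4 / 24) * \<phi> (qexp w)"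
    and \<psi>: "\<And>w. Im w > 0 \<Longrightarrow>
      hecke (Legendre 3 p) eta_quot_dual w = qexp (w * of_int (- (p\<^sup>2)) / 24) * \<psi> (qexp w)"
  shows "\<phi> u / alpha_prod u = \<psi> v / dual_prod v / v ^ M"
proof -
  define w z where "w = \<i> * complex_of_real (1 / (2 * y))" and "z = \<i> * complex_of_real y"
  define \<rho> where "\<rho> = complex_of_real (sqrt y) / 2"
  have \<rho>: "\<rho> \<noteq> 0" using y by (simp add: \<rho>_def)
  have im: "Im w > 0" "Im z > 0" using y by (simp_all add: w_def z_def)
  have "z * of_int (- (p\<^sup>2)) / 24 + of_nat M * z = - z / 24"
    unfolding M by (simp add: field_simps)
  then have "qexp (z * of_int (- (p\<^sup>2)) / 24) * v ^ M = qexp (- z / 24)"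
    by (metis qexp_add qexp_of_nat_mult v_def z_def)
  then have shift: "qexp (z * of_int (- (p\<^sup>2)) / 24) = qexp (- z / 24) / v ^ M"
    by (simp add: v_def field_simps)
  have "hecke (Legendre 6 p) eta_quot w = \<rho> * hecke (Legendre 3 p) eta_quot_dual z"
    unfolding \<rho>_def by (rule hecke_eta_quot_transform [OF y w_def z_def])
  then have "qexp (w / 6) * \<phi> u = \<rho> * (qexp (- z / 24) / v ^ M * \<psi> v)"
    unfolding \<phi> [OF im(1)] \<psi> [OF im(2)] shift by (simp add: u_def v_def w_def z_def)
  moreover have "qexp (w / 6) * alpha_prod u = \<rho> * (qexp (- z / 24) * dual_prod v)"
    using eta_quot_transform_imaginary [OF y]
    unfolding eta_quot_eq eta_quot_dual_eq
    by (simp add: u_def v_def w_def z_def \<rho>_def)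
  ultimately have "(qexp (w / 6) * \<phi> u) / (qexp (w / 6) * alpha_prod u) =
      (\<rho> * qexp (- z / 24) * (\<psi> v / v ^ M)) / (\<rho> * qexp (- z / 24) * dual_prod v)"
    by simp
  then show ?thesis using \<rho> by simp
qed

lemma hecke_quotient_polynomial:
  assumes \<phi>: "disc_fps hecke_alpha_fps \<phi>"
    "\<And>w. Im w > 0 \<Longrightarrow> hecke (Legendre 6 p) eta_quot w = qexp (w * of_int 4 / 24) * \<phi> (qexp w)"
  obtains M and r :: "nat \<Rightarrow> int" where
    "\<And>q. norm q < 1 \<Longrightarrow> \<phi> q / alpha_prod q = (\<Sum>k\<le>M. of_int (r k) * (2 ^ 12 * hauptmodul q) ^ k)"
proof -
  obtain k where k: "p\<^sup>2 - 1 = 24 * k" using square_mod_24 by (elim dvdE)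
  define M where "M = nat k"
  have "1 \<le> p\<^sup>2" using pos by (simp add: one_le_power)
  with k have M: "p\<^sup>2 = 24 * int M + 1" by (simp add: M_def)
  obtain B where B: "fps_nth B 0 = 1" "disc_fps B dual_prod" by (rule disc_fps_dual_prod)
  obtain b \<psi> where \<psi>: "disc_fps b \<psi>"
    "\<And>w. Im w > 0 \<Longrightarrow>
       hecke (Legendre 3 p) eta_quot_dual w = qexp (w * of_int (- (p\<^sup>2)) / 24) * \<psi> (qexp w)"
    using hecke_eta_quot_dual_expansion by blast
  obtain E where E: "disc_fps E (\<lambda>q. (euler (q\<^sup>2) / euler q) ^ 24)"
    by (rule disc_fps_euler_quotient)
  obtain S where S: "disc_fps S (\<lambda>q. \<psi> q / dual_prod q)"
    using disc_fps_divide [OF \<psi>(1) B(2) B(1)] dual_prod_nonzero by blast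
  have holomorphic: "(\<lambda>q. \<phi> q / alpha_prod q) holomorphic_on ball 0 1"
    using disc_fps_holomorphic [OF \<phi>(1)] disc_fps_holomorphic [OF disc_fps_alpha_prod]
    by (intro holomorphic_on_divide) (auto simp: alpha_prod_nonzero)
  have expansion:
    "disc_fps (S * E ^ M) (\<lambda>q. \<psi> q / dual_prod q * ((euler (q\<^sup>2) / euler q) ^ 24) ^ M)"
    by (intro disc_fps_mult disc_fps_power S E)
  have fricke: "\<phi> u / alpha_prod u =
      \<psi> v / dual_prod v * ((euler (v\<^sup>2) / euler v) ^ 24) ^ M / hauptmodul v ^ M"
    if y: "y > 0" and u: "u = qexp (\<i> * of_real (1 / (2 * y)))" and v: "v = qexp (\<i> * of_real y)"
    for y u v
  proof -
    have "norm v < 1" using y by (simp add: v norm_qexp_less_1)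
    then have "(euler (v\<^sup>2) / euler v) ^ 24 \<noteq> 0"
      by (simp add: euler_nonzero euler_square_nonzero)
    moreover have "\<phi> u / alpha_prod u = \<psi> v / dual_prod v / v ^ M"
      unfolding u v by (rule hecke_quotient_fricke [OF M y \<phi>(2) \<psi>(2)])
    ultimately show ?thesis
      by (simp only: hauptmodul_def power_mult_distrib) simp
  qed
  show ?thesis
    by (rule fricke_polynomial_in_hauptmodul [OF holomorphic expansion fricke [OF _ refl refl]])
       (use that in blast)+
qed

theorem hecke_alpha_fps_expansion:
  obtains M r T where
    "hecke_alpha_fps = alpha_gf * (\<Sum>k\<le>M. fps_const (r k * (2 ^ 12) ^ k) * T ^ k)"
proof -
  obtain \<phi> where \<phi>: "disc_fps hecke_alpha_fps \<phi>"
    "\<And>w. Im w > 0 \<Longrightarrow> hecke (Legendre 6 p) eta_quot w = qexp (w * of_int 4 / 24) * \<phi> (qexp w)"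
    using hecke_eta_quot_expansion by blast
  obtain M r where
    r: "\<And>q. norm q < 1 \<Longrightarrow> \<phi> q / alpha_prod q = (\<Sum>k\<le>M. of_int (r k) * (2 ^ 12 * hauptmodul q) ^ k)"
    using hecke_quotient_polynomial [OF \<phi>] by blast
  obtain T where T: "disc_fps T hauptmodul" by (rule disc_fps_hauptmodul)
  have "disc_fps (alpha_gf * (\<Sum>k\<le>M. fps_const (r k * (2 ^ 12) ^ k) * T ^ k))
      (\<lambda>q. alpha_prod q * (\<Sum>k\<le>M. of_int (r k * (2 ^ 12) ^ k) * hauptmodul q ^ k))"
    by (intro disc_fps_mult disc_fps_sum disc_fps_power disc_fps_const disc_fps_alpha_prod T)
  moreover have "alpha_prod q * (\<Sum>k\<le>M. of_int (r k * (2 ^ 12) ^ k) * hauptmodul q ^ k) = \<phi> q"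
    if "norm q < 1" for q
  proof -
    have "\<phi> q = alpha_prod q * (\<phi> q / alpha_prod q)" using alpha_prod_nonzero [OF that] by simp
    then show ?thesis unfolding r [OF that] by (simp add: power_mult_distrib mult.assoc)
  qed
  ultimately have "disc_fps (alpha_gf * (\<Sum>k\<le>M. fps_const (r k * (2 ^ 12) ^ k) * T ^ k)) \<phi>"
    by (rule disc_fps_cong)
  with \<phi>(1) that show ?thesis using disc_fps_unique by blast
qed

corollary hecke_alpha_fps_cong:
  "[fps_nth hecke_alpha_fps n = fps_nth hecke_alpha_fps 0 * fps_nth alpha_gf n] (mod 2 ^ 12)"
proof -
  obtain M r T where
    expansion: "hecke_alpha_fps = alpha_gf * (\<Sum>k\<le>M. fps_const (r k * (2 ^ 12) ^ k) * T ^ k)"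
    by (rule hecke_alpha_fps_expansion)
  have coeff: "[fps_nth hecke_alpha_fps k = r 0 * fps_nth alpha_gf k] (mod 2 ^ 12)" for k
    unfolding expansion by (rule fps_nth_mult_polynomial_cong)
  from coeff [of 0] have "[r 0 = fps_nth hecke_alpha_fps 0] (mod 2 ^ 12)"
    by (simp add: alpha_gf_nth_0 cong_sym)
  then have
    "[r 0 * fps_nth alpha_gf n = fps_nth hecke_alpha_fps 0 * fps_nth alpha_gf n] (mod 2 ^ 12)"
    by (rule cong_scalar_right)
  with coeff [of n] show ?thesis by (rule cong_trans)
qed

lemma Legendre_4: "Legendre 4 p = 1"
  using Legendre_square [OF not_dvd_2] by simp

context
  fixes l :: nat
  assumes l: "p = int l"
begin

lemma six_N: "6 * N_ell l = p\<^sup>2 - 1"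
  using six_N_ell [of l] prime gt_3 by (simp add: l)

lemma six_N_rat: "6 * rat_of_int (N_ell l) = of_nat l ^ 2 - 1"
  using arg_cong [OF six_N, of rat_of_int] by (simp add: l)

lemma Legendre_exponent:
  "Legendre 6 p * Legendre (24 * n + 4) p = Legendre (-1) p * Legendre (N_ell l - n) p"
proof -
  have "24 * n + 4 - (- 1) * (4 * 6) * (N_ell l - n) = p * (4 * p)"
    using six_N by (simp add: power2_eq_square)
  then have "Legendre (24 * n + 4) p = Legendre ((- 1) * (4 * 6) * (N_ell l - n)) p"
    by (intro Legendre.cong) (simp add: cong_iff_dvd_diff)
  also have "\<dots> = Legendre (-1) p * (Legendre 4 p * Legendre 6 p) * Legendre (N_ell l - n) p"
    by (simp only: Legendre_mult)
  finally have "Legendre (24 * n + 4) p = Legendre (-1) p * Legendre 6 p * Legendre (N_ell l - n) p"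
    by (simp add: Legendre_4)
  moreover have "Legendre 6 p * Legendre 6 p = 1"
    using not_dvd_2_3_smooth [of 1 1] by (intro Legendre_mult_self) simp
  ultimately show ?thesis by (simp add: mult_ac)
qed

lemma alpha_dilated_exponent:
  assumes e: "e = 24 * int n + 4"
  shows "(if p\<^sup>2 dvd e then alpha (of_int (e div p\<^sup>2 - 4) / 24) else 0) =
    alpha ((of_nat n - of_int (N_ell l)) / of_nat l ^ 2)"
proof -
  define x where "x = (of_nat n - rat_of_int (N_ell l)) / of_nat l ^ 2"
  have "rat_of_int e = 24 * (of_nat n - of_int (N_ell l)) + 4 * of_nat l ^ 2"
    using six_N_rat by (simp add: e)
  then have x: "x = (of_int e / of_int (p\<^sup>2) - 4) / 24"
    using pos by (simp add: x_def l add_divide_distrib del: right_diff_distrib_numeral)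
  have "p\<^sup>2 dvd e" if "x \<in> \<nat>"
  proof -
    from that obtain k where "x = of_nat k" by (elim Nats_cases)
    then have "rat_of_int e = of_int (p\<^sup>2 * (24 * int k + 4))"
      using pos unfolding x by (simp add: field_simps)
    then show "p\<^sup>2 dvd e" by (simp only: of_int_eq_iff) simp
  qed
  moreover have "of_int (e div p\<^sup>2 - 4) / 24 = x" if "p\<^sup>2 dvd e"
    using that pos unfolding x by (auto elim!: dvdE)
  ultimately show ?thesis by (auto simp: alpha_def x_def [symmetric])
qed

lemma hecke_alpha_fps_nth:
  "fps_nth hecke_alpha_fps n = int l * alpha (of_nat l ^ 2 * of_nat n + of_int (N_ell l))
     + Legendre (-1) (int l) * Legendre (N_ell l - int n) (int l) * alpha (of_nat n)
     + alpha ((of_nat n - of_int (N_ell l)) / of_nat l ^ 2)"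
proof -
  define e where "e = 24 * int n + 4"
  have "of_int (p\<^sup>2 * e - 4) / 24 = (of_nat l ^ 2 * of_nat n + of_int (N_ell l) :: rat)"
    using six_N_rat by (simp add: l e_def field_simps)
  moreover have "of_int (e - 4) / 24 = (of_nat n :: rat)"
    by (simp add: e_def)
  ultimately have "fps_nth hecke_alpha_fps n =
      p * alpha (of_nat l ^ 2 * of_nat n + of_int (N_ell l))
        + (Legendre 6 p * Legendre e p) * alpha (of_nat n)
        + alpha ((of_nat n - of_int (N_ell l)) / of_nat l ^ 2)"
    by (simp only: hecke_alpha_fps_def fps_nth_Abs_fps hecke_coeff_def e_def [symmetric]
        exponent_coeff_alpha alpha_dilated_exponent [OF e_def])
  then show ?thesis
    unfolding e_def Legendre_exponent by (simp only: l)
qed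

lemma hecke_alpha_fps_nth_0: "fps_nth hecke_alpha_fps 0 = c_ell l"
proof -
  have "of_int (p\<^sup>2 * 4 - 4) / 24 = rat_of_int (N_ell l)"
    using six_N_rat by (simp add: l)
  moreover have "\<not> p\<^sup>2 dvd 4"
  proof
    assume "p\<^sup>2 dvd 4"
    then have "p dvd 4" using dvd_trans [of p "p\<^sup>2" 4] by simp
    then show False using not_dvd_2 dvd_mult_iff [of 2 2] by simp
  qed
  ultimately have "fps_nth hecke_alpha_fps 0 = p * alpha (of_int (N_ell l)) + Legendre 6 p"
    using alpha_of_nat [of 0] Legendre_4
    by (simp add: hecke_alpha_fps_def hecke_coeff_def exponent_coeff_alpha alpha_gf_nth_0)
  then show ?thesis by (simp add: c_ell_def l)
qed

end

end

theorem theorem1p1: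
  fixes l n :: nat
  assumes "prime l" and "l > 3"
  shows "[int l * alpha (of_nat l ^ 2 * of_nat n + of_int (N_ell l))
          + Legendre (-1) (int l) * Legendre (N_ell l - int n) (int l) * alpha (of_nat n)
          + alpha ((of_nat n - of_int (N_ell l)) / of_nat l ^ 2)
        = c_ell l * alpha (of_nat n)] (mod 2 ^ 12)"
proof -
  interpret prime_gt_3 "int l"
    by unfold_locales (use assms in auto)
  show ?thesis
    using hecke_alpha_fps_cong [of n]
    unfolding hecke_alpha_fps_nth_0 [OF refl]
    unfolding hecke_alpha_fps_nth [OF refl] alpha_of_nat .
qed

end
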